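(* Let $A$, $F$, $\sigma$, $L$, $N$, $P$, $Q$ and the noise be as in the context, and fix $\alpha\in(1,2)$. Assume that the spectral gap condition $$\lambda_{N+1}-\lambda_N\ \ge\ \frac{2L}{\mu}\Big(\lambda_N^\sigma+\sigma^\sigma\Gamma(1-\sigma)(\lambda_{N+1}-\lambda_N)^\sigma+\lambda_{N+1}^\sigma\Big)$$ holds for some $\mu\in(0,1)$. Then there exists a Lipschitz inertial manifold for the random equation $$\frac{du^\alpha}{dt}+Au^\alpha=z(\theta_t\omega_{\ell^\alpha})u^\alpha+G(\theta_t\omega_{\ell^\alpha},u^\alpha),$$ which is given by $$\mathscr M^\alpha(\omega_{\ell^\alpha})=\{\xi+\psi^\alpha(\omega_{\ell^\alpha},\xi)\mid\xi\in PD(A^\sigma)\},$$ where $\mathscr M^\alpha(\omega_{\ell^\alpha})$ is the set defined in the context, $\psi^\alpha(\omega_{\ell^\alpha},\cdot):PD(A^\sigma)\to QD(A^\sigma)$ is Lipschitz continuous, and $\psi^\alpha$ is measurable in $(\omega_{\ell^\alpha},\xi)$. Furthermore, $\widetilde{\mathscr M}^\alpha(\omega_{\ell^\alpha})=e^{z(\omega_{\ell^\alpha})}\mathscr M^\alpha(\omega_{\ell^\alpha})$, i.e. $$\widetilde{\mathscr M}^\alpha(\omega_{\ell^\alpha})=\{\xi+e^{z(\omega_{\ell^\alpha})}\psi^\alpha(\omega_{\ell^\alpha},e^{-z(\omega_{\ell^\alpha})}\xi)\mid\xi\in PD(A^\sigma)\},$$ is a Lipschitz inertial manifold of the equation $\frac{dv^\alpha}{dt}+Av^\alpha=F(v^\alpha)+v^\alpha\diamond\dot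 W_{S^\alpha_t}$. In addition, if $F\in C^1$, then $\mathscr M^\alpha(\omega_{\ell^\alpha})$ is a $C^1$ inertial manifold for the random equation, i.e. $\psi^\alpha(\omega_{\ell^\alpha},\xi)$ is $C^1$ in $\xi$; consequently, $\widetilde{\mathscr M}^\alpha(\omega_{\ell^\alpha})$ is a $C^1$ inertial manifold of $\frac{dv^\alpha}{dt}+Av^\alpha=F(v^\alpha)+v^\alpha\diamond\dot W_{S^\alpha_t}$.
   Context: **Operator and nonlinearity.** $H$ is a separable Hilbert space with norm $\|\cdot\|$. There is an orthonormal basis $\{e_k\}$ of $H$ with $Ae_k=\lambda_ke_k$, $0<\lambda_1\le\lambda_2\le\cdots$, $\lambda_k\to+\infty$. $D(A^\sigma)$ carries the norm $\|u\|_\sigma=\|A^\sigma u\|$. $0\le\sigma<1$, and $F:D(A^\sigma)\to H$ satisfies $F(0)=0$ and $\|F(u_1)-F(u_2)\|\le L\|u_1-u_2\|_\sigma$ for all $u_1,u_2\in D(A^\sigma)$, with $L>0$. $F\in C^1$ means $C^1$ from $D(A^\sigma)$ to $H$. $N\ge1$ is a fixed integer with $\lambda_N<\lambda_{N+1}$, $P$ is the orthogonal projector onto $\mathrm{span}\{e_1,\dots,e_N\}$, $Q=I-P$. When $\sigma=0$, $\sigma^\sigma=1$. **Noise.** $W$ is a two-sided standard one-dimensional Brownian motion with path $\omega\in\mathbb W$ (continuous functions $\mathbb R\to\mathbb R$ vanishing at $0$, Wiener measure $\mu_{\mathbb W}$); $S^\alpha$ is a two-sided $\frac\alpha2$-stable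 subordinator independent of $W$ with path $\ell^\alpha\in\mathbb S$ (increasing càdlàg functions $\mathbb R\to\mathbb R$ with limit $0$ at $0$, law $\mu_{\mathbb S}$), no drift and Lévy measure $C(\alpha)x^{-1-\alpha/2}dx$ on $(0,\infty)$, $C(\alpha)=\frac{1}{2^{1-\alpha/2}}\frac{\alpha}{\Gamma(1-\alpha/2)}$. $\Omega=\mathbb W\times\mathbb S$, $\mathbb P=\mu_{\mathbb W}\times\mu_{\mathbb S}$; $(\omega,\ell^\alpha)$ is written $\omega_{\ell^\alpha}$, and $W_{S^\alpha_t}=\omega_{\ell^\alpha_t}$. The shift is $\theta_t(\omega_{\ell^\alpha_s})=\omega_{\ell^\alpha_{t+s}}-\omega_{\ell^\alpha_t}$, i.e. $\theta_t(\omega,\ell^\alpha)=(\omega_{\ell^\alpha_t+\cdot}-\omega_{\ell^\alpha_t},\ \ell^\alpha_{t+\cdot}-\ell^\alpha_t)$; $(\Omega,\mathcal F,\mathbb P,\theta)$ is a metric dynamical system. Let $z(\omega_{\ell^\alpha})=-\int_{-\infty}^0e^s\omega_{\ell^\alpha_s}ds$, so $z(\theta_t\omega_{\ell^\alpha})=\omega_{\ell^\alpha_t}-\int_{-\infty}^0e^s\omega_{\ell^\alpha_{t+s}}ds$. $\Omega$ is restricted to a $\theta$-invariant set of full measure on which, as $t\to\pm\infty$, $\omega_{\ell^\alpha_t}/t\to0$, $z(\theta_t\omega_{\ell^\alpha})/t\to0$ and $\frac1t\int_0^tz(\theta_s\omega_{\ell^\alpha})ds\to0$. **Equations.** $G(\omega_{\ell^\alpha},u)=e^{-z(\omega_{\ell^\alpha})}F(e^{z(\omega_{\ell^\alpha})}u)$.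 $u^\alpha(t,\omega_{\ell^\alpha},x)$ denotes the solution of the random equation (in the variation-of-constants sense: $u(t)=e^{-A(t-\tau)+\int_\tau^tz(\theta_r\omega_{\ell^\alpha})dr}u(\tau)+\int_\tau^te^{-A(t-s)+\int_s^tz(\theta_r\omega_{\ell^\alpha})dr}G(\theta_s\omega_{\ell^\alpha},u(s))ds$ for $\tau\le t$) with value $x$ at $t=0$; it generates a random dynamical system. The Marcus equation ($\diamond$ is the Marcus integral) has solution $v^\alpha(t,\omega_{\ell^\alpha},x)=e^{z(\theta_t\omega_{\ell^\alpha})}u^\alpha(t,\omega_{\ell^\alpha},e^{-z(\omega_{\ell^\alpha})}x)$, which also generates a random dynamical system. **The set $\mathscr M^\alpha$.** Let $\beta=\lambda_N+\frac2\mu L\lambda_N^\sigma\in(\lambda_N,\lambda_{N+1})$ and $$\mathcal C_\beta^{\alpha,-}=\Big\{\varphi\in C((-\infty,0],D(A^\sigma)):\ \sup_{t\le0}e^{\beta t-\int_0^tz(\theta_r\omega_{\ell^\alpha})dr}\|\varphi(t)\|_\sigma<\infty\Big\},$$ with that supremum as norm. Then $\mathscr M^\alpha(\omega_{\ell^\alpha})=\{x\in D(A^\sigma): u^\alpha(\cdot,\omega_{\ell^\alpha},x)\in\mathcal C_\beta^{\alpha,-}\}$, i.e. the set of $x$ for which there is a solution of the random equation on $(-\infty,0]$ with value $x$ at $t=0$ lying in $\mathcal C_\beta^{\alpha,-}$. **Inertial manifolds.** For a random dynamical system $\phi(t,\omega,x)$ on the phase space $D(A^\sigma)$ over $\theta$: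 a random set is a family $M(\omega)$ of nonempty closed sets such that $\omega\mapsto\inf_{y\in M(\omega)}\|x-y\|_\sigma$ is a random variable for every $x$; it is invariant if $\phi(t,\omega,M(\omega))\subset M(\theta_t\omega)$ for all $t\ge0$. An invariant random set $M$ is a Lipschitz (resp. $C^1$) inertial manifold if (i) $M(\omega)=\{\xi+m(\omega,\xi):\xi\in H_1\}$ for a Lipschitz (resp. $C^1$) map $m(\omega,\cdot):H_1\to H_2$, where the phase space is $H_1\oplus H_2$ with $H_1$ finite-dimensional (here $H_1=PD(A^\sigma)$, $H_2=QD(A^\sigma)$); and (ii) there is a constant $b>0$ such that for every $x$ there is a random variable $K(\omega,x)$ with $\mathrm{dist}(\phi(t,\omega,x),M(\theta_t\omega))\le Ke^{-bt}$ for all $t\ge0$. *)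

theory Defs
  imports "HOL-Probability.Probability"
begin

section \<open>The operator and its fractional powers\<close>

text \<open>
  Eigenvectors and eigenvalues are numbered from 1; the values \<open>e 0\<close> and
  \<open>lam 0\<close> are never used, and series over \<open>k \<ge> 1\<close> are written with \<open>Suc k\<close>.
  The positive self-adjoint operator \<open>A\<close> with \<open>A e\<^sub>k = lam\<^sub>k e\<^sub>k\<close> is \<open>Apow e lam 1\<close>
  with domain \<open>Adom e lam 1\<close>.
\<close>

definition eigenbasis :: "(nat \<Rightarrow> 'a::real_inner) \<Rightarrow> (nat \<Rightarrow> real) \<Rightarrow> bool" where
  "eigenbasis e lam \<longleftrightarrow>
     (\<forall>i\<ge>1. \<forall>j\<ge>1. e i \<bullet> e j = (if i = j then 1 else 0)) \<and>
     closure (span (e ` {1..})) = UNIV \<and>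
     0 < lam 1 \<and> (\<forall>k\<ge>1. lam k \<le> lam (Suc k)) \<and> filterlim lam at_top sequentially"

definition Adom :: "(nat \<Rightarrow> 'a::real_inner) \<Rightarrow> (nat \<Rightarrow> real) \<Rightarrow> real \<Rightarrow> 'a set" where
  "Adom e lam s = {u. summable (\<lambda>k. (lam (Suc k) powr s * (u \<bullet> e (Suc k)))\<^sup>2)}"

definition Apow :: "(nat \<Rightarrow> 'a::real_inner) \<Rightarrow> (nat \<Rightarrow> real) \<Rightarrow> real \<Rightarrow> 'a \<Rightarrow> 'a" where
  "Apow e lam s u = (\<Sum>k. (lam (Suc k) powr s * (u \<bullet> e (Suc k))) *\<^sub>R e (Suc k))"

definition snorm :: "(nat \<Rightarrow> 'a::real_inner) \<Rightarrow> (nat \<Rightarrow> real) \<Rightarrow> real \<Rightarrow> 'a \<Rightarrow> real" where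
  "snorm e lam s u = norm (Apow e lam s u)"

definition expA :: "(nat \<Rightarrow> 'a::real_inner) \<Rightarrow> (nat \<Rightarrow> real) \<Rightarrow> real \<Rightarrow> 'a \<Rightarrow> 'a" where
  "expA e lam t u = (\<Sum>k. (exp (- lam (Suc k) * t) * (u \<bullet> e (Suc k))) *\<^sub>R e (Suc k))"

definition projP :: "(nat \<Rightarrow> 'a::real_inner) \<Rightarrow> nat \<Rightarrow> 'a \<Rightarrow> 'a" where
  "projP e N u = (\<Sum>k=1..N. (u \<bullet> e k) *\<^sub>R e k)"

definition projQ :: "(nat \<Rightarrow> 'a::real_inner) \<Rightarrow> nat \<Rightarrow> 'a \<Rightarrow> 'a" where
  "projQ e N u = u - projP e N u"


section \<open>Maps between normed subspaces\<close>

text \<open>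
  The phase space is a linear subspace of the ambient type with a norm of its own, so the
  type-class notions do not apply. Below, \<open>X\<close> and \<open>Y\<close> are carriers and \<open>nX\<close> and \<open>nY\<close> are norms
  on them; values of the norms outside the carriers carry no meaning.
\<close>

definition norm_topology :: "'a::real_vector set \<Rightarrow> ('a \<Rightarrow> real) \<Rightarrow> 'a topology" where
  "norm_topology X nX = Metric_space.mtopology X (\<lambda>x y. nX (x - y))"

definition norm_borel :: "'a::real_vector set \<Rightarrow> ('a \<Rightarrow> real) \<Rightarrow> 'a measure" where
  "norm_borel X nX = sigma X {U. openin (norm_topology X nX) U}"

definition lipschitz_map ::
  "'a::real_vector set \<Rightarrow> ('a \<Rightarrow> real) \<Rightarrow> 'b::real_vector set \<Rightarrow> ('b \<Rightarrow> real) \<Rightarrow> ('a \<Rightarrow> 'b) \<Rightarrow> bool" where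
  "lipschitz_map X nX Y nY f \<longleftrightarrow>
     f \<in> X \<rightarrow> Y \<and> (\<exists>C\<ge>0. \<forall>x\<in>X. \<forall>y\<in>X. nY (f x - f y) \<le> C * nX (x - y))"

definition bounded_linear_map ::
  "'a::real_vector set \<Rightarrow> ('a \<Rightarrow> real) \<Rightarrow> 'b::real_vector set \<Rightarrow> ('b \<Rightarrow> real) \<Rightarrow> ('a \<Rightarrow> 'b) \<Rightarrow> bool" where
  "bounded_linear_map X nX Y nY T \<longleftrightarrow>
     T \<in> X \<rightarrow> Y \<and>
     (\<forall>x\<in>X. \<forall>y\<in>X. T (x + y) = T x + T y) \<and>
     (\<forall>x\<in>X. \<forall>c. T (c *\<^sub>R x) = c *\<^sub>R T x) \<and>
     (\<exists>C. \<forall>x\<in>X. nY (T x) \<le> C * nX x)"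

text \<open>Continuously Frechet differentiable; \<open>Df\<close> is continuous in the operator norm.\<close>

definition C1_map ::
  "'a::real_vector set \<Rightarrow> ('a \<Rightarrow> real) \<Rightarrow> 'b::real_vector set \<Rightarrow> ('b \<Rightarrow> real) \<Rightarrow> ('a \<Rightarrow> 'b) \<Rightarrow> bool" where
  "C1_map X nX Y nY f \<longleftrightarrow>
     f \<in> X \<rightarrow> Y \<and>
     (\<exists>Df. \<forall>x\<in>X.
        bounded_linear_map X nX Y nY (Df x) \<and>
        (\<forall>\<epsilon>>0. \<exists>\<delta>>0. \<forall>h\<in>X. nX h < \<delta> \<longrightarrow> nY (f (x + h) - f x - Df x h) \<le> \<epsilon> * nX h) \<and>
        (\<forall>\<epsilon>>0. \<exists>\<delta>>0. \<forall>y\<in>X. nX (y - x) < \<delta> \<longrightarrow>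
           (\<forall>h\<in>X. nY (Df y h - Df x h) \<le> \<epsilon> * nX h)))"


section \<open>Random sets and inertial manifolds\<close>

text \<open>
  A random dynamical system is given by the probability space \<open>\<Omega>\<close>, the shift \<open>\<theta> t\<close>, the phase
  space \<open>D\<close> with norm \<open>nD\<close>, and the cocycle \<open>\<phi> t \<omega> x\<close>, used for \<open>t \<ge> 0\<close>.
\<close>

definition random_set ::
  "'w measure \<Rightarrow> 'a::real_vector set \<Rightarrow> ('a \<Rightarrow> real) \<Rightarrow> ('w \<Rightarrow> 'a set) \<Rightarrow> bool" where
  "random_set \<Omega> D nD M \<longleftrightarrow>
     (\<forall>\<omega>\<in>space \<Omega>. M \<omega> \<noteq> {} \<and> closedin (norm_topology D nD) (M \<omega>)) \<and>
     (\<forall>x\<in>D. (\<lambda>\<omega>. INF y\<in>M \<omega>. nD (x - y)) \<in> borel_measurable \<Omega>)"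

definition invariant_under ::
  "'w measure \<Rightarrow> (real \<Rightarrow> 'w \<Rightarrow> 'w) \<Rightarrow> (real \<Rightarrow> 'w \<Rightarrow> 'a \<Rightarrow> 'a) \<Rightarrow> ('w \<Rightarrow> 'a set) \<Rightarrow> bool" where
  "invariant_under \<Omega> \<theta> \<phi> M \<longleftrightarrow> (\<forall>\<omega>\<in>space \<Omega>. \<forall>t\<ge>0. \<phi> t \<omega> ` M \<omega> \<subseteq> M (\<theta> t \<omega>))"

definition attracts_exponentially ::
  "'w measure \<Rightarrow> (real \<Rightarrow> 'w \<Rightarrow> 'w) \<Rightarrow> 'a::real_vector set \<Rightarrow> ('a \<Rightarrow> real) \<Rightarrow>
   (real \<Rightarrow> 'w \<Rightarrow> 'a \<Rightarrow> 'a) \<Rightarrow> ('w \<Rightarrow> 'a set) \<Rightarrow> bool" where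
  "attracts_exponentially \<Omega> \<theta> D nD \<phi> M \<longleftrightarrow>
     (\<exists>b>0. \<forall>x\<in>D. \<exists>K\<in>borel_measurable \<Omega>. \<forall>\<omega>\<in>space \<Omega>. \<forall>t\<ge>0.
        (INF y\<in>M (\<theta> t \<omega>). nD (\<phi> t \<omega> x - y)) \<le> K \<omega> * exp (- b * t))"

definition finite_dim_splitting :: "'a::real_vector set \<Rightarrow> 'a set \<Rightarrow> 'a set \<Rightarrow> bool" where
  "finite_dim_splitting D H1 H2 \<longleftrightarrow>
     (\<exists>B. finite B \<and> H1 = span B) \<and> subspace H2 \<and> H1 \<inter> H2 = {0} \<and>
     D = {x + y | x y. x \<in> H1 \<and> y \<in> H2}"

definition lipschitz_inertial_manifold ::
  "'w measure \<Rightarrow> (real \<Rightarrow> 'w \<Rightarrow> 'w) \<Rightarrow> 'a::real_vector set \<Rightarrow> ('a \<Rightarrow> real) \<Rightarrow> 'a set \<Rightarrow> 'a set \<Rightarrow>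
   (real \<Rightarrow> 'w \<Rightarrow> 'a \<Rightarrow> 'a) \<Rightarrow> ('w \<Rightarrow> 'a set) \<Rightarrow> bool" where
  "lipschitz_inertial_manifold \<Omega> \<theta> D nD H1 H2 \<phi> M \<longleftrightarrow>
     finite_dim_splitting D H1 H2 \<and>
     random_set \<Omega> D nD M \<and> invariant_under \<Omega> \<theta> \<phi> M \<and>
     (\<exists>m. \<forall>\<omega>\<in>space \<Omega>. lipschitz_map H1 nD H2 nD (m \<omega>) \<and> M \<omega> = {\<xi> + m \<omega> \<xi> | \<xi>. \<xi> \<in> H1}) \<and>
     attracts_exponentially \<Omega> \<theta> D nD \<phi> M"

definition C1_inertial_manifold ::
  "'w measure \<Rightarrow> (real \<Rightarrow> 'w \<Rightarrow> 'w) \<Rightarrow> 'a::real_vector set \<Rightarrow> ('a \<Rightarrow> real) \<Rightarrow> 'a set \<Rightarrow> 'a set \<Rightarrow>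
   (real \<Rightarrow> 'w \<Rightarrow> 'a \<Rightarrow> 'a) \<Rightarrow> ('w \<Rightarrow> 'a set) \<Rightarrow> bool" where
  "C1_inertial_manifold \<Omega> \<theta> D nD H1 H2 \<phi> M \<longleftrightarrow>
     finite_dim_splitting D H1 H2 \<and>
     random_set \<Omega> D nD M \<and> invariant_under \<Omega> \<theta> \<phi> M \<and>
     (\<exists>m. \<forall>\<omega>\<in>space \<Omega>. C1_map H1 nD H2 nD (m \<omega>) \<and> M \<omega> = {\<xi> + m \<omega> \<xi> | \<xi>. \<xi> \<in> H1}) \<and>
     attracts_exponentially \<Omega> \<theta> D nD \<phi> M"


section \<open>The noise\<close>

type_synonym path = "real \<Rightarrow> real"

definition wiener_paths :: "path set" where
  "wiener_paths = {w. continuous_on UNIV w \<and> w 0 = 0}"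

text \<open>
  Right-continuity makes \<open>l 0 = 0\<close> the statement that the right limit at 0 is 0. A two-sided
  limit is not required: the shifted path \<open>s \<mapsto> l (t + s) - l t\<close> has left limit different from 0
  at 0 whenever \<open>l\<close> jumps at \<open>t\<close>, so the paths with two-sided limit 0 contain no shift-invariant
  set of full measure.
\<close>

definition subordinator_paths :: "path set" where
  "subordinator_paths =
     {l. mono l \<and> (\<forall>t. continuous (at_right t) l \<and> (\<exists>y. (l \<longlongrightarrow> y) (at_left t))) \<and> l 0 = 0}"

definition path_space :: "path set \<Rightarrow> path measure" where
  "path_space X = restrict_space (Pi\<^sub>M UNIV (\<lambda>_. borel)) X"

definition independent_increments :: "path measure \<Rightarrow> bool" where
  "independent_increments M \<longleftrightarrow>
     (\<forall>n. \<forall>t::nat \<Rightarrow> real. (\<forall>i<n. t i < t (Suc i)) \<longrightarrow>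
        prob_space.indep_vars M (\<lambda>_. borel) (\<lambda>i x. x (t (Suc i)) - x (t i)) {..<n})"

definition wiener_measure :: "path measure \<Rightarrow> bool" where
  "wiener_measure M \<longleftrightarrow>
     prob_space M \<and> space M = wiener_paths \<and> sets M = sets (path_space wiener_paths) \<and>
     independent_increments M \<and>
     (\<forall>s t. s < t \<longrightarrow> distributed M lborel (\<lambda>w. w t - w s) (normal_density 0 (sqrt (t - s))))"

definition levy_density :: "real \<Rightarrow> real \<Rightarrow> real" where
  "levy_density \<alpha> x =
     1 / 2 powr (1 - \<alpha> / 2) * (\<alpha> / Gamma (1 - \<alpha> / 2)) * x powr (- 1 - \<alpha> / 2)"

text \<open>
  The law of the two-sided driftless subordinator with Levy density \<open>levy_density \<alpha>\<close> on the
  positive half-line, given by the Levy-Khintchine formula for the Laplace transform of the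
  increments.
\<close>

definition stable_subordinator_law :: "real \<Rightarrow> path measure \<Rightarrow> bool" where
  "stable_subordinator_law \<alpha> M \<longleftrightarrow>
     prob_space M \<and> space M = subordinator_paths \<and> sets M = sets (path_space subordinator_paths) \<and>
     independent_increments M \<and>
     (\<forall>s t p. s < t \<and> 0 \<le> p \<longrightarrow>
        (LINT l|M. exp (- p * (l t - l s))) =
        exp (- (t - s) * (LBINT x:{0<..}. (1 - exp (- p * x)) * levy_density \<alpha> x)))"

definition noise_shift :: "real \<Rightarrow> path \<times> path \<Rightarrow> path \<times> path" where
  "noise_shift t = (\<lambda>(w, l). (\<lambda>s. w (l t + s) - w (l t), \<lambda>s. l (t + s) - l t))"

definition subordinated :: "path \<times> path \<Rightarrow> real \<Rightarrow> real" where
  "subordinated = (\<lambda>(w, l) t. w (l t))"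

definition zOU :: "path \<times> path \<Rightarrow> real" where
  "zOU \<omega> = - (LBINT s:{..0}. exp s * subordinated \<omega> s)"

text \<open>The oriented integral of \<open>z (\<theta> r \<omega>)\<close> over \<open>r\<close> from \<open>a\<close> to \<open>b\<close>; \<open>b < a\<close> is allowed.\<close>

definition zint :: "path \<times> path \<Rightarrow> real \<Rightarrow> real \<Rightarrow> real" where
  "zint \<omega> a b = (LBINT r=ereal a..ereal b. zOU (noise_shift r \<omega>))"

definition full_invariant_set ::
  "path measure \<Rightarrow> path measure \<Rightarrow> (path \<times> path) set \<Rightarrow> bool" where
  "full_invariant_set muW muS Om \<longleftrightarrow>
     Om \<in> sets (muW \<Otimes>\<^sub>M muS) \<and> emeasure (muW \<Otimes>\<^sub>M muS) Om = 1 \<and>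
     (\<forall>t. noise_shift t ` Om = Om) \<and>
     (\<forall>\<omega>\<in>Om. \<forall>E\<in>{at_top, at_bot}.
        ((\<lambda>t. subordinated \<omega> t / t) \<longlongrightarrow> 0) E \<and>
        ((\<lambda>t. zOU (noise_shift t \<omega>) / t) \<longlongrightarrow> 0) E \<and>
        ((\<lambda>t. 1 / t * zint \<omega> 0 t) \<longlongrightarrow> 0) E)"


section \<open>The equations and the candidate manifold\<close>

definition Grand :: "('a::real_vector \<Rightarrow> 'a) \<Rightarrow> path \<times> path \<Rightarrow> 'a \<Rightarrow> 'a" where
  "Grand F \<omega> u = exp (- zOU \<omega>) *\<^sub>R F (exp (zOU \<omega>) *\<^sub>R u)"

text \<open>
  Solutions on a time interval \<open>I\<close> in the variation-of-constants sense. The scalar factor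
  \<open>exp (zint \<omega> s t)\<close> is split off from the operator exponential.
\<close>

definition random_solution ::
  "(nat \<Rightarrow> 'a::{real_inner,banach,second_countable_topology}) \<Rightarrow> (nat \<Rightarrow> real) \<Rightarrow> real \<Rightarrow>
   ('a \<Rightarrow> 'a) \<Rightarrow> path \<times> path \<Rightarrow> real set \<Rightarrow> (real \<Rightarrow> 'a) \<Rightarrow> bool" where
  "random_solution e lam \<sigma> F \<omega> I u \<longleftrightarrow>
     continuous_map (top_of_set I) (norm_topology (Adom e lam \<sigma>) (snorm e lam \<sigma>)) u \<and>
     (\<forall>\<tau>\<in>I. \<forall>t\<in>I. \<tau> \<le> t \<longrightarrow>
        set_integrable lborel {\<tau>..t}
          (\<lambda>s. exp (zint \<omega> s t) *\<^sub>R expA e lam (t - s) (Grand F (noise_shift s \<omega>) (u s))) \<and>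
        u t = exp (zint \<omega> \<tau> t) *\<^sub>R expA e lam (t - \<tau>) (u \<tau>) +
          (LBINT s:{\<tau>..t}.
             exp (zint \<omega> s t) *\<^sub>R expA e lam (t - s) (Grand F (noise_shift s \<omega>) (u s))))"

definition u_flow ::
  "(nat \<Rightarrow> 'a::{real_inner,banach,second_countable_topology}) \<Rightarrow> (nat \<Rightarrow> real) \<Rightarrow> real \<Rightarrow>
   ('a \<Rightarrow> 'a) \<Rightarrow> real \<Rightarrow> path \<times> path \<Rightarrow> 'a \<Rightarrow> 'a" where
  "u_flow e lam \<sigma> F t \<omega> x =
     (THE y. \<exists>u. random_solution e lam \<sigma> F \<omega> {0..} u \<and> u 0 = x \<and> u t = y)"

text \<open>
  The random dynamical system of the Marcus equation
  \<open>dv/dt + A v = F v + v \<diamondop> dW\<^bsub>S\<^esub>/dt\<close>, given through its explicit solution.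
\<close>

definition v_flow ::
  "(nat \<Rightarrow> 'a::{real_inner,banach,second_countable_topology}) \<Rightarrow> (nat \<Rightarrow> real) \<Rightarrow> real \<Rightarrow>
   ('a \<Rightarrow> 'a) \<Rightarrow> real \<Rightarrow> path \<times> path \<Rightarrow> 'a \<Rightarrow> 'a" where
  "v_flow e lam \<sigma> F t \<omega> x =
     exp (zOU (noise_shift t \<omega>)) *\<^sub>R u_flow e lam \<sigma> F t \<omega> (exp (- zOU \<omega>) *\<^sub>R x)"

definition backward_space ::
  "(nat \<Rightarrow> 'a::real_inner) \<Rightarrow> (nat \<Rightarrow> real) \<Rightarrow> real \<Rightarrow> real \<Rightarrow> path \<times> path \<Rightarrow> (real \<Rightarrow> 'a) set" where
  "backward_space e lam \<sigma> \<beta> \<omega> =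
     {\<phi>. continuous_map (top_of_set {..0}) (norm_topology (Adom e lam \<sigma>) (snorm e lam \<sigma>)) \<phi> \<and>
         bdd_above ((\<lambda>t. exp (\<beta> * t - zint \<omega> 0 t) * snorm e lam \<sigma> (\<phi> t)) ` {..0})}"

definition slow_manifold ::
  "(nat \<Rightarrow> 'a::{real_inner,banach,second_countable_topology}) \<Rightarrow> (nat \<Rightarrow> real) \<Rightarrow> real \<Rightarrow>
   ('a \<Rightarrow> 'a) \<Rightarrow> real \<Rightarrow> path \<times> path \<Rightarrow> 'a set" where
  "slow_manifold e lam \<sigma> F \<beta> \<omega> =
     {x \<in> Adom e lam \<sigma>. \<exists>u \<in> backward_space e lam \<sigma> \<beta> \<omega>.
        random_solution e lam \<sigma> F \<omega> {..0} u \<and> u 0 = x}"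

definition beta_exponent :: "(nat \<Rightarrow> real) \<Rightarrow> real \<Rightarrow> nat \<Rightarrow> real \<Rightarrow> real \<Rightarrow> real" where
  "beta_exponent lam \<sigma> N L \<mu> = lam N + 2 / \<mu> * L * lam N powr \<sigma>"

text \<open>The coefficient \<open>\<sigma>\<^sup>\<sigma>\<close> with value 1 at 0, where \<open>0 powr 0 = 0\<close> in HOL.\<close>

definition self_power :: "real \<Rightarrow> real" where
  "self_power \<sigma> = (if \<sigma> = 0 then 1 else \<sigma> powr \<sigma>)"

end

theory Submission
  imports Defs
begin

text \<open>
  In the variable \<open>v = exp (- zeta) A\<^sup>\<sigma> u\<close>, with \<open>zeta\<close> the primitive of the stationary
  Ornstein--Uhlenbeck process, the random equation becomes \<open>dv/dt + A v = A\<^sup>\<sigma> h v\<close>, whose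
  time-dependent forcing \<open>h\<close> vanishes at 0 and is still \<open>L\<close>-Lipschitz: the noise only enters through
  \<open>h\<close>. Forward solutions, the manifold, the tracking solutions and the derivative of the graph map
  are all fixed points of one equation \<open>y = a + K * f(y)\<close> on the whole line, in the space of
  measurable paths with \<open>norm (y t) \<le> C exp (- \<beta> t)\<close>, where \<open>K\<close> is the Green kernel of the linear part.
  The spectral gap condition says that this is a contraction with factor at most \<open>\<mu>\<close> (forward
  solutions use a very negative \<open>\<beta>\<close> and the kernel without unstable modes instead). Since Picard
  iterates are measurable in all parameters, so is the graph map. Differentiability uses only the
  pointwise derivative of \<open>F\<close>: the difference quotients satisfy an integral inequality whose
  inhomogeneity tends to 0 pointwise, and by dominated convergence their limes superior solves the
  homogeneous inequality.
\<close>

section \<open>Diagonal operators and fractional powers\<close>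

text \<open>Passing to A^\<sigma> u moves the phase space to the ambient type, at the price of a
  kernel that behaves like r^(-\<sigma>) at 0. As \<sigma> < 1 it is integrable, and its weighted
  integral is what the three terms of the gap condition bound: \<beta> is placed so that the
  unstable modes use exactly half of \<mu> and the stable ones at most the other half. The weight
  exp (- \<beta> t) no longer sees the noise. Randomness returns only when the substitution is
  undone, through factors exp (zeta) and exp (Zp) of subexponential growth, which cost an arbitrary
  part of the rate \<beta>, here one half. Paths are merely measurable because the inhomogeneities
  jump at time 0. Bounds hold at every time, so that values at 0 make sense, and continuity is
  recovered from the convolution. The map y -> f (s, y s) need not be differentiable on a space with
  fixed weight, so the implicit function theorem is not at hand, and changing the weight would use
  up room in the gap. This is why a pointwise argument with the limes superior replaces it.\<close>

locale eigen =
  fixes e :: "nat \<Rightarrow> 'a::{real_inner,banach,second_countable_topology}" and lam :: "nat \<Rightarrow> real"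
  assumes basis: "eigenbasis e lam"
begin

text \<open>The shift makes \<open>k < n\<close> select the first n eigenvectors. For N > 0 the two
  sides of the gap are \<open>Lam (N - 1)\<close>, which is \<open>lam N\<close>, and
  \<open>Lam N\<close>, which is \<open>lam (N + 1)\<close>.\<close>

abbreviation E :: "nat \<Rightarrow> 'a" where "E k \<equiv> e (Suc k)"
abbreviation Lam :: "nat \<Rightarrow> real" where "Lam k \<equiv> lam (Suc k)"

lemma inner_E: "E i \<bullet> E j = (if i = j then 1 else 0)"
proof -
  have "\<forall>i\<ge>1. \<forall>j\<ge>1. e i \<bullet> e j = (if i = j then 1 else 0)"
    using basis unfolding eigenbasis_def by blast
  from this[rule_format, of "Suc i" "Suc j"] show ?thesis by simp
qed

lemma Lam_mono: "i \<le> j \<Longrightarrow> Lam i \<le> Lam j"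
proof -
  have "\<forall>k\<ge>1. lam k \<le> lam (Suc k)"
    using basis unfolding eigenbasis_def by blast
  then have "Lam k \<le> Lam (Suc k)" for k by simp
  then show "i \<le> j \<Longrightarrow> Lam i \<le> Lam j" by (rule lift_Suc_mono_le)
qed

lemma Lam_pos [simp]: "0 < Lam k"
proof -
  have "0 < lam 1"
    using basis unfolding eigenbasis_def by blast
  then show ?thesis using Lam_mono[of 0 k] by simp
qed

lemma dense_span: "closure (span (e ` {1..})) = UNIV"
  using basis unfolding eigenbasis_def by blast

lemma Lam_ge0 [simp]: "0 \<le> Lam k"
  using Lam_pos[of k] by linarith

section \<open>Coordinates, Bessel's inequality and Parseval's identity\<close>

lemma norm_E [simp]: "norm (E k) = 1"
  by (simp add: norm_eq_sqrt_inner inner_E)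

text \<open>The vectors orthogonal to x - y form a closed subspace containing the basis, hence
  everything, in particular x - y itself. Identities between vectors and operators are checked mode
  by mode through this lemma.\<close>

lemma coords_eqI:
  assumes "\<And>k. x \<bullet> E k = y \<bullet> E k"
  shows "x = y"
proof -
  let ?S = "{v. (x - y) \<bullet> v = 0}"
  have "closed ?S"
    by (intro closed_Collect_eq continuous_intros)
  moreover have "subspace ?S"
    by (auto simp: subspace_def inner_add_right)
  moreover have "e ` {1..} \<subseteq> ?S"
  proof
    fix v assume "v \<in> e ` {1..}"
    then obtain k where "v = E k"
      by (auto simp: image_iff) (metis Suc_le_D)
    then show "v \<in> ?S" using assms by (simp add: inner_diff_left)
  qed
  ultimately have "closure (span (e ` {1..})) \<subseteq> ?S"
    by (meson closure_minimal span_minimal)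
  then have "(x - y) \<bullet> (x - y) = 0"
    unfolding dense_span by blast
  then show ?thesis by simp
qed

lemma norm_sum_E: "finite A \<Longrightarrow> (norm (\<Sum>k\<in>A. c k *\<^sub>R E k))\<^sup>2 = (\<Sum>k\<in>A. (c k)\<^sup>2)"
proof (induction A rule: finite_induct)
  case (insert x A)
  have "orthogonal (c x *\<^sub>R E x) (\<Sum>k\<in>A. c k *\<^sub>R E k)"
    using insert by (auto simp: orthogonal_def inner_sum_right inner_E intro!: sum.neutral)
  from norm_add_Pythagorean[OF this] show ?case
    using insert by (simp add: power_mult_distrib)
qed simp

lemma inner_sum_E: "finite A \<Longrightarrow> (\<Sum>k\<in>A. c k *\<^sub>R E k) \<bullet> E j = (if j \<in> A then c j else 0)"
proof -
  assume "finite A"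
  have "(\<Sum>k\<in>A. c k *\<^sub>R E k) \<bullet> E j = (\<Sum>k\<in>A. if k = j then c k else 0)"
    by (auto simp: inner_sum_left inner_E intro!: sum.cong)
  also have "\<dots> = (if j \<in> A then c j else 0)"
    using \<open>finite A\<close> by (simp add: sum.delta')
  finally show ?thesis .
qed

lemma bessel: "finite A \<Longrightarrow> (\<Sum>k\<in>A. (x \<bullet> E k)\<^sup>2) \<le> (norm x)\<^sup>2"
proof -
  assume A: "finite A"
  let ?p = "\<Sum>k\<in>A. (x \<bullet> E k) *\<^sub>R E k"
  have 1: "x \<bullet> ?p = (\<Sum>k\<in>A. (x \<bullet> E k)\<^sup>2)"
    by (simp add: inner_sum_right power2_eq_square)
  have 2: "?p \<bullet> ?p = (\<Sum>k\<in>A. (x \<bullet> E k)\<^sup>2)"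
    using norm_sum_E[OF A, of "\<lambda>k. x \<bullet> E k"] by (simp add: power2_norm_eq_inner)
  have "0 \<le> (x - ?p) \<bullet> (x - ?p)" by simp
  also have "\<dots> = x \<bullet> x - (\<Sum>k\<in>A. (x \<bullet> E k)\<^sup>2)"
    using 1 2 by (simp add: inner_diff_left inner_diff_right inner_commute)
  finally show ?thesis by (simp add: power2_norm_eq_inner)
qed

lemma summable_coords: "summable (\<lambda>k. (x \<bullet> E k)\<^sup>2)"
  by (rule summableI_nonneg_bounded[of _ "(norm x)\<^sup>2"]) (auto intro: bessel)

lemma summable_E:
  assumes "summable (\<lambda>k. (c k)\<^sup>2)"
  shows "summable (\<lambda>k. c k *\<^sub>R E k)"
proof (rule summable_Cauchy[THEN iffD2], intro allI impI)
  fix \<epsilon> :: real assume "0 < \<epsilon>"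
  with assms obtain M where M: "\<And>m n. M \<le> m \<Longrightarrow> norm (\<Sum>k\<in>{m..<n}. (c k)\<^sup>2) < \<epsilon>\<^sup>2"
    by (metis summable_Cauchy zero_less_power)
  show "\<exists>M. \<forall>m\<ge>M. \<forall>n. norm (\<Sum>k\<in>{m..<n}. c k *\<^sub>R E k) < \<epsilon>"
  proof (intro exI allI impI)
    fix m n assume "M \<le> m"
    from M[OF this, of n] have "(norm (\<Sum>k\<in>{m..<n}. c k *\<^sub>R E k))\<^sup>2 < \<epsilon>\<^sup>2"
      by (simp add: norm_sum_E)
    then show "norm (\<Sum>k\<in>{m..<n}. c k *\<^sub>R E k) < \<epsilon>"
      using \<open>0 < \<epsilon>\<close> by (simp add: power2_less_imp_less)
  qed
qed

lemma inner_suminf_E: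
  assumes "summable (\<lambda>k. (c k)\<^sup>2)"
  shows "(\<Sum>k. c k *\<^sub>R E k) \<bullet> E j = c j"
proof -
  have "(\<lambda>n. (\<Sum>k<n. c k *\<^sub>R E k) \<bullet> E j) \<longlonglongrightarrow> (\<Sum>k. c k *\<^sub>R E k) \<bullet> E j"
    by (intro tendsto_intros summable_LIMSEQ summable_E assms)
  moreover have "(\<lambda>n. (\<Sum>k<n. c k *\<^sub>R E k) \<bullet> E j) \<longlonglongrightarrow> c j"
    by (rule tendsto_eventually)
       (use eventually_gt_at_top[of j] in eventually_elim, simp add: inner_sum_E)
  ultimately show ?thesis by (rule LIMSEQ_unique)
qed

lemma norm_suminf_E:
  assumes "summable (\<lambda>k. (c k)\<^sup>2)"
  shows "(norm (\<Sum>k. c k *\<^sub>R E k))\<^sup>2 = (\<Sum>k. (c k)\<^sup>2)"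
proof -
  have "(\<lambda>n. (norm (\<Sum>k<n. c k *\<^sub>R E k))\<^sup>2) \<longlonglongrightarrow> (norm (\<Sum>k. c k *\<^sub>R E k))\<^sup>2"
    by (intro tendsto_intros summable_LIMSEQ summable_E assms)
  moreover have "(\<lambda>n. (norm (\<Sum>k<n. c k *\<^sub>R E k))\<^sup>2) \<longlonglongrightarrow> (\<Sum>k. (c k)\<^sup>2)"
    by (simp add: norm_sum_E summable_LIMSEQ assms)
  ultimately show ?thesis by (rule LIMSEQ_unique)
qed

lemma expansion: "(\<Sum>k. (x \<bullet> E k) *\<^sub>R E k) = x"
  by (rule coords_eqI) (simp add: inner_suminf_E summable_coords)

lemma parseval: "(norm x)\<^sup>2 = (\<Sum>k. (x \<bullet> E k)\<^sup>2)"
  using norm_suminf_E[OF summable_coords, of x] by (simp add: expansion)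

section \<open>Diagonal operators with bounded multipliers\<close>

definition dg :: "(nat \<Rightarrow> real) \<Rightarrow> 'a \<Rightarrow> 'a" where
  "dg m x = (\<Sum>k. (m k * (x \<bullet> E k)) *\<^sub>R E k)"

lemma summable_dg:
  assumes "\<And>k. \<bar>m k\<bar> \<le> B"
  shows "summable (\<lambda>k. (m k * (x \<bullet> E k))\<^sup>2)"
proof (rule summable_comparison_test)
  have "0 \<le> B" using assms[of 0] by linarith
  then have "(m k)\<^sup>2 \<le> B\<^sup>2" for k
    using assms[of k] by (metis abs_le_square_iff abs_of_nonneg)
  then show "\<exists>M. \<forall>n\<ge>M. norm ((m n * (x \<bullet> E n))\<^sup>2) \<le> B\<^sup>2 * (x \<bullet> E n)\<^sup>2"
    by (auto simp: power_mult_distrib intro!: mult_right_mono)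
  show "summable (\<lambda>n. B\<^sup>2 * (x \<bullet> E n)\<^sup>2)"
    by (intro summable_mult summable_coords)
qed

lemma inner_dg:
  assumes "\<And>k. \<bar>m k\<bar> \<le> B"
  shows "dg m x \<bullet> E j = m j * (x \<bullet> E j)"
  unfolding dg_def by (rule inner_suminf_E[OF summable_dg[OF assms]])

lemma norm_dg_le:
  assumes "\<And>k. \<bar>m k\<bar> \<le> B"
  shows "norm (dg m x) \<le> B * norm x"
proof (rule power2_le_imp_le)
  have B: "0 \<le> B" using assms[of 0] by linarith
  then have "(m k)\<^sup>2 \<le> B\<^sup>2" for k
    using assms[of k] by (metis abs_le_square_iff abs_of_nonneg)
  then have "(\<Sum>k. (m k * (x \<bullet> E k))\<^sup>2) \<le> (\<Sum>k. B\<^sup>2 * (x \<bullet> E k)\<^sup>2)"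
    by (intro suminf_le summable_dg[OF assms] summable_mult summable_coords)
       (auto simp: power_mult_distrib intro!: mult_right_mono)
  then show "(norm (dg m x))\<^sup>2 \<le> (B * norm x)\<^sup>2"
    unfolding dg_def norm_suminf_E[OF summable_dg[OF assms]] power_mult_distrib parseval[of x]
    by (simp add: suminf_mult summable_coords)
  show "0 \<le> B * norm x" using B by simp
qed

lemma bounded_linear_dg:
  assumes "\<And>k. \<bar>m k\<bar> \<le> B"
  shows "bounded_linear (dg m)"
proof (rule bounded_linear_intro[where K = B])
  show "dg m (x + y) = dg m x + dg m y" for x y
    by (rule coords_eqI) (simp add: inner_dg[OF assms] inner_add_left algebra_simps)
  show "dg m (r *\<^sub>R x) = r *\<^sub>R dg m x" for r x
    by (rule coords_eqI) (simp add: inner_dg[OF assms])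
  show "norm (dg m x) \<le> norm x * B" for x
    using norm_dg_le[OF assms] by (simp add: mult.commute)
qed

lemma borel_measurable_dg [measurable (raw)]:
  assumes [measurable]: "\<And>k. (\<lambda>w. m w k) \<in> borel_measurable M" "x \<in> borel_measurable M"
  shows "(\<lambda>w. dg (m w) (x w)) \<in> borel_measurable M"
  unfolding dg_def by measurable

text \<open>The remainder after n terms is a diagonal operator bounded by B, applied to the tail of
  x. It is therefore small uniformly in the parameter, and the continuous partial sums converge
  uniformly.\<close>

lemma dg_continuous:
  assumes B: "\<And>r k. r \<in> S \<Longrightarrow> \<bar>m r k\<bar> \<le> B" and cont: "\<And>k. continuous_on S (\<lambda>r. m r k)"
  shows "continuous_on S (\<lambda>r. dg (m r) x)"
proof (cases "S = {}")
  case False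
  then have B0: "0 \<le> B" using B by (meson abs_ge_zero ex_in_conv order_trans)
  have "uniform_limit S (\<lambda>n r. \<Sum>k<n. (m r k * (x \<bullet> E k)) *\<^sub>R E k) (\<lambda>r. dg (m r) x) sequentially"
  proof (rule uniform_limitI)
    fix \<epsilon> :: real assume "0 < \<epsilon>"
    have "(\<lambda>n. B * sqrt (\<Sum>k. (x \<bullet> E (k + n))\<^sup>2)) \<longlonglongrightarrow> B * sqrt 0"
      by (intro tendsto_intros suminf_exist_split2 summable_coords)
    then have "\<forall>\<^sub>F n in sequentially. B * sqrt (\<Sum>k. (x \<bullet> E (k + n))\<^sup>2) < \<epsilon>"
      using \<open>0 < \<epsilon>\<close> by (intro order_tendstoD(2)) auto
    then show "\<forall>\<^sub>F n in sequentially. \<forall>r\<in>S. dist (\<Sum>k<n. (m r k * (x \<bullet> E k)) *\<^sub>R E k) (dg (m r) x) < \<epsilon>"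
    proof eventually_elim
      case (elim n)
      show ?case
      proof
        fix r assume r: "r \<in> S"
        let ?c = "\<lambda>k. if k < n then 0 else m r k"
        have 1: "dg (m r) x - (\<Sum>k<n. (m r k * (x \<bullet> E k)) *\<^sub>R E k) = dg ?c (x - (\<Sum>k<n. (x \<bullet> E k) *\<^sub>R E k))"
        proof (rule coords_eqI)
          fix j
          have c: "\<bar>?c k\<bar> \<le> B" for k using B[OF r, of k] B0 by auto
          show "(dg (m r) x - (\<Sum>k<n. (m r k * (x \<bullet> E k)) *\<^sub>R E k)) \<bullet> E j =
              dg ?c (x - (\<Sum>k<n. (x \<bullet> E k) *\<^sub>R E k)) \<bullet> E j"
            by (simp add: inner_dg[OF c] inner_dg[OF B[OF r]] inner_diff_left inner_sum_E)
        qed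
        have c: "\<bar>?c k\<bar> \<le> B" for k using B[OF r, of k] B0 by auto
        let ?y = "x - (\<Sum>k<n. (x \<bullet> E k) *\<^sub>R E k)"
        have y: "?y \<bullet> E k = (if k < n then 0 else x \<bullet> E k)" for k
          by (simp add: inner_diff_left inner_sum_E)
        have "(norm ?y)\<^sup>2 = (\<Sum>k. (?y \<bullet> E (k + n))\<^sup>2) + (\<Sum>k<n. (?y \<bullet> E k)\<^sup>2)"
          unfolding parseval by (rule suminf_split_initial_segment[OF summable_coords])
        then have 2: "(norm ?y)\<^sup>2 = (\<Sum>k. (x \<bullet> E (k + n))\<^sup>2)"
          by (simp add: y)
        have "norm ?y = sqrt (\<Sum>k. (x \<bullet> E (k + n))\<^sup>2)"
          using arg_cong[OF 2, of sqrt] by simp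
        then have "norm (dg (m r) x - (\<Sum>k<n. (m r k * (x \<bullet> E k)) *\<^sub>R E k)) \<le> B * sqrt (\<Sum>k. (x \<bullet> E (k + n))\<^sup>2)"
          unfolding 1 using norm_dg_le[of ?c B ?y, OF c] by metis
        with elim show "dist (\<Sum>k<n. (m r k * (x \<bullet> E k)) *\<^sub>R E k) (dg (m r) x) < \<epsilon>"
          by (simp add: dist_norm norm_minus_commute)
      qed
    qed
  qed
  then show ?thesis
    by (rule uniform_limit_theorem[rotated])
       (auto intro!: always_eventually continuous_intros cont)
qed auto

section \<open>Fractional powers and their domains\<close>

lemma Adom_iff: "u \<in> Adom e lam s \<longleftrightarrow> summable (\<lambda>k. (Lam k powr s * (u \<bullet> E k))\<^sup>2)"
  by (simp add: Adom_def)

lemma inner_Apow: "u \<in> Adom e lam s \<Longrightarrow> Apow e lam s u \<bullet> E j = Lam j powr s * (u \<bullet> E j)"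
  by (simp add: Adom_iff Apow_def inner_suminf_E)

text \<open>For s >= 0 this inverse power is bounded and maps the whole space isometrically onto
  \<open>Adom e lam s\<close> with the norm \<open>snorm\<close>; the subspace can then be replaced
  by the ambient type.\<close>

definition Ainv :: "real \<Rightarrow> 'a \<Rightarrow> 'a" where
  "Ainv s = dg (\<lambda>k. Lam k powr (- s))"

text \<open>Square summability is inherited from the coordinates of \<open>v\<close>, so that
  exhibiting \<open>v\<close> settles membership and value together.\<close>

lemma AdomI:
  assumes "\<And>k. Lam k powr s * (u \<bullet> E k) = v \<bullet> E k"
  shows "u \<in> Adom e lam s" "Apow e lam s u = v"
proof -
  show *: "u \<in> Adom e lam s"
    by (simp add: Adom_iff assms summable_coords)
  show "Apow e lam s u = v"
    by (rule coords_eqI) (simp add: inner_Apow[OF *] assms)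
qed

lemma Adom_0: "0 \<in> Adom e lam s" and Apow_0: "Apow e lam s 0 = 0"
proof -
  have "Lam k powr s * (0 \<bullet> E k) = 0 \<bullet> E k" for k by simp
  from AdomI[OF this] show "0 \<in> Adom e lam s" "Apow e lam s 0 = 0" by auto
qed

lemma Adom_add:
  assumes "u \<in> Adom e lam s" "v \<in> Adom e lam s"
  shows "u + v \<in> Adom e lam s" "Apow e lam s (u + v) = Apow e lam s u + Apow e lam s v"
proof -
  have "Lam k powr s * ((u + v) \<bullet> E k) = (Apow e lam s u + Apow e lam s v) \<bullet> E k" for k
    by (simp add: inner_add_left inner_Apow assms distrib_left)
  from AdomI[OF this]
  show "u + v \<in> Adom e lam s" "Apow e lam s (u + v) = Apow e lam s u + Apow e lam s v" by auto
qed

lemma Adom_scaleR: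
  assumes "u \<in> Adom e lam s"
  shows "c *\<^sub>R u \<in> Adom e lam s" "Apow e lam s (c *\<^sub>R u) = c *\<^sub>R Apow e lam s u"
proof -
  have "Lam k powr s * ((c *\<^sub>R u) \<bullet> E k) = (c *\<^sub>R Apow e lam s u) \<bullet> E k" for k
    by (simp add: inner_Apow assms)
  from AdomI[OF this]
  show "c *\<^sub>R u \<in> Adom e lam s" "Apow e lam s (c *\<^sub>R u) = c *\<^sub>R Apow e lam s u" by auto
qed

lemma Adom_diff:
  assumes "u \<in> Adom e lam s" "v \<in> Adom e lam s"
  shows "u - v \<in> Adom e lam s" "Apow e lam s (u - v) = Apow e lam s u - Apow e lam s v"
proof -
  have "Lam k powr s * ((u - v) \<bullet> E k) = (Apow e lam s u - Apow e lam s v) \<bullet> E k" for k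
    by (simp add: inner_diff_left inner_Apow assms right_diff_distrib)
  from AdomI[OF this]
  show "u - v \<in> Adom e lam s" "Apow e lam s (u - v) = Apow e lam s u - Apow e lam s v" by auto
qed

text \<open>The metric space axioms ask for symmetry on the whole type, so vectors outside the
  domain count too. If one series diverges, so does its negative, and \<open>suminf\<close> returns
  the same default value for both.\<close>

lemma snorm_minus_commute: "snorm e lam s (u - v) = snorm e lam s (v - u)"
proof -
  have *: "(\<lambda>k. (Lam k powr s * ((v - u) \<bullet> E k)) *\<^sub>R E k) =
      (\<lambda>k. - ((Lam k powr s * ((u - v) \<bullet> E k)) *\<^sub>R E k))"
    by (simp add: fun_eq_iff inner_diff_left right_diff_distrib scaleR_left_diff_distrib)
  show ?thesis
  proof (cases "summable (\<lambda>k. (Lam k powr s * ((u - v) \<bullet> E k)) *\<^sub>R E k)")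
    case True
    then show ?thesis unfolding snorm_def Apow_def * by (simp add: suminf_minus)
  next
    case False
    then have "\<not> summable (\<lambda>k. - ((Lam k powr s * ((u - v) \<bullet> E k)) *\<^sub>R E k))"
      by (simp add: summable_minus_iff)
    with False show ?thesis
      unfolding snorm_def Apow_def * by (simp add: suminf_def summable_def)
  qed
qed

lemma snorm_scaleR: "u \<in> Adom e lam s \<Longrightarrow> snorm e lam s (c *\<^sub>R u) = \<bar>c\<bar> * snorm e lam s u"
  by (simp add: snorm_def Adom_scaleR)

lemma snorm_nonneg: "0 \<le> snorm e lam s u"
  by (simp add: snorm_def)

lemma Apow_inject:
  assumes "u \<in> Adom e lam s" "v \<in> Adom e lam s" "Apow e lam s u = Apow e lam s v"
  shows "u = v"
proof (rule coords_eqI)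
  fix k
  have "Lam k powr s * (u \<bullet> E k) = Lam k powr s * (v \<bullet> E k)"
    using assms by (metis inner_Apow)
  then show "u \<bullet> E k = v \<bullet> E k" by (simp add: Lam_pos less_imp_neq[symmetric])
qed

section \<open>The phase space as an isometric copy of the ambient space\<close>

context
  fixes s :: real
  assumes s: "0 \<le> s"
begin

lemma Ainv_bound: "\<bar>Lam k powr (- s)\<bar> \<le> Lam 0 powr (- s)"
  using s Lam_mono[of 0 k] by (simp add: powr_mono2')

lemma inner_Ainv: "Ainv s x \<bullet> E k = Lam k powr (- s) * (x \<bullet> E k)"
  unfolding Ainv_def by (rule inner_dg[OF Ainv_bound])

lemma bounded_linear_Ainv: "bounded_linear (Ainv s)"
  unfolding Ainv_def by (rule bounded_linear_dg[OF Ainv_bound])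

lemma Ainv_Adom: "Ainv s x \<in> Adom e lam s" and Apow_Ainv: "Apow e lam s (Ainv s x) = x"
proof -
  have "Lam k powr s * (Ainv s x \<bullet> E k) = x \<bullet> E k" for k
    by (simp add: inner_Ainv powr_minus field_simps Lam_pos less_imp_neq[symmetric])
  from AdomI[OF this] show "Ainv s x \<in> Adom e lam s" "Apow e lam s (Ainv s x) = x" by auto
qed

lemma Ainv_Apow: "u \<in> Adom e lam s \<Longrightarrow> Ainv s (Apow e lam s u) = u"
  by (rule Apow_inject[where s=s]) (auto simp: Ainv_Adom Apow_Ainv)

lemma snorm_Ainv: "snorm e lam s (Ainv s x) = norm x"
  by (simp add: snorm_def Apow_Ainv)

lemma Ainv_linear:
  "Ainv s (x + y) = Ainv s x + Ainv s y" "Ainv s (x - y) = Ainv s x - Ainv s y"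
  "Ainv s (c *\<^sub>R x) = c *\<^sub>R Ainv s x" "Ainv s 0 = 0"
  using bounded_linear_Ainv
  by (auto simp: linear_simps bounded_linear.linear[THEN linear_0])

lemma Metric_space_snorm: "Metric_space (Adom e lam s) (\<lambda>x y. snorm e lam s (x - y))"
proof (rule Metric_space.intro)
  show "snorm e lam s (x - y) = snorm e lam s (y - x)" for x y
    by (rule snorm_minus_commute)
next
  fix x y assume xy: "x \<in> Adom e lam s" "y \<in> Adom e lam s"
  show "(snorm e lam s (x - y) = 0) = (x = y)"
    using xy Apow_inject[OF xy] by (auto simp: snorm_def Adom_diff Adom_0 Apow_0)
next
  fix x y z assume xy: "x \<in> Adom e lam s" "y \<in> Adom e lam s" "z \<in> Adom e lam s"
  show "snorm e lam s (x - z) \<le> snorm e lam s (x - y) + snorm e lam s (y - z)"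
    using xy norm_triangle_ineq[of "Apow e lam s x - Apow e lam s y" "Apow e lam s y - Apow e lam s z"]
    by (simp add: snorm_def Adom_diff)
qed (auto simp: snorm_nonneg)

text \<open>\<open>Ainv s\<close> carries balls onto balls. Pulling back along it reduces
  continuity, closedness and Borel sets of the phase space to those of the ambient type.\<close>

lemma openin_norm_topology:
  "openin (norm_topology (Adom e lam s) (snorm e lam s)) U \<longleftrightarrow> U \<subseteq> Adom e lam s \<and> open (Ainv s -` U)"
proof -
  interpret M: Metric_space "Adom e lam s" "\<lambda>x y. snorm e lam s (x - y)"
    by (rule Metric_space_snorm)
  have ball: "M.mball (Ainv s x) r \<subseteq> U \<longleftrightarrow> ball x r \<subseteq> Ainv s -` U" for x r
  proof
    assume L: "M.mball (Ainv s x) r \<subseteq> U"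
    show "ball x r \<subseteq> Ainv s -` U"
    proof
      fix y assume "y \<in> ball x r"
      then have "Ainv s y \<in> M.mball (Ainv s x) r"
        by (simp add: Ainv_Adom Ainv_linear[symmetric] snorm_Ainv dist_norm)
      with L show "y \<in> Ainv s -` U" by auto
    qed
  next
    assume R: "ball x r \<subseteq> Ainv s -` U"
    show "M.mball (Ainv s x) r \<subseteq> U"
    proof
      fix u assume u: "u \<in> M.mball (Ainv s x) r"
      then have "u = Ainv s (Apow e lam s u)" by (simp add: Ainv_Apow)
      moreover have "Apow e lam s u \<in> ball x r"
      proof -
        have "snorm e lam s (Ainv s x - u) < r" "u \<in> Adom e lam s" using u by auto
        then show ?thesis by (simp add: snorm_def Adom_diff Ainv_Adom Apow_Ainv dist_norm)
      qed
      ultimately show "u \<in> U" using R by auto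
    qed
  qed
  show ?thesis
  proof (cases "U \<subseteq> Adom e lam s")
    case True
    have "(\<forall>u\<in>U. \<exists>r>0. M.mball u r \<subseteq> U) \<longleftrightarrow> (\<forall>x\<in>Ainv s -` U. \<exists>r>0. ball x r \<subseteq> Ainv s -` U)"
    proof
      assume L: "\<forall>u\<in>U. \<exists>r>0. M.mball u r \<subseteq> U"
      show "\<forall>x\<in>Ainv s -` U. \<exists>r>0. ball x r \<subseteq> Ainv s -` U"
        unfolding ball[symmetric] using L by blast
    next
      assume R: "\<forall>x\<in>Ainv s -` U. \<exists>r>0. ball x r \<subseteq> Ainv s -` U"
      show "\<forall>u\<in>U. \<exists>r>0. M.mball u r \<subseteq> U"
      proof
        fix u assume u: "u \<in> U"
        then have *: "Ainv s (Apow e lam s u) = u" using True Ainv_Apow by blast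
        then obtain r where "r > 0" "ball (Apow e lam s u) r \<subseteq> Ainv s -` U"
          using u R by force
        then show "\<exists>r>0. M.mball u r \<subseteq> U"
          using ball[of "Apow e lam s u" r] * by auto
      qed
    qed
    then show ?thesis
      unfolding norm_topology_def M.openin_mtopology open_contains_ball using True by blast
  qed (auto simp: norm_topology_def M.openin_mtopology)
qed

lemma topspace_norm_topology [simp]:
  "topspace (norm_topology (Adom e lam s) (snorm e lam s)) = Adom e lam s"
  unfolding norm_topology_def
  by (rule Metric_space.topspace_mtopology[OF Metric_space_snorm])

lemma closedin_norm_topology:
  "closedin (norm_topology (Adom e lam s) (snorm e lam s)) C \<longleftrightarrow> C \<subseteq> Adom e lam s \<and> closed (Ainv s -` C)"
proof -
  have "Ainv s -` (Adom e lam s - C) = - (Ainv s -` C)"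
    by (auto simp: Ainv_Adom)
  then show ?thesis
    by (auto simp: closedin_def openin_norm_topology closed_def)
qed

lemma Ainv_vimage_image: "Ainv s -` (Ainv s ` V) = V"
  by (auto, metis Apow_Ainv)

lemma Ainv_image_sub: "Ainv s ` V \<subseteq> Adom e lam s"
  by (auto simp: Ainv_Adom)

lemma continuous_map_norm_topology:
  "continuous_map (top_of_set I) (norm_topology (Adom e lam s) (snorm e lam s)) u \<longleftrightarrow>
    (\<forall>t\<in>I. u t \<in> Adom e lam s) \<and> continuous_on I (\<lambda>t. Apow e lam s (u t))"
proof (cases "\<forall>t\<in>I. u t \<in> Adom e lam s")
  case True
  have pre: "{t \<in> I. u t \<in> U} = I \<inter> (\<lambda>t. Apow e lam s (u t)) -` (Ainv s -` U)" for U
    using True by (auto simp: Ainv_Apow)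
  have "(\<forall>U. openin (norm_topology (Adom e lam s) (snorm e lam s)) U \<longrightarrow>
            openin (top_of_set I) {t \<in> I. u t \<in> U}) \<longleftrightarrow>
        (\<forall>V. open V \<longrightarrow> openin (top_of_set I) (I \<inter> (\<lambda>t. Apow e lam s (u t)) -` V))"
    unfolding openin_norm_topology pre by (metis Ainv_vimage_image Ainv_image_sub)
  then show ?thesis
    using True by (simp add: continuous_map_def continuous_openin_preimage_eq Pi_iff)
qed (auto simp: continuous_map_def)

lemma space_norm_borel [simp]: "space (norm_borel (Adom e lam s) (snorm e lam s)) = Adom e lam s"
  unfolding norm_borel_def by (rule space_measure_of) (auto simp: openin_norm_topology)

lemma sets_norm_borel:
  "sets (norm_borel (Adom e lam s) (snorm e lam s)) =
    sigma_sets (Adom e lam s) {U. openin (norm_topology (Adom e lam s) (snorm e lam s)) U}"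
  unfolding norm_borel_def
  by (rule sets_measure_of) (auto simp: openin_norm_topology)

lemma measurable_Ainv: "Ainv s \<in> measurable borel (norm_borel (Adom e lam s) (snorm e lam s))"
  unfolding norm_borel_def
  by (rule measurable_measure_of) (auto simp: openin_norm_topology Ainv_Adom)

lemma measurable_Apow: "Apow e lam s \<in> measurable (norm_borel (Adom e lam s) (snorm e lam s)) borel"
proof (rule borel_measurableI)
  fix V :: "'a set" assume "open V"
  have "Apow e lam s -` V \<inter> Adom e lam s = Ainv s ` V"
  proof
    show "Apow e lam s -` V \<inter> Adom e lam s \<subseteq> Ainv s ` V"
    proof
      fix u assume "u \<in> Apow e lam s -` V \<inter> Adom e lam s"
      then have "u = Ainv s (Apow e lam s u)" "Apow e lam s u \<in> V" by (auto simp: Ainv_Apow)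
      then show "u \<in> Ainv s ` V" by blast
    qed
  qed (auto simp: Ainv_Adom Apow_Ainv)
  moreover have "openin (norm_topology (Adom e lam s) (snorm e lam s)) (Ainv s ` V)"
    using \<open>open V\<close> by (simp add: openin_norm_topology Ainv_image_sub Ainv_vimage_image)
  ultimately show "Apow e lam s -` V \<inter> space (norm_borel (Adom e lam s) (snorm e lam s))
      \<in> sets (norm_borel (Adom e lam s) (snorm e lam s))"
    by (auto simp: sets_norm_borel)
qed

end

end

section \<open>Weighted convolution equations on the real line\<close>

text \<open>Mere measurability in time is the right requirement: the noise enters through a path
  that may jump.\<close>

definition forcing :: "real \<Rightarrow> (real \<Rightarrow> 'a::real_normed_vector \<Rightarrow> 'a) \<Rightarrow> bool" where
  "forcing L f \<longleftrightarrow> (\<lambda>(s, x). f s x) \<in> borel_measurable (borel \<Otimes>\<^sub>M borel) \<and>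
     (\<forall>s x y. norm (f s x - f s y) \<le> L * norm (x - y)) \<and> (\<forall>s. f s 0 = 0)"

lemma forcingD:
  assumes "forcing L f"
  shows forcing_measurable: "(\<lambda>(s, x). f s x) \<in> borel_measurable (borel \<Otimes>\<^sub>M borel)"
    and forcing_lipschitz: "norm (f s x - f s y) \<le> L * norm (x - y)"
    and forcing_zero: "f s 0 = 0"
    and forcing_bound: "norm (f s x) \<le> L * norm x"
proof -
  show 1: "(\<lambda>(s, x). f s x) \<in> borel_measurable (borel \<Otimes>\<^sub>M borel)"
    "norm (f s x - f s y) \<le> L * norm (x - y)" "f s 0 = 0" for s x y
    using assms unfolding forcing_def by blast+
  show "norm (f s x) \<le> L * norm x"
    using 1(2)[of s x 0] 1(3) by simp
qed

lemma forcing_comp_measurable: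
  assumes "forcing L f" "g \<in> borel_measurable M" "y \<in> borel_measurable M"
  shows "(\<lambda>w. f (g w) (y w)) \<in> borel_measurable M"
  using measurable_compose[OF measurable_Pair[OF assms(2,3)] forcing_measurable[OF assms(1)]]
  by simp

text \<open>The estimate is imposed at every time and not only almost everywhere, so that a fixed
  point has a meaningful value at time 0.\<close>

definition exp_bounded :: "real \<Rightarrow> real \<Rightarrow> (real \<Rightarrow> 'a::real_normed_vector) \<Rightarrow> bool" where
  "exp_bounded \<beta> C p \<longleftrightarrow> (\<forall>t. norm (p t) \<le> C * exp (- \<beta> * t))"

lemma exp_boundedD: "exp_bounded \<beta> C p \<Longrightarrow> norm (p t) \<le> C * exp (- \<beta> * t)"
  by (simp add: exp_bounded_def)

lemma exp_bounded_nonneg: "exp_bounded \<beta> C p \<Longrightarrow> 0 \<le> C"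
  using exp_boundedD[of \<beta> C p 0] norm_ge_zero[of "p 0"] by (simp del: norm_ge_zero)

lemma exp_bounded_forcing:
  assumes "forcing L f" "0 \<le> L" "exp_bounded \<beta> C y"
  shows "exp_bounded \<beta> (L * C) (\<lambda>s. f s (y s))"
  unfolding exp_bounded_def
  using forcing_bound[OF assms(1)] exp_boundedD[OF assms(3)] assms(2)
  by (metis (no_types, opaque_lifting) mult.assoc mult_left_mono order_trans)

lemma exp_bounded_diff:
  assumes "exp_bounded \<beta> C x" "exp_bounded \<beta> D y"
  shows "exp_bounded \<beta> (C + D) (\<lambda>t. x t - y t)"
  unfolding exp_bounded_def distrib_right
  using exp_boundedD[OF assms(1)] exp_boundedD[OF assms(2)] norm_triangle_ineq4
  by (metis (no_types, opaque_lifting) add_mono order_trans)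

lemma exp_bounded_add:
  assumes "exp_bounded \<beta> C x" "exp_bounded \<beta> D y"
  shows "exp_bounded \<beta> (C + D) (\<lambda>t. x t + y t)"
  unfolding exp_bounded_def distrib_right
  using exp_boundedD[OF assms(1)] exp_boundedD[OF assms(2)] norm_triangle_ineq
  by (metis (no_types, opaque_lifting) add_mono order_trans)

text \<open>The number \<open>c\<close> bounds the convolution in the weight exp (- \<beta> t), so
  \<open>L * c\<close> is the contraction factor of the fixed point map. Continuity is asked only
  away from 0, because the Green kernel jumps there and may be singular.\<close>

locale conv_kernel =
  fixes K :: "real \<Rightarrow> 'a::{banach,second_countable_topology} \<Rightarrow> 'a"
    and \<kappa> :: "real \<Rightarrow> real" and \<beta> c L :: real
  assumes K_meas: "(\<lambda>(r, x). K r x) \<in> borel_measurable (borel \<Otimes>\<^sub>M borel)"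
    and K_lin: "bounded_linear (K r)"
    and K_bound: "norm (K r x) \<le> \<kappa> r * norm x"
    and \<kappa>_meas [measurable]: "\<kappa> \<in> borel_measurable borel"
    and \<kappa>_nonneg: "0 \<le> \<kappa> r"
    and \<kappa>_int: "has_bochner_integral lborel (\<lambda>r. \<kappa> r * exp (\<beta> * r)) c"
    and K_cont: "r \<noteq> 0 \<Longrightarrow> isCont (\<lambda>r. K r x) r"
    and \<kappa>_cont: "r \<noteq> 0 \<Longrightarrow> isCont \<kappa> r"
    and L_nonneg: "0 \<le> L"
    and contraction: "L * c < 1"
begin

lemma K_measurable [measurable (raw)]:
  assumes "g \<in> borel_measurable M" "y \<in> borel_measurable M"
  shows "(\<lambda>w. K (g w) (y w)) \<in> borel_measurable M"
  using measurable_compose[OF measurable_Pair[OF assms] K_meas] by simp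

lemma c_nonneg: "0 \<le> c"
proof -
  have "c = (LINT r|lborel. \<kappa> r * exp (\<beta> * r))"
    using \<kappa>_int by (simp add: has_bochner_integral_integral_eq)
  then show ?thesis using \<kappa>_nonneg by simp
qed

lemma Lc: "0 \<le> L * c" "0 < 1 - L * c"
  using c_nonneg L_nonneg contraction by auto

text \<open>After reflection and translation of the variable, the weight exp (- \<beta> s) is an
  eigenfunction of the convolution with \<kappa>, with eigenvalue \<open>c\<close>.\<close>

lemma kernel_integral:
  "has_bochner_integral lborel (\<lambda>s. \<kappa> (t - s) * (C * exp (- \<beta> * s))) (c * C * exp (- \<beta> * t))"
proof -
  have "has_bochner_integral lborel (\<lambda>s. \<kappa> (t + (-1) * s) * exp (\<beta> * (t + (-1) * s))) (c /\<^sub>R \<bar>-1\<bar>)"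
    using \<kappa>_int lborel_has_bochner_integral_real_affine_iff[of "-1" "\<lambda>r. \<kappa> r * exp (\<beta> * r)" c t]
    by simp
  then have "has_bochner_integral lborel (\<lambda>s. (C * exp (- \<beta> * t)) * (\<kappa> (t - s) * exp (\<beta> * (t - s)))) ((C * exp (- \<beta> * t)) * c)"
    by (intro has_bochner_integral_mult_right) simp
  moreover have "(C * exp (- \<beta> * t)) * (\<kappa> (t - s) * exp (\<beta> * (t - s))) = \<kappa> (t - s) * (C * exp (- \<beta> * s))" for s
    by (simp add: right_diff_distrib exp_diff exp_minus divide_inverse)
  ultimately show ?thesis by (simp only: mult.commute[of "C * exp (- \<beta> * t)" c] mult.assoc[symmetric])
qed

lemma kernel_integrable: "integrable lborel (\<lambda>s. \<kappa> (t - s) * (C * exp (- \<beta> * s)))"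
  using kernel_integral by (simp add: has_bochner_integral_iff)

section \<open>The convolution operator on weighted paths\<close>

definition conv :: "(real \<Rightarrow> 'a) \<Rightarrow> real \<Rightarrow> 'a" where
  "conv p t = (LINT s|lborel. K (t - s) (p s))"

lemma kernel_integrable_real:
  assumes [measurable]: "d \<in> borel_measurable borel" and "\<And>s. \<bar>d s\<bar> \<le> C * exp (- \<beta> * s)"
  shows "integrable lborel (\<lambda>s. \<kappa> (t - s) * d s)"
proof (rule Bochner_Integration.integrable_bound[OF kernel_integrable[of t C]])
  show "AE s in lborel. norm (\<kappa> (t - s) * d s) \<le> norm (\<kappa> (t - s) * (C * exp (- \<beta> * s)))"
  proof (rule AE_I2)
    fix s
    have "\<bar>d s\<bar> \<le> \<bar>C * exp (- \<beta> * s)\<bar>" using assms(2)[of s] by linarith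
    then show "norm (\<kappa> (t - s) * d s) \<le> norm (\<kappa> (t - s) * (C * exp (- \<beta> * s)))"
      unfolding real_norm_def abs_mult[of "\<kappa> (t - s)"] by (intro mult_left_mono) auto
  qed
qed simp

lemma conv_integrable:
  assumes [measurable]: "p \<in> borel_measurable borel" and "exp_bounded \<beta> C p"
  shows "integrable lborel (\<lambda>s. K (t - s) (p s))"
proof (rule Bochner_Integration.integrable_bound[OF kernel_integrable[of t C]])
  show "AE s in lborel. norm (K (t - s) (p s)) \<le> norm (\<kappa> (t - s) * (C * exp (- \<beta> * s)))"
  proof (rule AE_I2)
    fix s
    have "norm (K (t - s) (p s)) \<le> \<kappa> (t - s) * norm (p s)" by (rule K_bound)
    also have "\<dots> \<le> \<kappa> (t - s) * (C * exp (- \<beta> * s))"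
      using exp_boundedD[OF assms(2)] \<kappa>_nonneg by (intro mult_left_mono) auto
    finally show "norm (K (t - s) (p s)) \<le> norm (\<kappa> (t - s) * (C * exp (- \<beta> * s)))" by simp
  qed
qed simp

lemma norm_conv_le:
  assumes [measurable]: "p \<in> borel_measurable borel" and "exp_bounded \<beta> C p"
    and [measurable]: "d \<in> borel_measurable borel" and d: "\<And>s. norm (p s) \<le> d s"
    and "\<And>s. d s \<le> D * exp (- \<beta> * s)"
  shows "norm (conv p t) \<le> (LINT s|lborel. \<kappa> (t - s) * d s)"
  unfolding conv_def
proof (rule Bochner_Integration.integral_norm_bound_integral[OF conv_integrable[OF assms(1,2)]])
  have "\<bar>d s\<bar> \<le> D * exp (- \<beta> * s)" for s
    using assms(5)[of s] order_trans[OF norm_ge_zero d[of s]] by simp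
  then show "integrable lborel (\<lambda>s. \<kappa> (t - s) * d s)"
    by (intro kernel_integrable_real) auto
  show "norm (K (t - s) (p s)) \<le> \<kappa> (t - s) * d s" for s
    using K_bound[of "t - s" "p s"] mult_left_mono[OF d \<kappa>_nonneg] by (rule order_trans)
qed

lemma exp_bounded_conv:
  assumes [measurable]: "p \<in> borel_measurable borel" and "exp_bounded \<beta> C p"
  shows "exp_bounded \<beta> (c * C) (conv p)"
  unfolding exp_bounded_def
proof
  fix t
  have "norm (conv p t) \<le> (LINT s|lborel. \<kappa> (t - s) * (C * exp (- \<beta> * s)))"
    using exp_boundedD[OF assms(2)] by (intro norm_conv_le[OF assms]) auto
  then show "norm (conv p t) \<le> c * C * exp (- \<beta> * t)"
    by (simp only: has_bochner_integral_integral_eq[OF kernel_integral])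
qed

lemma conv_diff:
  assumes "p \<in> borel_measurable borel" "exp_bounded \<beta> C p"
    and "q \<in> borel_measurable borel" "exp_bounded \<beta> D q"
  shows "conv (\<lambda>s. p s - q s) t = conv p t - conv q t"
  using conv_integrable[OF assms(1,2)] conv_integrable[OF assms(3,4)]
  by (simp add: conv_def linear_diff[OF bounded_linear.linear[OF K_lin]])

lemma conv_add:
  assumes "p \<in> borel_measurable borel" "exp_bounded \<beta> C p"
    and "q \<in> borel_measurable borel" "exp_bounded \<beta> D q"
  shows "conv (\<lambda>s. p s + q s) t = conv p t + conv q t"
  using conv_integrable[OF assms(1,2)] conv_integrable[OF assms(3,4)]
  by (simp add: conv_def linear_add[OF bounded_linear.linear[OF K_lin]])

lemma conv_scaleR: "conv (\<lambda>s. r *\<^sub>R p s) t = r *\<^sub>R conv p t"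
  by (simp add: conv_def linear_scale[OF bounded_linear.linear[OF K_lin]])

text \<open>Integration over one variable preserves measurability in the others; this is the
  induction step that makes Picard iterates measurable in their data.\<close>

lemma conv_measurable_pair:
  assumes "(\<lambda>(w, s). p w s) \<in> borel_measurable (M \<Otimes>\<^sub>M borel)"
  shows "(\<lambda>(w, t). conv (p w) t) \<in> borel_measurable (M \<Otimes>\<^sub>M borel)"
proof -
  have [measurable (raw)]: "(\<lambda>x. p (g x) (h x)) \<in> borel_measurable N"
    if "g \<in> measurable N M" "h \<in> borel_measurable N" for g h and N :: "'z measure"
    using measurable_compose[OF measurable_Pair[OF that] assms] by simp
  show ?thesis
    unfolding conv_def split_beta' by measurable
qed

lemma conv_measurable [measurable (raw)]:
  assumes [measurable]: "p \<in> borel_measurable borel"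
  shows "conv p \<in> borel_measurable borel"
  unfolding conv_def by measurable

text \<open>The supremum S of d t * exp (\<beta> t) is finite by the a priori bound with
  \<open>C\<close> and satisfies S <= A + L c S. Since L c < 1, the inequality can be solved for
  S.\<close>

lemma gronwall:
  assumes [measurable]: "d \<in> borel_measurable borel"
    and d: "\<And>s. 0 \<le> d s" "\<And>s. d s \<le> C * exp (- \<beta> * s)"
    and ineq: "\<And>t. d t \<le> A * exp (- \<beta> * t) + (LINT s|lborel. \<kappa> (t - s) * (L * d s))"
  shows "d t \<le> A / (1 - L * c) * exp (- \<beta> * t)"
proof -
  define S where "S = (SUP t. d t * exp (\<beta> * t))"
  have bdd: "bdd_above (range (\<lambda>t. d t * exp (\<beta> * t)))"
  proof (rule bdd_aboveI2)
    show "d t * exp (\<beta> * t) \<le> C" for t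
      using d(2)[of t] by (simp add: exp_minus field_simps)
  qed
  have dS: "d t \<le> S * exp (- \<beta> * t)" for t
  proof -
    have "d t * exp (\<beta> * t) \<le> S"
      unfolding S_def by (rule cSUP_upper[OF _ bdd]) simp
    then show ?thesis by (simp add: exp_minus field_simps)
  qed
  have "d t * exp (\<beta> * t) \<le> A + L * c * S" for t
  proof -
    have "(LINT s|lborel. \<kappa> (t - s) * (L * d s)) \<le> (LINT s|lborel. \<kappa> (t - s) * (L * S * exp (- \<beta> * s)))"
    proof (rule integral_mono)
      show "integrable lborel (\<lambda>s. \<kappa> (t - s) * (L * d s))"
        by (rule kernel_integrable_real[where C = "L * C"])
           (use d L_nonneg in \<open>auto simp: abs_mult mult.assoc intro!: mult_left_mono\<close>)
      show "\<kappa> (t - s) * (L * d s) \<le> \<kappa> (t - s) * (L * S * exp (- \<beta> * s))" for s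
        using dS[of s] L_nonneg \<kappa>_nonneg
        by (auto simp: mult.assoc intro!: mult_left_mono)
    qed (rule kernel_integrable)
    also have "\<dots> = c * (L * S) * exp (- \<beta> * t)"
      by (simp only: has_bochner_integral_integral_eq[OF kernel_integral])
    finally have "d t \<le> (A + L * c * S) * exp (- \<beta> * t)"
      using ineq[of t] by (simp add: algebra_simps)
    then show ?thesis by (simp add: exp_minus field_simps)
  qed
  then have "S \<le> A + L * c * S"
    unfolding S_def by (intro cSUP_least) auto
  then have "S \<le> A / (1 - L * c)"
    using Lc by (simp add: field_simps)
  with dS[of t] show ?thesis
    by (meson exp_ge_zero mult_right_mono order_trans)
qed

lemma tail_sup:
  fixes d :: "nat \<Rightarrow> real"
  assumes "\<And>n. 0 \<le> d n" "\<And>n. d n \<le> C"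
  shows "n \<ge> m \<Longrightarrow> d n \<le> (SUP n\<in>{m..}. d n)" "0 \<le> (SUP n\<in>{m..}. d n)" "(SUP n\<in>{m..}. d n) \<le> C"
    and "decseq (\<lambda>m. SUP n\<in>{m..}. d n)"
proof -
  have bdd: "bdd_above (d ` X)" for X using assms(2) by (rule bdd_aboveI2)
  show *: "n \<ge> m \<Longrightarrow> d n \<le> (SUP n\<in>{m..}. d n)" for n m
    by (rule cSUP_upper[OF _ bdd]) simp
  show "0 \<le> (SUP n\<in>{m..}. d n)"
    using assms(1)[of m] *[of m m] by simp
  show "(SUP n\<in>{m..}. d n) \<le> C"
    by (rule cSUP_least) (auto simp: assms)
  show "decseq (\<lambda>m. SUP n\<in>{m..}. d n)"
    by (intro decseq_SucI cSUP_subset_mono bdd) auto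
qed

text \<open>
  The limes superior of \<open>d n\<close> satisfies the homogeneous integral inequality by dominated
  convergence, so it vanishes by Gronwall's lemma.
\<close>

lemma vanishing:
  fixes d b :: "nat \<Rightarrow> real \<Rightarrow> real"
  assumes [measurable]: "\<And>n. d n \<in> borel_measurable borel" "\<And>n. b n \<in> borel_measurable borel"
    and d: "\<And>n s. 0 \<le> d n s" "\<And>n s. d n s \<le> C * exp (- \<beta> * s)"
    and b: "\<And>n s. 0 \<le> b n s" "\<And>n s. b n s \<le> D * exp (- \<beta> * s)" "\<And>s. (\<lambda>n. b n s) \<longlonglongrightarrow> 0"
    and ineq: "\<And>n t. d n t \<le> (LINT s|lborel. \<kappa> (t - s) * (L * d n s + b n s))"
  shows "(\<lambda>n. d n t) \<longlonglongrightarrow> 0"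
proof -
  define d' where "d' m s = (SUP n\<in>{m..}. d n s)" for m s
  define b' where "b' m s = (SUP n\<in>{m..}. b n s)" for m s
  have bddd: "bdd_above ((\<lambda>n. d n s) ` X)" and bddb: "bdd_above ((\<lambda>n. b n s) ` X)" for s X
    by (rule bdd_aboveI2, rule d(2), rule bdd_aboveI2, rule b(2))
  have [measurable]: "d' m \<in> borel_measurable borel" "b' m \<in> borel_measurable borel" for m
    unfolding d'_def b'_def by (auto intro!: borel_measurable_cSUP bddd bddb)
  note d' = tail_sup[of "\<lambda>n. d n s" "C * exp (- \<beta> * s)" for s, OF d, folded d'_def]
  note b' = tail_sup[of "\<lambda>n. b n s" "D * exp (- \<beta> * s)" for s, OF b(1,2), folded b'_def]
  have b'_lim: "(\<lambda>m. b' m s) \<longlonglongrightarrow> 0" for s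
  proof (rule LIMSEQ_I)
    fix r :: real assume "0 < r"
    then obtain M where M: "\<And>n. n \<ge> M \<Longrightarrow> b n s \<le> r / 2"
      using LIMSEQ_D[OF b(3)[of s], of "r / 2"] by fastforce
    show "\<exists>no. \<forall>n\<ge>no. norm (b' n s - 0) < r"
    proof (intro exI allI impI)
      fix m assume "M \<le> m"
      then have "b' m s \<le> r / 2"
        unfolding b'_def using M by (intro cSUP_least) auto
      moreover have "0 \<le> b' m s" by (rule b'(2))
      ultimately show "norm (b' m s - 0) < r" using \<open>0 < r\<close> by simp
    qed
  qed
  define e where "e s = (INF m. d' m s)" for s
  have e_lim: "(\<lambda>m. d' m s) \<longlonglongrightarrow> e s" for s
    unfolding e_def by (rule LIMSEQ_decseq_INF[OF _ d'(4)]) (auto intro: bdd_belowI2 d'(2))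
  have [measurable]: "e \<in> borel_measurable borel"
    by (rule borel_measurable_LIMSEQ_metric[OF _ e_lim]) simp
  have e: "0 \<le> e s" "e s \<le> C * exp (- \<beta> * s)" for s
    using d'(2,3) by (auto intro!: LIMSEQ_le_const[OF e_lim] LIMSEQ_le_const2[OF e_lim])
  have bound: "L * d' m s + b' m s \<le> (L * C + D) * exp (- \<beta> * s)" "0 \<le> L * d' m s + b' m s" for m s
    using d'(2,3) b'(2,3) L_nonneg
    by (auto simp: distrib_right mult.assoc intro!: add_mono mult_left_mono)
  \<comment> \<open>The right side is monotone in d and b, so the inequality for each n >= m passes
    to the suprema over the tail. This form is stable under the monotone limit in m.\<close>
  have step: "d' m t \<le> (LINT s|lborel. \<kappa> (t - s) * (L * d' m s + b' m s))" for m t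
    unfolding d'_def[of m t]
  proof (rule cSUP_least)
    fix n assume "n \<in> {m..}"
    then have n: "m \<le> n" by simp
    have le: "L * d n s + b n s \<le> L * d' m s + b' m s" for s
      using d'(1)[OF n] b'(1)[OF n] L_nonneg by (intro add_mono mult_left_mono)
    note ineq[of n t]
    also have "(LINT s|lborel. \<kappa> (t - s) * (L * d n s + b n s)) \<le> (LINT s|lborel. \<kappa> (t - s) * (L * d' m s + b' m s))"
    proof (rule integral_mono)
      have "\<bar>L * d n s + b n s\<bar> \<le> (L * C + D) * exp (- \<beta> * s)" for s
        using le[of s] bound(1)[of m s] d(1) b(1) L_nonneg by (simp add: abs_of_nonneg)
      then show "integrable lborel (\<lambda>s. \<kappa> (t - s) * (L * d n s + b n s))"
        by (intro kernel_integrable_real) auto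
      show "integrable lborel (\<lambda>s. \<kappa> (t - s) * (L * d' m s + b' m s))"
        using bound by (intro kernel_integrable_real) auto
    qed (use le \<kappa>_nonneg in \<open>auto intro: mult_left_mono\<close>)
    finally show "d n t \<le> (LINT s|lborel. \<kappa> (t - s) * (L * d' m s + b' m s))" .
  qed simp
  have "e t \<le> (LINT s|lborel. \<kappa> (t - s) * (L * e s + 0))" for t
  proof (rule LIMSEQ_le[OF e_lim _ exI[of _ 0]])
    show "(\<lambda>m. LINT s|lborel. \<kappa> (t - s) * (L * d' m s + b' m s)) \<longlonglongrightarrow> (LINT s|lborel. \<kappa> (t - s) * (L * e s + 0))"
    proof (rule integral_dominated_convergence[OF _ _ kernel_integrable[of t "L * C + D"]])
      show "AE s in lborel. (\<lambda>m. \<kappa> (t - s) * (L * d' m s + b' m s)) \<longlonglongrightarrow> \<kappa> (t - s) * (L * e s + 0)"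
        by (intro AE_I2 tendsto_intros e_lim b'_lim)
      show "AE s in lborel. norm (\<kappa> (t - s) * (L * d' m s + b' m s)) \<le> \<kappa> (t - s) * ((L * C + D) * exp (- \<beta> * s))" for m
        using bound[of m] \<kappa>_nonneg by (auto simp: abs_mult intro!: mult_left_mono)
    qed simp_all
  qed (use step in auto)
  then have "e t \<le> 0 / (1 - L * c) * exp (- \<beta> * t)"
    by (intro gronwall[OF _ e]) auto
  then have "e t = 0" using e(1)[of t] by simp
  then have lim: "(\<lambda>m. d' m t) \<longlonglongrightarrow> 0" using e_lim[of t] by simp
  show ?thesis
  proof (rule Lim_null_comparison[OF _ lim], intro always_eventually allI)
    show "norm (d n t) \<le> d' n t" for n
      using d'(1)[of n n t] d(1)[of n t] by simp
  qed
qed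

section \<open>Picard iteration and its limit\<close>

primrec picard :: "(real \<Rightarrow> 'a) \<Rightarrow> (real \<Rightarrow> 'a \<Rightarrow> 'a) \<Rightarrow> nat \<Rightarrow> real \<Rightarrow> 'a" where
  "picard a f 0 = (\<lambda>_. 0)"
| "picard a f (Suc n) = (\<lambda>t. a t + conv (\<lambda>s. f s (picard a f n s)) t)"

text \<open>Using \<open>lim\<close> makes the solution an explicit limit defined for all data.
  Joint measurability then follows from that of the iterates, without any selection of fixed
  points.\<close>

definition lp :: "(real \<Rightarrow> 'a) \<Rightarrow> (real \<Rightarrow> 'a \<Rightarrow> 'a) \<Rightarrow> real \<Rightarrow> 'a" where
  "lp a f t = lim (\<lambda>n. picard a f n t)"

lemmas picard_simps = picard.simps
declare picard.simps [simp del]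

lemma picard_measurable_pair:
  assumes a: "(\<lambda>(w, t). a w t) \<in> borel_measurable (M \<Otimes>\<^sub>M borel)"
    and f: "(\<lambda>(w, s, x). f w s x) \<in> borel_measurable (M \<Otimes>\<^sub>M borel \<Otimes>\<^sub>M borel)"
  shows "(\<lambda>(w, t). picard (a w) (f w) n t) \<in> borel_measurable (M \<Otimes>\<^sub>M borel)"
proof (induction n)
  case (Suc n)
  have "(\<lambda>z. (fst z, snd z, picard (a (fst z)) (f (fst z)) n (snd z)))
      \<in> measurable (M \<Otimes>\<^sub>M borel) (M \<Otimes>\<^sub>M borel \<Otimes>\<^sub>M borel)"
    using Suc unfolding split_beta' by measurable
  from measurable_compose[OF this f]
  have "(\<lambda>(w, s). f w s (picard (a w) (f w) n s)) \<in> borel_measurable (M \<Otimes>\<^sub>M borel)"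
    by (simp add: split_beta')
  from conv_measurable_pair[OF this] a show ?case
    unfolding picard_simps split_beta' by simp
qed (simp add: picard_simps)

lemma lp_measurable_pair:
  assumes a: "(\<lambda>(w, t). a w t) \<in> borel_measurable (M \<Otimes>\<^sub>M borel)"
    and f: "(\<lambda>(w, s, x). f w s x) \<in> borel_measurable (M \<Otimes>\<^sub>M borel \<Otimes>\<^sub>M borel)"
  shows "(\<lambda>(w, t). lp (a w) (f w) t) \<in> borel_measurable (M \<Otimes>\<^sub>M borel)"
  using picard_measurable_pair[OF a f]
  unfolding lp_def split_beta' by (intro borel_measurable_lim_metric) auto

context
  fixes f :: "real \<Rightarrow> 'a \<Rightarrow> 'a" and a :: "real \<Rightarrow> 'a" and A :: real
  assumes f: "forcing L f" and a [measurable]: "a \<in> borel_measurable borel" and A: "exp_bounded \<beta> A a"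
begin

lemma picard_measurable [measurable]: "picard a f n \<in> borel_measurable borel"
proof (induction n)
  case (Suc n)
  then have [measurable]: "(\<lambda>s. f s (picard a f n s)) \<in> borel_measurable borel"
    by (intro forcing_comp_measurable[OF f]) auto
  show ?case unfolding picard_simps by measurable
qed (simp add: picard_simps)

lemma forcing_picard_measurable [measurable]: "(\<lambda>s. f s (picard a f n s)) \<in> borel_measurable borel"
  by (intro forcing_comp_measurable[OF f]) auto

text \<open>The radius R = A / (1 - L c) solves A + L c R = R, so the ball of this radius is mapped
  into itself.\<close>

lemma picard_bound: "exp_bounded \<beta> (A / (1 - L * c)) (picard a f n)"
proof (induction n)
  case 0
  show ?case using exp_bounded_nonneg[OF A] Lc by (simp add: picard_simps exp_bounded_def)
next
  case (Suc n)
  have "exp_bounded \<beta> (A + c * (L * (A / (1 - L * c)))) (picard a f (Suc n))"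
    unfolding picard_simps
    by (intro exp_bounded_add A exp_bounded_conv exp_bounded_forcing[OF f L_nonneg Suc]) simp
  moreover have "A + c * (L * (A / (1 - L * c))) = A / (1 - L * c)"
    using Lc by (simp add: field_simps)
  ultimately show ?case by simp
qed

lemma picard_diff_bound: "exp_bounded \<beta> ((L * c) ^ n * A) (\<lambda>t. picard a f (Suc n) t - picard a f n t)"
proof (induction n)
  case 0
  have "conv (\<lambda>s. 0) t = 0" for t
    by (simp add: conv_def linear_0[OF bounded_linear.linear[OF K_lin]])
  then show ?case using A by (simp add: picard_simps forcing_zero[OF f])
next
  case (Suc n)
  have eq: "picard a f (Suc (Suc n)) t - picard a f (Suc n) t =
      conv (\<lambda>s. f s (picard a f (Suc n) s) - f s (picard a f n s)) t" for t
    unfolding picard_simps(2)[of _ _ "Suc n"]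
    by (subst conv_diff[OF _ exp_bounded_forcing[OF f L_nonneg picard_bound] _ exp_bounded_forcing[OF f L_nonneg picard_bound]])
       (simp_all, simp add: picard_simps)
  have "exp_bounded \<beta> (L * ((L * c) ^ n * A)) (\<lambda>s. f s (picard a f (Suc n) s) - f s (picard a f n s))"
    unfolding exp_bounded_def
  proof
    fix s
    have "norm (f s (picard a f (Suc n) s) - f s (picard a f n s)) \<le> L * norm (picard a f (Suc n) s - picard a f n s)"
      by (rule forcing_lipschitz[OF f])
    also have "\<dots> \<le> L * ((L * c) ^ n * A * exp (- \<beta> * s))"
      by (intro mult_left_mono L_nonneg exp_boundedD[OF Suc])
    finally show "norm (f s (picard a f (Suc n) s) - f s (picard a f n s)) \<le> L * ((L * c) ^ n * A) * exp (- \<beta> * s)"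
      by (simp add: mult_ac)
  qed
  from exp_bounded_conv[OF _ this] show ?case
    unfolding eq by (simp add: mult_ac)
qed

lemma picard_LIMSEQ: "(\<lambda>n. picard a f n t) \<longlonglongrightarrow> lp a f t"
proof -
  have "summable (\<lambda>n. picard a f (Suc n) t - picard a f n t)"
  proof (rule summable_comparison_test)
    show "\<exists>N. \<forall>n\<ge>N. norm (picard a f (Suc n) t - picard a f n t) \<le> (L * c) ^ n * (A * exp (- \<beta> * t))"
      using exp_boundedD[OF picard_diff_bound] by (auto simp: mult.assoc)
    show "summable (\<lambda>n. (L * c) ^ n * (A * exp (- \<beta> * t)))"
      using Lc by (intro summable_mult2 summable_geometric) simp
  qed
  then have "convergent (\<lambda>n. picard a f n t - picard a f 0 t)"
    unfolding summable_iff_convergent sum_lessThan_telescope[of "\<lambda>n. picard a f n t"] .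
  then have "convergent (\<lambda>n. picard a f n t)"
    by (simp add: picard_simps(1))
  then show ?thesis unfolding lp_def by (rule convergent_LIMSEQ_iff[THEN iffD1])
qed

lemma lp_measurable [measurable]: "lp a f \<in> borel_measurable borel"
  by (rule borel_measurable_LIMSEQ_metric[OF _ picard_LIMSEQ]) simp

lemma lp_bound: "exp_bounded \<beta> (A / (1 - L * c)) (lp a f)"
  unfolding exp_bounded_def
  by (auto intro!: LIMSEQ_le_const2[OF tendsto_norm[OF picard_LIMSEQ]] exI[of _ 0] exp_boundedD[OF picard_bound, simplified])

lemma lp_forcing_bound: "exp_bounded \<beta> (L * (A / (1 - L * c))) (\<lambda>s. f s (lp a f s))"
  by (rule exp_bounded_forcing[OF f L_nonneg lp_bound])

lemma lp_forcing_measurable [measurable]: "(\<lambda>s. f s (lp a f s)) \<in> borel_measurable borel"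
  by (intro forcing_comp_measurable[OF f]) auto

text \<open>The recursion passes to the limit: f is continuous in the state, and the uniform bound
  on the iterates provides the majorant for dominated convergence.\<close>

lemma lp_fixed_point: "lp a f t = a t + conv (\<lambda>s. f s (lp a f s)) t"
proof (rule LIMSEQ_unique)
  show "(\<lambda>n. picard a f (Suc n) t) \<longlonglongrightarrow> lp a f t"
    using picard_LIMSEQ by (rule LIMSEQ_Suc)
  have f_lim: "(\<lambda>n. f s (picard a f n s)) \<longlonglongrightarrow> f s (lp a f s)" for s
  proof (rule Lim_null_comparison[THEN Lim_null[THEN iffD2]])
    show "\<forall>\<^sub>F n in sequentially. norm (f s (picard a f n s) - f s (lp a f s)) \<le> L * norm (picard a f n s - lp a f s)"
      by (intro always_eventually allI forcing_lipschitz[OF f])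
    show "(\<lambda>n. L * norm (picard a f n s - lp a f s)) \<longlonglongrightarrow> 0"
      by (intro tendsto_mult_right_zero tendsto_norm_zero picard_LIMSEQ[THEN Lim_null[THEN iffD1]])
  qed
  have "(\<lambda>n. conv (\<lambda>s. f s (picard a f n s)) t) \<longlonglongrightarrow> conv (\<lambda>s. f s (lp a f s)) t"
    unfolding conv_def
  proof (rule integral_dominated_convergence[OF _ _ kernel_integrable[of t "L * (A / (1 - L * c))"]])
    show "AE s in lborel. (\<lambda>n. K (t - s) (f s (picard a f n s))) \<longlonglongrightarrow> K (t - s) (f s (lp a f s))"
      by (intro AE_I2 bounded_linear.tendsto[OF K_lin] f_lim)
    show "AE s in lborel. norm (K (t - s) (f s (picard a f n s))) \<le> \<kappa> (t - s) * (L * (A / (1 - L * c)) * exp (- \<beta> * s))" for n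
      using order_trans[OF K_bound mult_left_mono[OF exp_boundedD[OF exp_bounded_forcing[OF f L_nonneg picard_bound]] \<kappa>_nonneg]]
      by (intro AE_I2)
  qed simp_all
  then show "(\<lambda>n. picard a f (Suc n) t) \<longlonglongrightarrow> a t + conv (\<lambda>s. f s (lp a f s)) t"
    unfolding picard_simps by (intro tendsto_intros)
qed

end

text \<open>Common core of uniqueness (A = 0) and of Lipschitz dependence on the inhomogeneity.
  Asking only for an inequality on \<open>y\<close> admits paths cut off outside an interval, whose
  difference vanishes where the fixed point equation fails.\<close>

lemma fixed_point_diff_bound:
  assumes [measurable]: "p \<in> borel_measurable borel" "q \<in> borel_measurable borel"
      "y \<in> borel_measurable borel"
    and p: "exp_bounded \<beta> P p" and q: "exp_bounded \<beta> Q q" and y: "exp_bounded \<beta> Y y"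
    and pq: "\<And>s. norm (p s - q s) \<le> L * norm (y s)"
    and le: "\<And>t. norm (y t) \<le> A * exp (- \<beta> * t) + norm (conv p t - conv q t)"
  shows "exp_bounded \<beta> (A / (1 - L * c)) y"
  unfolding exp_bounded_def
proof
  fix t
  show "norm (y t) \<le> A / (1 - L * c) * exp (- \<beta> * t)"
  proof (rule gronwall[where d = "\<lambda>t. norm (y t)" and C = Y])
    fix t
    have "norm (conv p t - conv q t) = norm (conv (\<lambda>s. p s - q s) t)"
      by (subst conv_diff[OF _ p _ q]) auto
    also have "\<dots> \<le> (LINT s|lborel. \<kappa> (t - s) * (L * norm (y s)))"
    proof (rule norm_conv_le[OF _ exp_bounded_diff[OF p q] _ pq])
      show "L * norm (y s) \<le> (L * Y) * exp (- \<beta> * s)" for s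
        unfolding mult.assoc by (intro mult_left_mono exp_boundedD[OF y] L_nonneg)
    qed auto
    finally show "norm (y t) \<le> A * exp (- \<beta> * t) + (LINT s|lborel. \<kappa> (t - s) * (L * norm (y s)))"
      using le[of t] by linarith
  qed (auto intro: exp_boundedD[OF y, simplified])
qed

lemma lp_unique:
  assumes f: "forcing L f" and a [measurable]: "a \<in> borel_measurable borel" and A: "exp_bounded \<beta> A a"
    and y [measurable]: "y \<in> borel_measurable borel" and Y: "exp_bounded \<beta> Y y"
    and fp: "\<And>t. y t = a t + conv (\<lambda>s. f s (y s)) t"
  shows "y = lp a f"
proof -
  note [measurable] = lp_measurable[OF f a A] lp_forcing_measurable[OF f a A] forcing_comp_measurable[OF f]
  have "exp_bounded \<beta> (0 / (1 - L * c)) (\<lambda>t. y t - lp a f t)"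
  proof (rule fixed_point_diff_bound[OF _ _ _ exp_bounded_forcing[OF f L_nonneg Y] lp_forcing_bound[OF f a A]
        exp_bounded_diff[OF Y lp_bound[OF f a A]] forcing_lipschitz[OF f]])
    show "norm (y t - lp a f t) \<le> 0 * exp (- \<beta> * t) + norm (conv (\<lambda>s. f s (y s)) t - conv (\<lambda>s. f s (lp a f s)) t)" for t
      by (subst fp, subst lp_fixed_point[OF f a A]) simp
  qed measurable
  then show ?thesis by (simp add: exp_bounded_def fun_eq_iff)
qed

lemma lp_diff_bound:
  assumes f: "forcing L f"
    and a [measurable]: "a \<in> borel_measurable borel" and A: "exp_bounded \<beta> A a"
    and b [measurable]: "b \<in> borel_measurable borel" and B: "exp_bounded \<beta> B b"
    and D: "exp_bounded \<beta> D (\<lambda>t. a t - b t)"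
  shows "exp_bounded \<beta> (D / (1 - L * c)) (\<lambda>t. lp a f t - lp b f t)"
proof -
  note [measurable] = lp_measurable[OF f a A] lp_forcing_measurable[OF f a A]
    lp_measurable[OF f b B] lp_forcing_measurable[OF f b B]
  show ?thesis
  proof (rule fixed_point_diff_bound[OF _ _ _ lp_forcing_bound[OF f a A] lp_forcing_bound[OF f b B]
        exp_bounded_diff[OF lp_bound[OF f a A] lp_bound[OF f b B]] forcing_lipschitz[OF f]])
    fix t
    let ?p = "conv (\<lambda>s. f s (lp a f s)) t" and ?q = "conv (\<lambda>s. f s (lp b f s)) t"
    have "lp a f t - lp b f t = (a t - b t) + (?p - ?q)"
      by (subst (1 2) lp_fixed_point[OF f]) (rule a A b B | simp)+
    then show "norm (lp a f t - lp b f t) \<le> D * exp (- \<beta> * t) + norm (?p - ?q)"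
      using exp_boundedD[OF D, of t] norm_triangle_ineq[of "a t - b t" "?p - ?q"] by simp
  qed measurable
qed

end

section \<open>Continuity of convolutions\<close>

context conv_kernel
begin

text \<open>The singularity of the kernel sits at s = t and moves with t, so dominated convergence
  has no fixed majorant to work with. The moving majorants \<open>g (x n)\<close> converge almost
  everywhere together with their integrals, hence in L1, by Scheffe's argument. The integrand is
  split into a part truncated at \<open>2 * g t\<close> and an excess controlled by this L1
  distance.\<close>

lemma conv_continuous:
  assumes [measurable]: "p \<in> borel_measurable borel" and p: "exp_bounded \<beta> C p"
  shows "continuous_on UNIV (conv p)"
proof (rule continuous_on_sequentiallyI)
  fix x :: "nat \<Rightarrow> real" and t
  assume x: "x \<longlonglongrightarrow> t"
  have C: "0 \<le> C" using p by (rule exp_bounded_nonneg)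
  define g where "g t s = \<kappa> (t - s) * (C * exp (- \<beta> * s))" for t s
  have g_nonneg: "0 \<le> g t s" for t s
    unfolding g_def using \<kappa>_nonneg C by simp
  have g_int: "has_bochner_integral lborel (g t) (c * C * exp (- \<beta> * t))" for t
    unfolding g_def by (rule kernel_integral)
  then have gi: "integrable lborel (g t)" "integral\<^sup>L lborel (g t) = c * C * exp (- \<beta> * t)" for t
    by (simp_all add: has_bochner_integral_iff)
  have [measurable]: "g t \<in> borel_measurable lborel" for t
    using gi by (intro borel_measurable_integrable)
  have ne: "AE s in lborel. s \<noteq> t"
    by (rule AE_lborel_singleton)
  have xs: "(\<lambda>n. x n - s) \<longlonglongrightarrow> t - s" for s
    by (intro tendsto_intros x)
  have g_lim: "AE s in lborel. (\<lambda>n. g (x n) s) \<longlonglongrightarrow> g t s"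
    using ne
  proof eventually_elim
    case (elim s)
    show ?case unfolding g_def
      using isCont_tendsto_compose[OF \<kappa>_cont xs, of s] elim by (intro tendsto_intros) auto
  qed
  define k where "k n s = K (x n - s) (p s) - K (t - s) (p s)" for n s
  have [measurable]: "k n \<in> borel_measurable lborel" for n unfolding k_def by measurable
  have k_lim: "AE s in lborel. (\<lambda>n. k n s) \<longlonglongrightarrow> 0"
    using ne
  proof eventually_elim
    case (elim s)
    have "(\<lambda>n. K (x n - s) (p s)) \<longlonglongrightarrow> K (t - s) (p s)"
      using isCont_tendsto_compose[OF K_cont xs, of s "p s"] elim by auto
    then show ?case unfolding k_def by (simp add: LIM_zero)
  qed
  have Kg: "norm (K (t - s) (p s)) \<le> g t s" for t s
    unfolding g_def
    using order_trans[OF K_bound mult_left_mono[OF exp_boundedD[OF p] \<kappa>_nonneg]] .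
  \<comment> \<open>Indeed norm (k n s) <= g (x n) s + g t s <= 2 g t s + |g (x n) s - g t
    s|.\<close>
  have k_bound: "norm (k n s) \<le> min (norm (k n s)) (2 * g t s) + \<bar>g (x n) s - g t s\<bar>" for n s
    using Kg[of "x n" s] Kg[of t s] norm_triangle_ineq4[of "K (x n - s) (p s)" "K (t - s) (p s)"]
    unfolding k_def by linarith
  have "(\<lambda>n. \<integral>s. min (norm (k n s)) (2 * g t s) \<partial>lborel) \<longlonglongrightarrow> (\<integral>s. 0 \<partial>(lborel :: real measure))"
  proof (rule integral_dominated_convergence[where w = "\<lambda>s. 2 * g t s"])
    show "AE s in lborel. (\<lambda>n. min (norm (k n s)) (2 * g t s)) \<longlonglongrightarrow> 0"
      using k_lim
    proof eventually_elim
      case (elim s)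
      have "(\<lambda>n. min (norm (k n s)) (2 * g t s)) \<longlonglongrightarrow> min (norm (0::'a)) (2 * g t s)"
        by (intro tendsto_intros elim)
      then show ?case using g_nonneg[of t s] by simp
    qed
    show "AE s in lborel. norm (min (norm (k n s)) (2 * g t s)) \<le> 2 * g t s" for n
      using g_nonneg by (auto simp: abs_of_nonneg)
  qed (use gi in auto)
  moreover have "(\<lambda>n. \<integral>s. \<bar>g (x n) s - g t s\<bar> \<partial>lborel) \<longlonglongrightarrow> 0"
  proof -
    have 1: "(\<lambda>n. \<integral>s. min (g (x n) s) (g t s) \<partial>lborel) \<longlonglongrightarrow> (\<integral>s. g t s \<partial>lborel)"
    proof (rule integral_dominated_convergence[where w = "g t"])
      show "AE s in lborel. (\<lambda>n. min (g (x n) s) (g t s)) \<longlonglongrightarrow> g t s"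
        using g_lim
      proof eventually_elim
        case (elim s)
        have "(\<lambda>n. min (g (x n) s) (g t s)) \<longlonglongrightarrow> min (g t s) (g t s)"
          by (intro tendsto_intros elim)
        then show ?case by simp
      qed
      show "AE s in lborel. norm (min (g (x n) s) (g t s)) \<le> g t s" for n
        using g_nonneg by auto
    qed (use gi in auto)
    \<comment> \<open>From |a - b| = a + b - 2 min a b. The integrals of a and b are known, and the
      minimum has the fixed majorant \<open>g t\<close>.\<close>
    have 2: "(\<integral>s. \<bar>g (x n) s - g t s\<bar> \<partial>lborel) =
        c * C * exp (- \<beta> * x n) + c * C * exp (- \<beta> * t) - 2 * (\<integral>s. min (g (x n) s) (g t s) \<partial>lborel)" for n
    proof -
      have "(\<integral>s. \<bar>g (x n) s - g t s\<bar> \<partial>lborel) = (\<integral>s. g (x n) s + g t s - 2 * min (g (x n) s) (g t s) \<partial>lborel)"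
        by (intro Bochner_Integration.integral_cong) auto
      also have "\<dots> = (\<integral>s. g (x n) s \<partial>lborel) + (\<integral>s. g t s \<partial>lborel) - 2 * (\<integral>s. min (g (x n) s) (g t s) \<partial>lborel)"
        using gi by (simp add: integrable_min)
      finally show ?thesis by (simp add: gi)
    qed
    have "(\<lambda>n. \<integral>s. \<bar>g (x n) s - g t s\<bar> \<partial>lborel) \<longlonglongrightarrow>
        c * C * exp (- \<beta> * t) + c * C * exp (- \<beta> * t) - 2 * (\<integral>s. g t s \<partial>lborel)"
      unfolding 2 by (intro tendsto_intros x 1)
    then show ?thesis by (simp add: gi)
  qed
  ultimately have lim0: "(\<lambda>n. (\<integral>s. min (norm (k n s)) (2 * g t s) \<partial>lborel) + (\<integral>s. \<bar>g (x n) s - g t s\<bar> \<partial>lborel)) \<longlonglongrightarrow> 0"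
    using tendsto_add by fastforce
  have int: "integrable lborel (\<lambda>s. K (t - s) (p s))" for t
    by (rule conv_integrable[OF _ p]) simp
  have mi: "integrable lborel (\<lambda>s. min (norm (k n s)) (2 * g t s))" for n
    by (rule Bochner_Integration.integrable_bound[where f = "\<lambda>s. 2 * g t s"])
       (use gi g_nonneg in auto)
  have "norm (conv p (x n) - conv p t) \<le> (\<integral>s. min (norm (k n s)) (2 * g t s) \<partial>lborel) + (\<integral>s. \<bar>g (x n) s - g t s\<bar> \<partial>lborel)" for n
  proof -
    have "conv p (x n) - conv p t = (\<integral>s. k n s \<partial>lborel)"
      unfolding conv_def k_def using int by simp
    also have "norm \<dots> \<le> (\<integral>s. min (norm (k n s)) (2 * g t s) + \<bar>g (x n) s - g t s\<bar> \<partial>lborel)"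
      by (rule Bochner_Integration.integral_norm_bound_integral)
         (use int k_bound gi mi in \<open>auto simp: k_def\<close>)
    finally show ?thesis using gi mi by simp
  qed
  then have "(\<lambda>n. conv p (x n) - conv p t) \<longlonglongrightarrow> 0"
    by (intro Lim_null_comparison[OF _ lim0] always_eventually) auto
  then show "(\<lambda>n. conv p (x n)) \<longlonglongrightarrow> conv p t"
    by (simp add: LIM_zero_cancel)
qed

end

text \<open>Writing the derivative as the limit of a sequence of difference quotients transfers both
  the Lipschitz bound and measurability from a function to its derivative.\<close>

lemma directional_LIMSEQ:
  assumes "(f has_derivative f') (at x)"
  shows "(\<lambda>n. real (Suc n) *\<^sub>R (f (x + inverse (real (Suc n)) *\<^sub>R y) - f x)) \<longlonglongrightarrow> f' y"
proof (cases "y = 0")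
  case True
  then show ?thesis using assms by (simp add: has_derivative_def linear_simps)
next
  case False
  define h where "h n = inverse (real (Suc n)) *\<^sub>R y" for n
  have h_nz: "h n \<noteq> 0" for n using False by (simp add: h_def)
  have lin: "bounded_linear f'" and lim: "((\<lambda>h. norm (f (x + h) - f x - f' h) / norm h) \<longlongrightarrow> 0) (at 0)"
    using assms by (auto simp: has_derivative_at)
  have "h \<longlonglongrightarrow> 0 *\<^sub>R y"
    unfolding h_def[abs_def] by (intro tendsto_intros LIMSEQ_inverse_real_of_nat)
  then have "filterlim h (at 0) sequentially"
    using h_nz by (auto simp: filterlim_at)
  from tendsto_mult_left_zero[OF filterlim_compose[OF lim this], of "norm y"]
  have "(\<lambda>n. norm (f (x + h n) - f x - f' (h n)) / norm (h n) * norm y) \<longlonglongrightarrow> 0" .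
  moreover have "norm (f (x + h n) - f x - f' (h n)) / norm (h n) * norm y =
      norm (real (Suc n) *\<^sub>R (f (x + h n) - f x) - f' y)" for n
  proof -
    have "f' y = real (Suc n) *\<^sub>R f' (h n)"
      unfolding h_def using lin by (simp add: linear_simps)
    then have "norm (real (Suc n) *\<^sub>R (f (x + h n) - f x) - f' y) = real (Suc n) * norm (f (x + h n) - f x - f' (h n))"
      by (simp only: scaleR_diff_right[symmetric] norm_scaleR abs_of_nat)
    moreover have "norm (h n) * real (Suc n) = norm y"
      unfolding h_def by (simp del: of_nat_Suc)
    ultimately show ?thesis
      using h_nz[of n] False by (simp add: field_simps del: of_nat_Suc)
  qed
  ultimately have "(\<lambda>n. norm (real (Suc n) *\<^sub>R (f (x + h n) - f x) - f' y)) \<longlonglongrightarrow> 0" by simp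
  then show ?thesis
    unfolding h_def[symmetric] by (rule LIM_zero_cancel[OF tendsto_norm_zero_cancel])
qed

section \<open>Differentiability of the fixed point in a linear parameter\<close>

locale smooth_forcing = conv_kernel K \<kappa> \<beta> c L
  for K :: "real \<Rightarrow> 'a::{banach,second_countable_topology} \<Rightarrow> 'a" and \<kappa> \<beta> c L +
  fixes f :: "real \<Rightarrow> 'a \<Rightarrow> 'a" and Df :: "real \<Rightarrow> 'a \<Rightarrow> 'a \<Rightarrow>\<^sub>L 'a"
    and a :: "'b::real_normed_vector \<Rightarrow> real \<Rightarrow> 'a"
  assumes f: "forcing L f"
    and Df: "(f s has_derivative blinfun_apply (Df s x)) (at x)"
    and Df_cont: "continuous_on UNIV (Df s)"
    and a_meas [measurable]: "a \<xi> \<in> borel_measurable borel"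
    and a_linear: "linear (\<lambda>\<xi>. a \<xi> t)"
    and a_bound: "exp_bounded \<beta> (norm \<xi>) (a \<xi>)"
begin

lemma norm_Df_le: "norm (Df s x y) \<le> L * norm y"
proof (rule LIMSEQ_le_const2[OF tendsto_norm[OF directional_LIMSEQ[OF Df]]], intro exI[of _ 0] allI impI)
  fix n
  have "norm (f s (x + inverse (real (Suc n)) *\<^sub>R y) - f s x) \<le> L * norm (inverse (real (Suc n)) *\<^sub>R y)"
    using forcing_lipschitz[OF f, of s "x + inverse (real (Suc n)) *\<^sub>R y" x] by simp
  then have "real (Suc n) * norm (f s (x + inverse (real (Suc n)) *\<^sub>R y) - f s x) \<le> real (Suc n) * (L * norm (inverse (real (Suc n)) *\<^sub>R y))"
    by (rule mult_left_mono) simp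
  also have "\<dots> = L * norm y" by (simp del: of_nat_Suc)
  finally show "norm (real (Suc n) *\<^sub>R (f s (x + inverse (real (Suc n)) *\<^sub>R y) - f s x)) \<le> L * norm y"
    by (simp only: norm_scaleR abs_of_nat)
qed

definition \<phi> :: "'b \<Rightarrow> real \<Rightarrow> 'a" where "\<phi> \<xi> = lp (a \<xi>) f"

lemma \<phi>_meas [measurable]: "\<phi> \<xi> \<in> borel_measurable borel"
  unfolding \<phi>_def by (rule lp_measurable[OF f a_meas a_bound])

definition g :: "'b \<Rightarrow> real \<Rightarrow> 'a \<Rightarrow> 'a" where "g \<xi> s y = Df s (\<phi> \<xi> s) y"

text \<open>Joint measurability comes from f: the difference quotients of f along \<phi> are jointly
  measurable and converge to g. Linearity and \<open>norm_Df_le\<close> give the Lipschitz bound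
  with the same L, so the linearised equation is again a contraction.\<close>

lemma g_forcing: "forcing L (g \<xi>)"
  unfolding forcing_def
proof (intro conjI allI)
  note [measurable (raw)] = forcing_comp_measurable[OF f]
  show "(\<lambda>(s, x). g \<xi> s x) \<in> borel_measurable (borel \<Otimes>\<^sub>M borel)"
    unfolding split_beta'
  proof (rule borel_measurable_LIMSEQ_metric)
    show "(\<lambda>n. real (Suc n) *\<^sub>R (f (fst z) (\<phi> \<xi> (fst z) + inverse (real (Suc n)) *\<^sub>R snd z) - f (fst z) (\<phi> \<xi> (fst z))))
        \<longlonglongrightarrow> g \<xi> (fst z) (snd z)" for z
      unfolding g_def by (rule directional_LIMSEQ[OF Df])
  qed measurable
  show "norm (g \<xi> s x - g \<xi> s y) \<le> L * norm (x - y)" for s x y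
    unfolding g_def blinfun.diff_right[symmetric] by (rule norm_Df_le)
qed (simp add: g_def)

text \<open>The solution of the variational equation along \<open>\<phi> \<xi>\<close> in direction
  h, the candidate for the derivative of the fixed point.\<close>

definition \<Phi> :: "'b \<Rightarrow> real \<Rightarrow> 'b \<Rightarrow> 'a" where "\<Phi> \<xi> t h = lp (a h) (g \<xi>) t"

lemma \<Phi>_meas [measurable]: "(\<lambda>t. \<Phi> \<xi> t h) \<in> borel_measurable borel"
  unfolding \<Phi>_def by (rule lp_measurable[OF g_forcing a_meas a_bound])

lemma f_\<phi>_meas [measurable]: "(\<lambda>s. f s (\<phi> \<xi> s)) \<in> borel_measurable borel"
  by (rule forcing_comp_measurable[OF f]) auto

lemma g_\<Phi>_meas [measurable]: "(\<lambda>s. g \<zeta> s (\<Phi> \<xi> s h)) \<in> borel_measurable borel"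
  by (rule forcing_comp_measurable[OF g_forcing]) auto

abbreviation "C \<equiv> 1 / (1 - L * c)"

lemma C_nonneg: "0 \<le> C" using Lc by simp

lemma \<phi>_bound: "exp_bounded \<beta> (norm \<xi> * C) (\<phi> \<xi>)"
  using lp_bound[OF f a_meas a_bound] by (simp add: \<phi>_def)

lemma \<Phi>_bound: "exp_bounded \<beta> (norm h * C) (\<lambda>t. \<Phi> \<xi> t h)"
  using lp_bound[OF g_forcing a_meas a_bound] by (simp add: \<Phi>_def)

lemma \<phi>_fp: "\<phi> \<xi> t = a \<xi> t + conv (\<lambda>s. f s (\<phi> \<xi> s)) t"
  unfolding \<phi>_def by (rule lp_fixed_point[OF f a_meas a_bound])

lemma \<Phi>_fp: "\<Phi> \<xi> t h = a h t + conv (\<lambda>s. g \<xi> s (\<Phi> \<xi> s h)) t"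
  unfolding \<Phi>_def by (rule lp_fixed_point[OF g_forcing a_meas a_bound])

lemma \<phi>_lipschitz: "exp_bounded \<beta> (norm (\<xi> - \<eta>) * C) (\<lambda>t. \<phi> \<xi> t - \<phi> \<eta> t)"
proof -
  have "exp_bounded \<beta> (norm (\<xi> - \<eta>)) (\<lambda>t. a \<xi> t - a \<eta> t)"
    using a_bound[of "\<xi> - \<eta>"] by (simp add: linear_diff[OF a_linear] exp_bounded_def)
  from lp_diff_bound[OF f a_meas a_bound a_meas a_bound this] show ?thesis
    by (simp add: \<phi>_def)
qed

lemma f\<phi>_bound: "exp_bounded \<beta> (L * (norm \<xi> * C)) (\<lambda>s. f s (\<phi> \<xi> s))"
  by (rule exp_bounded_forcing[OF f L_nonneg \<phi>_bound])

lemma g\<Phi>_bound: "exp_bounded \<beta> (L * (norm h * C)) (\<lambda>s. g \<zeta> s (\<Phi> \<xi> s h))"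
  by (rule exp_bounded_forcing[OF g_forcing L_nonneg \<Phi>_bound])

text \<open>Sums and multiples of solutions solve the equation with the corresponding data, so
  uniqueness of the fixed point gives linearity.\<close>

lemma \<Phi>_linear: "linear (\<Phi> \<xi> t)"
proof (rule linearI)
  fix x y
  have "(\<lambda>t. \<Phi> \<xi> t x + \<Phi> \<xi> t y) = lp (a (x + y)) (g \<xi>)"
  proof (rule lp_unique[OF g_forcing a_meas a_bound _ exp_bounded_add[OF \<Phi>_bound \<Phi>_bound]])
    show "\<Phi> \<xi> t x + \<Phi> \<xi> t y = a (x + y) t + conv (\<lambda>s. g \<xi> s (\<Phi> \<xi> s x + \<Phi> \<xi> s y)) t" for t
    proof -
      have "conv (\<lambda>s. g \<xi> s (\<Phi> \<xi> s x + \<Phi> \<xi> s y)) t =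
          conv (\<lambda>s. g \<xi> s (\<Phi> \<xi> s x) + g \<xi> s (\<Phi> \<xi> s y)) t"
        unfolding g_def by (simp add: blinfun.add_right)
      also have "\<dots> = conv (\<lambda>s. g \<xi> s (\<Phi> \<xi> s x)) t + conv (\<lambda>s. g \<xi> s (\<Phi> \<xi> s y)) t"
        by (rule conv_add[OF _ g\<Phi>_bound _ g\<Phi>_bound]) auto
      finally show ?thesis
        using \<Phi>_fp[of \<xi> t x] \<Phi>_fp[of \<xi> t y] by (simp add: linear_add[OF a_linear])
    qed
  qed measurable
  then show "\<Phi> \<xi> t (x + y) = \<Phi> \<xi> t x + \<Phi> \<xi> t y"
    unfolding \<Phi>_def by (simp add: fun_eq_iff)
next
  fix r x
  have "exp_bounded \<beta> (\<bar>r\<bar> * (norm x * C)) (\<lambda>t. r *\<^sub>R \<Phi> \<xi> t x)"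
    unfolding exp_bounded_def norm_scaleR mult.assoc[of "\<bar>r\<bar>"]
    by (intro allI mult_left_mono exp_boundedD[OF \<Phi>_bound]) simp
  then have "(\<lambda>t. r *\<^sub>R \<Phi> \<xi> t x) = lp (a (r *\<^sub>R x)) (g \<xi>)"
  proof (rule lp_unique[OF g_forcing a_meas a_bound, rotated])
    show "r *\<^sub>R \<Phi> \<xi> t x = a (r *\<^sub>R x) t + conv (\<lambda>s. g \<xi> s (r *\<^sub>R \<Phi> \<xi> s x)) t" for t
    proof -
      have "conv (\<lambda>s. g \<xi> s (r *\<^sub>R \<Phi> \<xi> s x)) t = conv (\<lambda>s. r *\<^sub>R g \<xi> s (\<Phi> \<xi> s x)) t"
        unfolding g_def by (simp add: blinfun.scaleR_right)
      then show ?thesis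
        using \<Phi>_fp[of \<xi> t x] by (simp add: linear_scale[OF a_linear] conv_scaleR scaleR_add_right[symmetric])
    qed
  qed measurable
  then show "\<Phi> \<xi> t (r *\<^sub>R x) = r *\<^sub>R \<Phi> \<xi> t x"
    unfolding \<Phi>_def by (simp add: fun_eq_iff)
qed

lemma \<Phi>_bounded_linear: "bounded_linear (\<Phi> \<xi> t)"
proof (rule bounded_linear_intro)
  show "norm (\<Phi> \<xi> t h) \<le> norm h * (C * exp (- \<beta> * t))" for h
    using exp_boundedD[OF \<Phi>_bound] by (simp add: mult.assoc)
qed (auto simp: linear_add[OF \<Phi>_linear] linear_scale[OF \<Phi>_linear])

text \<open>The error w = \<phi> (\<xi> + h) - \<phi> \<xi> - \<Phi> \<xi> h solves w = K * (g w +
  r), where r is the Taylor remainder of f along the increment \<delta>. As \<delta> is at most a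
  multiple of |h| at each time, r / |h| tends to 0 pointwise, which is all that
  \<open>vanishing\<close> requires.\<close>

lemma \<phi>_frechet:
  assumes h: "h \<longlonglongrightarrow> 0" and h_nz: "\<And>n. h n \<noteq> 0"
  shows "(\<lambda>n. norm (\<phi> (\<xi> + h n) t - \<phi> \<xi> t - \<Phi> \<xi> t (h n)) / norm (h n)) \<longlonglongrightarrow> 0"
proof -
  define \<delta> where "\<delta> n s = \<phi> (\<xi> + h n) s - \<phi> \<xi> s" for n s
  define r where "r n s = f s (\<phi> (\<xi> + h n) s) - f s (\<phi> \<xi> s) - g \<xi> s (\<delta> n s)" for n s
  have [measurable]: "\<delta> n \<in> borel_measurable borel" for n
    unfolding \<delta>_def by measurable
  have [measurable]: "(\<lambda>s. g \<xi> s (\<delta> n s)) \<in> borel_measurable borel" for n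
    by (rule forcing_comp_measurable[OF g_forcing]) auto
  have [measurable]: "r n \<in> borel_measurable borel" for n
    unfolding r_def by measurable
  have \<delta>_bound: "exp_bounded \<beta> (norm (h n) * C) (\<delta> n)" for n
    using \<phi>_lipschitz[of "\<xi> + h n" \<xi>] unfolding \<delta>_def[abs_def] by simp
  have r_le: "norm (r n s) \<le> 2 * L * norm (\<delta> n s)" for n s
  proof -
    have "norm (r n s) \<le> norm (f s (\<phi> (\<xi> + h n) s) - f s (\<phi> \<xi> s)) + norm (g \<xi> s (\<delta> n s))"
      unfolding r_def by (rule norm_triangle_ineq4)
    then show ?thesis
      using forcing_lipschitz[OF f, of s "\<phi> (\<xi> + h n) s" "\<phi> \<xi> s"] forcing_bound[OF g_forcing, of \<xi> s "\<delta> n s"]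
      by (simp add: \<delta>_def)
  qed
  show ?thesis
  proof (rule vanishing[where b = "\<lambda>n s. norm (r n s) / norm (h n)" and C = "2 * C" and D = "2 * L * C"])
    show "(\<lambda>s. norm (\<phi> (\<xi> + h n) s - \<phi> \<xi> s - \<Phi> \<xi> s (h n)) / norm (h n)) \<in> borel_measurable borel"
      "(\<lambda>s. norm (r n s) / norm (h n)) \<in> borel_measurable borel" for n
      by measurable
    show "norm (\<phi> (\<xi> + h n) s - \<phi> \<xi> s - \<Phi> \<xi> s (h n)) / norm (h n) \<le> 2 * C * exp (- \<beta> * s)" for n s
    proof -
      have "norm (\<phi> (\<xi> + h n) s - \<phi> \<xi> s - \<Phi> \<xi> s (h n)) \<le> norm (h n) * (2 * C * exp (- \<beta> * s))"
        using exp_boundedD[OF exp_bounded_diff[OF \<delta>_bound[of n] \<Phi>_bound[of "h n" \<xi>]], of s]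
        by (simp add: \<delta>_def algebra_simps)
      then show ?thesis using h_nz[of n] by (simp add: pos_divide_le_eq mult_ac)
    qed
    show "norm (r n s) / norm (h n) \<le> 2 * L * C * exp (- \<beta> * s)" for n s
    proof -
      have "norm (r n s) \<le> 2 * L * (norm (h n) * C * exp (- \<beta> * s))"
        using r_le[of n s] mult_left_mono[OF exp_boundedD[OF \<delta>_bound[of n], of s], of "2 * L"] L_nonneg
        by linarith
      then show ?thesis using h_nz[of n] by (simp add: pos_divide_le_eq mult_ac)
    qed
    show "(\<lambda>n. norm (r n s) / norm (h n)) \<longlonglongrightarrow> 0" for s
    proof (rule LIMSEQ_I)
      fix e :: real assume e: "0 < e"
      define M where "M = C * exp (- \<beta> * s)"
      have M: "0 \<le> M" using C_nonneg by (simp add: M_def)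
      \<comment> \<open>Chosen so that e' * M < e also when M = 0.\<close>
      define e' where "e' = e / (M + 1)"
      have e': "0 < e'" "e' * M < e" using e M by (auto simp: e'_def field_simps)
      from Df[of s "\<phi> \<xi> s"] obtain d where d: "0 < d"
        "\<And>y. norm (y - \<phi> \<xi> s) < d \<Longrightarrow> norm (f s y - f s (\<phi> \<xi> s) - Df s (\<phi> \<xi> s) (y - \<phi> \<xi> s)) \<le> e' * norm (y - \<phi> \<xi> s)"
        unfolding has_derivative_at_alt using e'(1) by blast
      have "(\<lambda>n. norm (h n) * M) \<longlonglongrightarrow> norm (0::'b) * M"
        by (intro tendsto_intros h)
      then have "\<forall>\<^sub>F n in sequentially. norm (h n) * M < d"
        using d(1) by (intro order_tendstoD(2)) auto
      then obtain n0 where n0: "\<And>n. n \<ge> n0 \<Longrightarrow> norm (h n) * M < d"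
        by (auto simp: eventually_sequentially)
      show "\<exists>no. \<forall>n\<ge>no. norm (norm (r n s) / norm (h n) - 0) < e"
      proof (intro exI allI impI)
        fix n assume "n0 \<le> n"
        have 1: "norm (\<delta> n s) \<le> norm (h n) * M"
          using exp_boundedD[OF \<delta>_bound[of n], of s] by (simp add: M_def mult.assoc)
        have "norm (r n s) \<le> e' * norm (\<delta> n s)"
          using d(2)[of "\<phi> (\<xi> + h n) s"] n0[OF \<open>n0 \<le> n\<close>] 1
          by (simp add: r_def g_def \<delta>_def)
        also have "\<dots> \<le> e' * M * norm (h n)"
          using mult_left_mono[OF 1, of e'] e' by (simp add: mult_ac)
        finally have "norm (r n s) / norm (h n) \<le> e' * M"
          using h_nz[of n] by (simp add: pos_divide_le_eq)
        with e'(2) show "norm (norm (r n s) / norm (h n) - 0) < e" by simp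
      qed
    qed
    show "norm (\<phi> (\<xi> + h n) t - \<phi> \<xi> t - \<Phi> \<xi> t (h n)) / norm (h n)
        \<le> (LINT s|lborel. \<kappa> (t - s) * (L * (norm (\<phi> (\<xi> + h n) s - \<phi> \<xi> s - \<Phi> \<xi> s (h n)) / norm (h n)) + norm (r n s) / norm (h n)))" for n t
    proof -
      let ?q = "\<lambda>s. f s (\<phi> (\<xi> + h n) s) - f s (\<phi> \<xi> s) - g \<xi> s (\<Phi> \<xi> s (h n))"
      let ?w = "\<lambda>s. \<phi> (\<xi> + h n) s - \<phi> \<xi> s - \<Phi> \<xi> s (h n)"
      have wb: "exp_bounded \<beta> (norm (h n) * C + norm (h n) * C) ?w"
        using exp_bounded_diff[OF \<delta>_bound[of n] \<Phi>_bound[of "h n" \<xi>]] by (simp add: \<delta>_def)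
      have w_eq: "?w t = conv ?q t"
      proof -
        have "conv ?q t = conv (\<lambda>s. f s (\<phi> (\<xi> + h n) s)) t - conv (\<lambda>s. f s (\<phi> \<xi> s)) t - conv (\<lambda>s. g \<xi> s (\<Phi> \<xi> s (h n))) t"
          by (subst conv_diff[OF _ exp_bounded_diff[OF f\<phi>_bound f\<phi>_bound] _ g\<Phi>_bound], measurable)
             (subst conv_diff[OF _ f\<phi>_bound _ f\<phi>_bound], auto)
        then show ?thesis
          using \<phi>_fp[of "\<xi> + h n" t] \<phi>_fp[of \<xi> t] \<Phi>_fp[of \<xi> t "h n"] by (simp add: linear_add[OF a_linear])
      qed
      have le: "norm (conv ?q t) \<le> (LINT s|lborel. \<kappa> (t - s) * (L * norm (?w s) + norm (r n s)))"
      proof (rule norm_conv_le)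
        show "exp_bounded \<beta> (L * (norm (\<xi> + h n) * C) + L * (norm \<xi> * C) + L * (norm (h n) * C)) ?q"
          by (intro exp_bounded_diff f\<phi>_bound g\<Phi>_bound)
        show "norm (?q s) \<le> L * norm (?w s) + norm (r n s)" for s
        proof -
          \<comment> \<open>Linearity of g splits off the error: \<delta> minus the linear
            prediction is ?w, and r was formed with g applied to \<delta>.\<close>
          have "?q s = g \<xi> s (?w s) + r n s"
            by (simp add: r_def g_def \<delta>_def blinfun.diff_right)
          then show ?thesis
            using norm_triangle_ineq[of "g \<xi> s (?w s)" "r n s"] forcing_bound[OF g_forcing, of \<xi> s "?w s"] by simp
        qed
        show "L * norm (?w s) + norm (r n s) \<le> (L * (norm (h n) * C + norm (h n) * C) + 2 * L * (norm (h n) * C)) * exp (- \<beta> * s)" for s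
          using mult_left_mono[OF exp_boundedD[OF wb, of s] L_nonneg] r_le[of n s]
            mult_left_mono[OF exp_boundedD[OF \<delta>_bound[of n], of s], of "2 * L"] L_nonneg
          by (simp add: distrib_right mult.assoc)
      qed measurable
      have "norm (?w t) / norm (h n) \<le> (LINT s|lborel. \<kappa> (t - s) * (L * norm (?w s) + norm (r n s))) / norm (h n)"
        unfolding w_eq by (rule divide_right_mono[OF le]) simp
      also have "\<dots> = (LINT s|lborel. \<kappa> (t - s) * (L * norm (?w s) + norm (r n s)) / norm (h n))"
        by (rule integral_divide_zero[symmetric])
      also have "\<dots> = (LINT s|lborel. \<kappa> (t - s) * (L * (norm (?w s) / norm (h n)) + norm (r n s) / norm (h n)))"
        by (intro Bochner_Integration.integral_cong refl)
           (metis (no_types, lifting) add_divide_distrib times_divide_eq_right)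
      finally show ?thesis .
    qed
  qed auto
qed

lemma \<phi>_has_derivative: "((\<lambda>\<xi>. \<phi> \<xi> t) has_derivative \<Phi> \<xi> t) (at \<xi>)"
  unfolding has_derivative_at
proof (intro conjI \<Phi>_bounded_linear)
  show "((\<lambda>h. norm (\<phi> (\<xi> + h) t - \<phi> \<xi> t - \<Phi> \<xi> t h) / norm h) \<longlongrightarrow> 0) (at 0)"
    unfolding tendsto_at_iff_sequentially comp_def by (auto intro!: \<phi>_frechet)
qed

text \<open>The directions h n may vary with n, as continuity in the operator norm demands. The
  difference of the two variational solutions is driven by (Df (\<phi> (x n)) - Df (\<phi> \<xi>))
  \<Phi> \<xi> h, which relative to |h| tends to 0 pointwise by continuity of
  \<open>Df s\<close>.\<close>

lemma \<Phi>_continuous: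
  assumes x: "x \<longlonglongrightarrow> \<xi>" and h_nz: "\<And>n. h n \<noteq> 0"
  shows "(\<lambda>n. norm (\<Phi> (x n) t (h n) - \<Phi> \<xi> t (h n)) / norm (h n)) \<longlonglongrightarrow> 0"
proof -
  define r where "r n s = g (x n) s (\<Phi> \<xi> s (h n)) - g \<xi> s (\<Phi> \<xi> s (h n))" for n s
  have [measurable]: "r n \<in> borel_measurable borel" for n
    unfolding r_def by measurable
  have r_bound: "exp_bounded \<beta> (L * (norm (h n) * C) + L * (norm (h n) * C)) (r n)" for n
    unfolding r_def by (intro exp_bounded_diff g\<Phi>_bound)
  have scale: "u / norm (h n) \<le> v" if "u \<le> norm (h n) * v" for u v n
    using that h_nz[of n] by (simp add: pos_divide_le_eq mult.commute)
  show ?thesis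
  proof (rule vanishing[where b = "\<lambda>n s. norm (r n s) / norm (h n)" and C = "2 * C" and D = "2 * L * C"])
    show "(\<lambda>s. norm (\<Phi> (x n) s (h n) - \<Phi> \<xi> s (h n)) / norm (h n)) \<in> borel_measurable borel"
      "(\<lambda>s. norm (r n s) / norm (h n)) \<in> borel_measurable borel" for n
      by measurable
    show "norm (\<Phi> (x n) s (h n) - \<Phi> \<xi> s (h n)) / norm (h n) \<le> 2 * C * exp (- \<beta> * s)" for n s
      using exp_boundedD[OF exp_bounded_diff[OF \<Phi>_bound[of "h n" "x n"] \<Phi>_bound[of "h n" \<xi>]], of s]
      by (intro scale) (simp add: algebra_simps)
    show "norm (r n s) / norm (h n) \<le> 2 * L * C * exp (- \<beta> * s)" for n s
      using exp_boundedD[OF r_bound, of n s]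
      by (intro scale) (simp add: algebra_simps)
    show "(\<lambda>n. norm (r n s) / norm (h n)) \<longlonglongrightarrow> 0" for s
    proof (rule Lim_null_comparison)
      have "(\<lambda>n. norm (x n - \<xi>) * (C * exp (- \<beta> * s))) \<longlonglongrightarrow> norm (\<xi> - \<xi>) * (C * exp (- \<beta> * s))"
        by (intro tendsto_intros x)
      then have lim0: "(\<lambda>n. norm (x n - \<xi>) * (C * exp (- \<beta> * s))) \<longlonglongrightarrow> 0" by simp
      have "(\<lambda>n. \<phi> (x n) s - \<phi> \<xi> s) \<longlonglongrightarrow> 0"
        by (rule Lim_null_comparison[OF always_eventually lim0])
           (use exp_boundedD[OF \<phi>_lipschitz] in \<open>auto simp: mult.assoc\<close>)
      then have "(\<lambda>n. \<phi> (x n) s) \<longlonglongrightarrow> \<phi> \<xi> s" by (rule LIM_zero_cancel)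
      then have "(\<lambda>n. Df s (\<phi> (x n) s)) \<longlonglongrightarrow> Df s (\<phi> \<xi> s)"
        by (intro continuous_on_tendsto_compose[OF Df_cont]) auto
      then have "(\<lambda>n. norm (Df s (\<phi> (x n) s) - Df s (\<phi> \<xi> s)) * (C * exp (- \<beta> * s))) \<longlonglongrightarrow> norm (Df s (\<phi> \<xi> s) - Df s (\<phi> \<xi> s)) * (C * exp (- \<beta> * s))"
        by (intro tendsto_intros)
      then show "(\<lambda>n. norm (Df s (\<phi> (x n) s) - Df s (\<phi> \<xi> s)) * (C * exp (- \<beta> * s))) \<longlonglongrightarrow> 0" by simp
      show "\<forall>\<^sub>F n in sequentially. norm (norm (r n s) / norm (h n)) \<le> norm (Df s (\<phi> (x n) s) - Df s (\<phi> \<xi> s)) * (C * exp (- \<beta> * s))"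
      proof (intro always_eventually allI)
        fix n
        have "norm (r n s) \<le> norm (Df s (\<phi> (x n) s) - Df s (\<phi> \<xi> s)) * norm (\<Phi> \<xi> s (h n))"
          unfolding r_def g_def blinfun.diff_left[symmetric] by (rule norm_blinfun)
        also have "\<dots> \<le> norm (Df s (\<phi> (x n) s) - Df s (\<phi> \<xi> s)) * (norm (h n) * C * exp (- \<beta> * s))"
          by (intro mult_left_mono exp_boundedD[OF \<Phi>_bound]) simp
        finally show "norm (norm (r n s) / norm (h n)) \<le> norm (Df s (\<phi> (x n) s) - Df s (\<phi> \<xi> s)) * (C * exp (- \<beta> * s))"
          by (auto intro!: scale simp: mult_ac)
      qed
    qed
    show "norm (\<Phi> (x n) t (h n) - \<Phi> \<xi> t (h n)) / norm (h n)
        \<le> (LINT s|lborel. \<kappa> (t - s) * (L * (norm (\<Phi> (x n) s (h n) - \<Phi> \<xi> s (h n)) / norm (h n)) + norm (r n s) / norm (h n)))" for n t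
    proof -
      let ?q = "\<lambda>s. g (x n) s (\<Phi> (x n) s (h n)) - g \<xi> s (\<Phi> \<xi> s (h n))"
      let ?w = "\<lambda>s. \<Phi> (x n) s (h n) - \<Phi> \<xi> s (h n)"
      have wb: "exp_bounded \<beta> (norm (h n) * C + norm (h n) * C) ?w"
        by (intro exp_bounded_diff \<Phi>_bound)
      have w_eq: "?w t = conv ?q t"
        by (subst conv_diff[OF _ g\<Phi>_bound _ g\<Phi>_bound], measurable)
           (use \<Phi>_fp[of "x n" t "h n"] \<Phi>_fp[of \<xi> t "h n"] in simp)
      have le: "norm (conv ?q t) \<le> (LINT s|lborel. \<kappa> (t - s) * (L * norm (?w s) + norm (r n s)))"
      proof (rule norm_conv_le)
        show "exp_bounded \<beta> (L * (norm (h n) * C) + L * (norm (h n) * C)) ?q"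
          by (intro exp_bounded_diff g\<Phi>_bound)
        show "norm (?q s) \<le> L * norm (?w s) + norm (r n s)" for s
        proof -
          have "?q s = g (x n) s (?w s) + r n s"
            by (simp add: r_def g_def blinfun.diff_right)
          then show ?thesis
            using norm_triangle_ineq[of "g (x n) s (?w s)" "r n s"] forcing_bound[OF g_forcing, of "x n" s "?w s"] by simp
        qed
        show "L * norm (?w s) + norm (r n s) \<le> (L * (norm (h n) * C + norm (h n) * C) + (L * (norm (h n) * C) + L * (norm (h n) * C))) * exp (- \<beta> * s)" for s
          using mult_left_mono[OF exp_boundedD[OF wb, of s] L_nonneg] exp_boundedD[OF r_bound, of n s]
          by (simp add: distrib_right mult.assoc)
      qed measurable
      have "norm (?w t) / norm (h n) \<le> (LINT s|lborel. \<kappa> (t - s) * (L * norm (?w s) + norm (r n s))) / norm (h n)"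
        unfolding w_eq by (rule divide_right_mono[OF le]) simp
      also have "\<dots> = (LINT s|lborel. \<kappa> (t - s) * (L * norm (?w s) + norm (r n s)) / norm (h n))"
        by (rule integral_divide_zero[symmetric])
      also have "\<dots> = (LINT s|lborel. \<kappa> (t - s) * (L * (norm (?w s) / norm (h n)) + norm (r n s) / norm (h n)))"
        by (intro Bochner_Integration.integral_cong refl)
           (metis (no_types, lifting) add_divide_distrib times_divide_eq_right)
      finally show ?thesis .
    qed
  qed auto
qed

text \<open>A failure would yield points converging to \<xi> and, for each of them, a direction
  violating the estimate by \<epsilon>, against the sequential statement.\<close>

lemma \<Phi>_opnorm_continuous:
  assumes "0 < \<epsilon>"
  shows "\<exists>\<delta>>0. \<forall>y. norm (y - \<xi>) < \<delta> \<longrightarrow> (\<forall>h. norm (\<Phi> y t h - \<Phi> \<xi> t h) \<le> \<epsilon> * norm h)"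
proof (rule ccontr)
  assume "\<not> ?thesis"
  then have "\<forall>n. \<exists>y h. norm (y - \<xi>) < inverse (real (Suc n)) \<and> \<epsilon> * norm h < norm (\<Phi> y t h - \<Phi> \<xi> t h)"
    by (auto simp: not_le dest!: spec[of _ "inverse (real (Suc n))" for n])
  then obtain y h where yh: "\<And>n. norm (y n - \<xi>) < inverse (real (Suc n))"
    "\<And>n. \<epsilon> * norm (h n) < norm (\<Phi> (y n) t (h n) - \<Phi> \<xi> t (h n))"
    by metis
  have h_nz: "h n \<noteq> 0" for n
    using yh(2)[of n] by (auto simp: linear_0[OF \<Phi>_linear])
  have "(\<lambda>n. y n - \<xi>) \<longlonglongrightarrow> 0"
    using yh(1) by (intro Lim_null_comparison[OF always_eventually LIMSEQ_inverse_real_of_nat]) (auto intro: less_imp_le)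
  then have "y \<longlonglongrightarrow> \<xi>" by (rule LIM_zero_cancel)
  from \<Phi>_continuous[OF this h_nz, of t] have "\<forall>\<^sub>F n in sequentially. norm (\<Phi> (y n) t (h n) - \<Phi> \<xi> t (h n)) / norm (h n) < \<epsilon>"
    using assms by (rule order_tendstoD(2))
  then obtain n where "norm (\<Phi> (y n) t (h n) - \<Phi> \<xi> t (h n)) / norm (h n) < \<epsilon>"
    by (auto simp: eventually_sequentially)
  with yh(2)[of n] h_nz[of n] show False by (simp add: pos_divide_less_eq)
qed

end

section \<open>The Green kernel of the linear part\<close>

text \<open>Euler's integral after scaling by \<delta>; the factor Gamma (1 - \<sigma>) of the gap
  condition comes from here.\<close>

lemma has_bochner_integral_powr_exp:
  fixes \<sigma> \<delta> :: real
  assumes "\<sigma> < 1" "0 < \<delta>"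
  shows "has_bochner_integral lborel (\<lambda>r. indicator {0<..} r * (r powr (- \<sigma>) * exp (- \<delta> * r)))
    (Gamma (1 - \<sigma>) * \<delta> powr (\<sigma> - 1))"
proof -
  let ?f = "\<lambda>t::real. indicator {0..} t * t powr (- \<sigma>) / exp t"
  have "has_bochner_integral lborel ?f (Gamma (1 - \<sigma>))"
    by (rule has_bochner_integral_nn_integral)
       (use Gamma_conv_nn_integral_real[of "1 - \<sigma>"] Gamma_real_pos[of "1 - \<sigma>"] assms in \<open>auto simp: indicator_def\<close>)
  then have "has_bochner_integral lborel (\<lambda>r. ?f (0 + \<delta> * r)) (Gamma (1 - \<sigma>) /\<^sub>R \<bar>\<delta>\<bar>)"
    using lborel_has_bochner_integral_real_affine_iff[of \<delta> ?f _ 0] assms by simp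
  then have 1: "has_bochner_integral lborel (\<lambda>r. \<delta> powr \<sigma> * ?f (0 + \<delta> * r)) (\<delta> powr \<sigma> * (Gamma (1 - \<sigma>) /\<^sub>R \<bar>\<delta>\<bar>))"
    by (rule has_bochner_integral_mult_right)
  have 2: "\<delta> powr \<sigma> * ?f (0 + \<delta> * r) = indicator {0<..} r * (r powr (- \<sigma>) * exp (- \<delta> * r))" for r
    using assms by (cases r "0::real" rule: linorder_cases)
      (auto simp: indicator_def powr_mult powr_minus exp_minus field_simps zero_le_mult_iff mult_less_0_iff)
  have 3: "\<delta> powr \<sigma> * (Gamma (1 - \<sigma>) /\<^sub>R \<bar>\<delta>\<bar>) = Gamma (1 - \<sigma>) * \<delta> powr (\<sigma> - 1)"
    using assms by (simp add: powr_diff field_simps)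
  show ?thesis using 1 unfolding 2 3 .
qed

lemma has_bochner_integral_exp_pos:
  fixes \<delta> :: real
  assumes "0 < \<delta>"
  shows "has_bochner_integral lborel (\<lambda>r. indicator {0<..} r * exp (- \<delta> * r)) (1 / \<delta>)"
proof -
  have "(\<lambda>r. indicator {0<..} r * (r powr (- 0) * exp (- \<delta> * r))) = (\<lambda>r::real. indicator {0<..} r * exp (- \<delta> * r))"
    by (auto simp: fun_eq_iff indicator_def)
  then show ?thesis
    using has_bochner_integral_powr_exp[of 0 \<delta>] assms by (simp add: powr_minus field_simps)
qed

lemma has_bochner_integral_exp_neg:
  fixes \<delta> :: real
  assumes "0 < \<delta>"
  shows "has_bochner_integral lborel (\<lambda>r. indicator {..<0} r * exp (\<delta> * r)) (1 / \<delta>)"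
proof -
  have "has_bochner_integral lborel (\<lambda>r. indicator {0<..} (0 + (-1) * r) * exp (- \<delta> * (0 + (-1) * r))) ((1 / \<delta>) /\<^sub>R \<bar>-1\<bar>)"
    using has_bochner_integral_exp_pos[OF assms]
      lborel_has_bochner_integral_real_affine_iff[of "-1" "\<lambda>r. indicator {0<..} r * exp (- \<delta> * r)" "1 / \<delta>" 0] by simp
  moreover have "indicator {0<..} (0 + (-1) * r) * exp (- \<delta> * (0 + (-1) * r)) = indicator {..<0} r * exp (\<delta> * r)" for r :: real
    by (auto simp: indicator_def)
  ultimately show ?thesis by simp
qed

text \<open>The ratios x / (x + y) and y / (x + y) add up to 1, and each is at most its p-th
  power.\<close>

lemma powr_add_le:
  fixes x y p :: real
  assumes "0 < x" "0 \<le> y" "0 \<le> p" "p \<le> 1"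
  shows "(x + y) powr p \<le> x powr p + y powr p"
proof (cases "y = 0")
  case False
  have le: "u \<le> u powr p" if "0 < u" "u \<le> 1" for u :: real
    using powr_mono'[of p 1 u] that assms by simp
  have "1 = x / (x + y) + y / (x + y)"
    using assms by (simp add: add_divide_distrib[symmetric])
  also have "\<dots> \<le> (x / (x + y)) powr p + (y / (x + y)) powr p"
    using assms False by (intro add_mono le) auto
  also have "\<dots> = (x powr p + y powr p) / (x + y) powr p"
    using assms by (simp add: powr_divide add_divide_distrib)
  finally show ?thesis using assms False by (simp add: field_simps)
qed simp

text \<open>With y = x r / \<sigma> this is y <= exp y raised to the power \<sigma>. It is the
  origin of the factor \<sigma>^\<sigma>, and the convention \<open>self_power 0 = 1\<close> covers
  \<sigma> = 0.\<close>

lemma powr_mult_exp_le: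
  assumes "0 \<le> \<sigma>" "0 \<le> x" "0 < r"
  shows "x powr \<sigma> * exp (- x * r) \<le> self_power \<sigma> * r powr (- \<sigma>)"
proof (cases "x = 0 \<or> \<sigma> = 0")
  case True
  then show ?thesis using assms by (auto simp: self_power_def)
next
  case False
  define y where "y = x * r / \<sigma>"
  have y: "0 < y" using False assms by (simp add: y_def)
  have "y \<le> exp y" using exp_ge_add_one_self[of y] by linarith
  then have "y powr \<sigma> \<le> exp y powr \<sigma>"
    using y assms by (intro powr_mono2) auto
  also have "\<dots> = exp (x * r)"
    using False by (simp add: powr_def y_def)
  finally have "y powr \<sigma> * exp (- x * r) \<le> 1"
    by (simp add: exp_minus field_simps)
  moreover have "x = \<sigma> * y / r" using False assms by (simp add: y_def)
  then have "x powr \<sigma> = \<sigma> powr \<sigma> * r powr (- \<sigma>) * y powr \<sigma>"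
    using y assms by (simp add: powr_mult powr_divide powr_minus_divide)
  ultimately show ?thesis
    using False mult_left_mono[of "y powr \<sigma> * exp (- x * r)" 1 "\<sigma> powr \<sigma> * r powr (- \<sigma>)"]
    by (simp add: self_power_def mult_ac)
qed

locale frac_eigen = eigen e lam
  for e :: "nat \<Rightarrow> 'a::{real_inner,banach,second_countable_topology}" and lam +
  fixes \<sigma> :: real
  assumes \<sigma>: "0 \<le> \<sigma>" "\<sigma> < 1"
begin

text \<open>The Green function of dv/dt + A v = A^\<sigma> p for exponentially weighted paths. Modes
  from n on are integrated from the past, the first n modes from the future, hence the minus sign.
  For n = 0 it is the causal Duhamel kernel.\<close>

definition mult :: "nat \<Rightarrow> real \<Rightarrow> nat \<Rightarrow> real" where
  "mult n r k = (if k < n then if r < 0 then - (Lam k powr \<sigma> * exp (- Lam k * r)) else 0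
     else if 0 < r then Lam k powr \<sigma> * exp (- Lam k * r) else 0)"

definition G :: "nat \<Rightarrow> real \<Rightarrow> 'a \<Rightarrow> 'a" where "G n r = dg (mult n r)"

text \<open>A majorant of all multipliers at once. The sum for r > 0 comes from splitting
  \<open>Lam k\<close> into \<open>Lam n\<close> and the excess over it; the guard
  \<open>0 < n\<close> protects the truncated subtraction \<open>n - 1\<close>.\<close>

definition kap :: "nat \<Rightarrow> real \<Rightarrow> real" where
  "kap n r = (if 0 < r then (self_power \<sigma> * r powr (- \<sigma>) + Lam n powr \<sigma>) * exp (- Lam n * r)
     else if r < 0 \<and> 0 < n then Lam (n - 1) powr \<sigma> * exp (- Lam (n - 1) * r) else 0)"

text \<open>The weighted integral of \<open>kap\<close>: singular stable part, regular stable part,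
  unstable part. They correspond to the middle, last and first term of the gap condition.\<close>

definition kap_int :: "nat \<Rightarrow> real \<Rightarrow> real" where
  "kap_int n \<beta> = self_power \<sigma> * (Gamma (1 - \<sigma>) * (Lam n - \<beta>) powr (\<sigma> - 1)) + Lam n powr \<sigma> / (Lam n - \<beta>)
     + (if 0 < n then Lam (n - 1) powr \<sigma> / (\<beta> - Lam (n - 1)) else 0)"

lemma self_power_nonneg: "0 \<le> self_power \<sigma>"
  by (simp add: self_power_def)

lemma kap_nonneg: "0 \<le> kap n r"
  using self_power_nonneg by (auto simp: kap_def)

text \<open>For r < 0 both factors increase with k, so the last unstable mode is the worst. For r >
  0 put Lam k = Lam n + x; subadditivity of the power separates x^\<sigma>, and exp (- x r) turns it
  into the singularity r^(-\<sigma>), leaving the decay exp (- Lam n r).\<close>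

lemma mult_le_kap: "\<bar>mult n r k\<bar> \<le> kap n r"
proof -
  consider "k < n" "r < 0" | "n \<le> k" "0 < r" | "mult n r k = 0"
    unfolding mult_def by (metis not_less)
  then show ?thesis
  proof cases
    case 1
    then have L: "Lam k \<le> Lam (n - 1)" by (intro Lam_mono) simp
    have "Lam k powr \<sigma> * exp (- Lam k * r) \<le> Lam (n - 1) powr \<sigma> * exp (- Lam (n - 1) * r)"
      using L 1 \<sigma> by (intro mult_mono powr_mono2) (auto intro: mult_right_mono_neg)
    then show ?thesis using 1 by (simp add: mult_def kap_def)
  next
    case 2
    then have L: "Lam n \<le> Lam k" by (intro Lam_mono)
    define x where "x = Lam k - Lam n"
    have x: "0 \<le> x" "Lam k = Lam n + x" using L by (auto simp: x_def)
    have "Lam k powr \<sigma> * exp (- Lam k * r) \<le> (Lam n powr \<sigma> + x powr \<sigma>) * exp (- Lam k * r)"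
      unfolding x(2) using x(1) \<sigma> by (intro mult_right_mono powr_add_le) auto
    also have "\<dots> = (Lam n powr \<sigma> * exp (- x * r) + x powr \<sigma> * exp (- x * r)) * exp (- Lam n * r)"
      unfolding x(2) by (simp add: algebra_simps exp_add[symmetric])
    also have "\<dots> \<le> (Lam n powr \<sigma> * 1 + self_power \<sigma> * r powr (- \<sigma>)) * exp (- Lam n * r)"
      using 2 x(1) \<sigma> by (intro mult_right_mono add_mono mult_left_mono powr_mult_exp_le) auto
    finally show ?thesis using 2 by (simp add: mult_def kap_def algebra_simps)
  qed (simp add: kap_nonneg)
qed

lemma inner_G: "G n r x \<bullet> E k = mult n r k * (x \<bullet> E k)"
  unfolding G_def by (rule inner_dg[OF mult_le_kap])

lemma kap_measurable [measurable]: "kap n \<in> borel_measurable borel"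
  unfolding kap_def by measurable

lemma kap_has_integral:
  assumes "\<beta> < Lam n" "0 < n \<Longrightarrow> Lam (n - 1) < \<beta>"
  shows "has_bochner_integral lborel (\<lambda>r. kap n r * exp (\<beta> * r)) (kap_int n \<beta>)"
proof -
  \<comment> \<open>For n = 0 the third term has coefficient 0; the substitute exponent 1 keeps its
    integral convergent, so that one formula serves both cases.\<close>
  have 1: "has_bochner_integral lborel (\<lambda>r.
      self_power \<sigma> * (indicator {0<..} r * (r powr (- \<sigma>) * exp (- (Lam n - \<beta>) * r)))
      + Lam n powr \<sigma> * (indicator {0<..} r * exp (- (Lam n - \<beta>) * r))
      + (if 0 < n then Lam (n - 1) powr \<sigma> else 0) * (indicator {..<0} r * exp ((if 0 < n then \<beta> - Lam (n - 1) else 1) * r)))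
     (self_power \<sigma> * (Gamma (1 - \<sigma>) * (Lam n - \<beta>) powr (\<sigma> - 1)) + Lam n powr \<sigma> * (1 / (Lam n - \<beta>))
       + (if 0 < n then Lam (n - 1) powr \<sigma> else 0) * (1 / (if 0 < n then \<beta> - Lam (n - 1) else 1)))"
    using assms \<sigma>
    by (intro has_bochner_integral_add has_bochner_integral_mult_right has_bochner_integral_powr_exp
        has_bochner_integral_exp_pos has_bochner_integral_exp_neg) auto
  have 2: "self_power \<sigma> * (indicator {0<..} r * (r powr (- \<sigma>) * exp (- (Lam n - \<beta>) * r)))
      + Lam n powr \<sigma> * (indicator {0<..} r * exp (- (Lam n - \<beta>) * r))
      + (if 0 < n then Lam (n - 1) powr \<sigma> else 0) * (indicator {..<0} r * exp ((if 0 < n then \<beta> - Lam (n - 1) else 1) * r))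
      = kap n r * exp (\<beta> * r)" for r
    by (cases r "0::real" rule: linorder_cases)
       (auto simp: kap_def indicator_def distrib_left distrib_right left_diff_distrib right_diff_distrib exp_diff exp_minus divide_inverse mult_ac)
  have 3: "Lam n powr \<sigma> * (1 / (Lam n - \<beta>)) = Lam n powr \<sigma> / (Lam n - \<beta>)"
    "(if 0 < n then Lam (n - 1) powr \<sigma> else 0) * (1 / (if 0 < n then \<beta> - Lam (n - 1) else 1)) =
      (if 0 < n then Lam (n - 1) powr \<sigma> / (\<beta> - Lam (n - 1)) else 0)"
    by auto
  show ?thesis using 1 unfolding 2 3 kap_int_def .
qed

lemma mult_measurable [measurable]: "(\<lambda>r. mult n r k) \<in> borel_measurable borel"
  unfolding mult_def by measurable

lemma kap_isCont: "r \<noteq> 0 \<Longrightarrow> isCont (kap n) r"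
proof -
  assume "r \<noteq> 0"
  then consider "0 < r" | "r < 0" by linarith
  then show ?thesis
  proof cases
    case 1
    have "isCont (\<lambda>r. (self_power \<sigma> * r powr (- \<sigma>) + Lam n powr \<sigma>) * exp (- Lam n * r)) r"
      using 1 by (intro continuous_intros) auto
    then show ?thesis
      by (rule isCont_cong[THEN iffD1, rotated])
         (use eventually_nhds_in_open[of "{0<..}" r] 1 in \<open>auto elim!: eventually_mono simp: kap_def\<close>)
  next
    case 2
    have "isCont (\<lambda>r. if 0 < n then Lam (n - 1) powr \<sigma> * exp (- Lam (n - 1) * r) else 0) r"
      by (cases "0 < n") auto
    then show ?thesis
      by (rule isCont_cong[THEN iffD1, rotated])
         (use eventually_nhds_in_open[of "{..<0}" r] 2 in \<open>auto elim!: eventually_mono simp: kap_def\<close>)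
  qed
qed

lemma G_isCont:
  assumes "r \<noteq> 0"
  shows "isCont (\<lambda>r. G n r x) r"
proof -
  \<comment> \<open>This interval around r stays away from 0. On it the sign of the time is fixed,
    so each multiplier is given by one formula, and \<open>kap n\<close> is bounded by
    compactness.\<close>
  define S where "S = {r - \<bar>r\<bar> / 2 .. r + \<bar>r\<bar> / 2}"
  have nz: "s < 0 \<longleftrightarrow> r < 0" "0 < s \<longleftrightarrow> 0 < r" "s \<noteq> 0" if "s \<in> S" for s
    using that assms by (auto simp: S_def abs_if split: if_splits)
  have "continuous_on S (kap n)"
    using nz(3) kap_isCont by (auto intro!: continuous_at_imp_continuous_on)
  then have "bounded (kap n ` S)"
    by (intro compact_imp_bounded compact_continuous_image) (auto simp: S_def)
  then obtain B where B: "\<And>s. s \<in> S \<Longrightarrow> kap n s \<le> B"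
    unfolding bounded_iff by (metis image_eqI norm_conv_dist abs_le_D1 real_norm_def)
  have "continuous_on S (\<lambda>r. G n r x)"
    unfolding G_def
  proof (rule dg_continuous)
    show "\<bar>mult n s k\<bar> \<le> B" if "s \<in> S" for s k
      using mult_le_kap[of n s k] B[OF that] by linarith
    show "continuous_on S (\<lambda>s. mult n s k)" for k
    proof -
      have "continuous_on S (\<lambda>s. if k < n then if r < 0 then - (Lam k powr \<sigma> * exp (- Lam k * s)) else 0
          else if 0 < r then Lam k powr \<sigma> * exp (- Lam k * s) else 0)"
        by (cases "k < n"; cases "r < 0"; cases "0 < r"; simp; intro continuous_intros)
      then show ?thesis
        by (rule continuous_on_cong[THEN iffD1, rotated 2]) (auto simp: mult_def nz)
    qed
  qed
  moreover have "r \<in> interior S" using assms by (auto simp: S_def)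
  ultimately show ?thesis by (rule continuous_on_interior)
qed

lemma conv_kernel_G:
  assumes "\<beta> < Lam n" "0 < n \<Longrightarrow> Lam (n - 1) < \<beta>" "0 \<le> L" "L * kap_int n \<beta> < 1"
  shows "conv_kernel (G n) (kap n) \<beta> (kap_int n \<beta>) L"
proof (rule conv_kernel.intro)
  show "(\<lambda>(r, x). G n r x) \<in> borel_measurable (borel \<Otimes>\<^sub>M borel)"
    unfolding G_def split_beta' by measurable
  show "bounded_linear (G n r)" for r
    unfolding G_def by (rule bounded_linear_dg[OF mult_le_kap])
  show "norm (G n r x) \<le> kap n r * norm x" for r x
    unfolding G_def by (rule norm_dg_le[OF mult_le_kap])
  show "has_bochner_integral lborel (\<lambda>r. kap n r * exp (\<beta> * r)) (kap_int n \<beta>)"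
    using assms by (intro kap_has_integral)
qed (use assms in \<open>auto simp: kap_nonneg G_isCont kap_isCont\<close>)

text \<open>Without unstable modes the weight exponent has no lower barrier, and the kernel integral
  tends to 0 as the exponent goes to minus infinity. The forward problem is thus a contraction for
  every L.\<close>

lemma forward_rate:
  assumes "0 \<le> L"
  obtains \<gamma> where "conv_kernel (G 0) (kap 0) \<gamma> (kap_int 0 \<gamma>) L" "\<gamma> \<le> 0"
proof -
  have lim: "filterlim (\<lambda>\<gamma>. Lam 0 + \<gamma>) at_top at_top"
    by (intro filterlim_tendsto_add_at_top[OF tendsto_const] filterlim_ident)
  have "((\<lambda>\<gamma>. L * (self_power \<sigma> * (Gamma (1 - \<sigma>) * (Lam 0 + \<gamma>) powr (\<sigma> - 1)) + Lam 0 powr \<sigma> / (Lam 0 + \<gamma>))) \<longlongrightarrow>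
      L * (self_power \<sigma> * (Gamma (1 - \<sigma>) * 0) + 0)) at_top"
    using \<sigma> by (intro tendsto_intros tendsto_neg_powr lim tendsto_divide_0[OF tendsto_const] filterlim_at_top_imp_at_infinity) auto
  then have "\<forall>\<^sub>F \<gamma> in at_top. L * kap_int 0 (- \<gamma>) < 1"
    unfolding kap_int_def by (auto dest: order_tendstoD(2)[of _ _ _ 1])
  then have "\<forall>\<^sub>F \<gamma> in at_top. L * kap_int 0 (- \<gamma>) < 1 \<and> 0 \<le> \<gamma>"
    using eventually_ge_at_top[of 0] by eventually_elim auto
  then obtain \<gamma> where "L * kap_int 0 (- \<gamma>) < 1" "0 \<le> \<gamma>"
    by (auto simp: eventually_at_top_linorder)
  moreover have "- \<gamma> < Lam 0" using Lam_pos[of 0] \<open>0 \<le> \<gamma>\<close> by linarith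
  ultimately show ?thesis
    using conv_kernel_G[of "- \<gamma>" 0 L] assms that by auto
qed

end

section \<open>Mild solutions\<close>

definition loc_bounded :: "(real \<Rightarrow> 'a::{real_normed_vector,second_countable_topology}) \<Rightarrow> bool" where
  "loc_bounded p \<longleftrightarrow> p \<in> borel_measurable borel \<and> (\<forall>a b. \<exists>C. \<forall>s\<in>{a..b}. norm (p s) \<le> C)"

lemma loc_bounded_measurable: "loc_bounded p \<Longrightarrow> p \<in> borel_measurable borel"
  by (simp add: loc_bounded_def)

lemma exp_bounded_loc_bounded:
  assumes "p \<in> borel_measurable borel" "exp_bounded \<beta> C p"
  shows "loc_bounded p"
  unfolding loc_bounded_def
proof (intro conjI allI assms)
  fix a b :: real
  show "\<exists>C. \<forall>s\<in>{a..b}. norm (p s) \<le> C"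
  proof (intro exI ballI)
    fix s assume "s \<in> {a..b}"
    then have "\<bar>s\<bar> \<le> \<bar>a\<bar> + \<bar>b\<bar>" by auto
    have "- \<beta> * s \<le> \<bar>\<beta>\<bar> * \<bar>s\<bar>" by (metis abs_ge_self abs_minus abs_mult mult_minus_left)
    also have "\<dots> \<le> \<bar>\<beta>\<bar> * (\<bar>a\<bar> + \<bar>b\<bar>)"
      using \<open>\<bar>s\<bar> \<le> \<bar>a\<bar> + \<bar>b\<bar>\<close> by (rule mult_left_mono) simp
    finally have "C * exp (- \<beta> * s) \<le> C * exp (\<bar>\<beta>\<bar> * (\<bar>a\<bar> + \<bar>b\<bar>))"
      using exp_bounded_nonneg[OF assms(2)] by (intro mult_left_mono) auto
    then show "norm (p s) \<le> C * exp (\<bar>\<beta>\<bar> * (\<bar>a\<bar> + \<bar>b\<bar>))"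
      using exp_boundedD[OF assms(2), of s] by linarith
  qed
qed

lemma loc_bounded_add:
  assumes "loc_bounded p" "loc_bounded q"
  shows "loc_bounded (\<lambda>s. p s + q s)"
  unfolding loc_bounded_def
proof (intro conjI allI)
  show "(\<lambda>s. p s + q s) \<in> borel_measurable borel"
    using assms by (auto simp: loc_bounded_def)
  fix a b :: real
  obtain C D where "\<And>s. s \<in> {a..b} \<Longrightarrow> norm (p s) \<le> C" "\<And>s. s \<in> {a..b} \<Longrightarrow> norm (q s) \<le> D"
    using assms unfolding loc_bounded_def by metis
  then show "\<exists>C. \<forall>s\<in>{a..b}. norm (p s + q s) \<le> C"
    by (intro exI[of _ "C + D"] ballI norm_triangle_le add_mono) auto
qed

lemma loc_bounded_continuous:
  fixes u :: "real \<Rightarrow> 'a::{real_normed_vector,second_countable_topology}"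
  assumes "continuous_on S u" "closed S"
  shows "loc_bounded (\<lambda>s. indicator S s *\<^sub>R u s)"
  unfolding loc_bounded_def
proof (intro conjI allI)
  show "(\<lambda>s. indicator S s *\<^sub>R u s) \<in> borel_measurable borel"
    using assms by (intro borel_measurable_continuous_on_indicator) auto
  fix a b :: real
  have "compact (u ` (S \<inter> {a..b}))"
    using assms by (intro compact_continuous_image continuous_on_subset[OF assms(1)] closed_Int_compact) auto
  then obtain C where "\<And>s. s \<in> S \<inter> {a..b} \<Longrightarrow> norm (u s) \<le> C" "0 \<le> C"
    by (metis bounded_pos compact_imp_bounded image_eqI less_imp_le)
  then show "\<exists>C. \<forall>s\<in>{a..b}. norm (indicator S s *\<^sub>R u s) \<le> C"
    by (intro exI[of _ C]) (auto simp: indicator_def)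
qed

lemma loc_bounded_forcing:
  assumes f: "forcing L f" "0 \<le> L" and u: "loc_bounded u"
  shows "loc_bounded (\<lambda>s. f s (u s))"
  unfolding loc_bounded_def
proof (intro conjI allI)
  show "(\<lambda>s. f s (u s)) \<in> borel_measurable borel"
    using u by (intro forcing_comp_measurable[OF f(1)]) (auto simp: loc_bounded_def)
  fix a b :: real
  obtain C where C: "\<And>s. s \<in> {a..b} \<Longrightarrow> norm (u s) \<le> C"
    using u unfolding loc_bounded_def by metis
  then have "norm (f s (u s)) \<le> L * C" if "s \<in> {a..b}" for s
    using forcing_bound[OF f(1), of s "u s"] mult_left_mono[OF C[OF that] f(2)] by linarith
  then show "\<exists>C. \<forall>s\<in>{a..b}. norm (f s (u s)) \<le> C" by blast
qed

lemma exp_split: "exp (- l * (t - s)) = exp (- l * (t - c)) * exp (- l * (c - s))" for l t s c :: real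
  unfolding exp_add[symmetric] by (rule arg_cong[where f = exp]) (simp add: algebra_simps)

context frac_eigen
begin

text \<open>Variation of constants with inhomogeneity \<open>A\<^sup>\<sigma> p\<close>, read off coordinatewise.\<close>

definition vocp :: "(real \<Rightarrow> 'a) \<Rightarrow> real set \<Rightarrow> (real \<Rightarrow> 'a) \<Rightarrow> bool" where
  "vocp p I v \<longleftrightarrow> (\<forall>\<tau>\<in>I. \<forall>t\<in>I. \<tau> \<le> t \<longrightarrow> (\<forall>k. v t \<bullet> E k = exp (- Lam k * (t - \<tau>)) * (v \<tau> \<bullet> E k)
     + Lam k powr \<sigma> * (LBINT s:{\<tau>..t}. exp (- Lam k * (t - s)) * (p s \<bullet> E k))))"

lemma vocpI:
  assumes "\<And>\<tau> t k. \<tau> \<in> I \<Longrightarrow> t \<in> I \<Longrightarrow> \<tau> \<le> t \<Longrightarrow> v t \<bullet> E k = exp (- Lam k * (t - \<tau>)) * (v \<tau> \<bullet> E k)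
     + Lam k powr \<sigma> * (LBINT s:{\<tau>..t}. exp (- Lam k * (t - s)) * (p s \<bullet> E k))"
  shows "vocp p I v"
  using assms unfolding vocp_def by blast

lemma vocpD:
  assumes "vocp p I v" "\<tau> \<in> I" "t \<in> I" "\<tau> \<le> t"
  shows "v t \<bullet> E k = exp (- Lam k * (t - \<tau>)) * (v \<tau> \<bullet> E k)
     + Lam k powr \<sigma> * (LBINT s:{\<tau>..t}. exp (- Lam k * (t - s)) * (p s \<bullet> E k))"
  using assms unfolding vocp_def by blast

lemma vocp_subset: "vocp p I v \<Longrightarrow> J \<subseteq> I \<Longrightarrow> vocp p J v"
  unfolding vocp_def by blast

lemma voc_integrable:
  assumes p: "loc_bounded p"
  shows "set_integrable lborel {\<tau>..t} (\<lambda>s. exp (- Lam k * (t - s)) * (p s \<bullet> E k))"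
proof -
  note [measurable] = loc_bounded_measurable[OF p]
  obtain C where C: "\<And>s. s \<in> {\<tau>..t} \<Longrightarrow> norm (p s) \<le> C"
    using p unfolding loc_bounded_def by metis
  show ?thesis
    unfolding set_integrable_def
  proof (rule integrableI_bounded_set_indicator[where B = C])
    show "AE x in lborel. x \<in> {\<tau>..t} \<longrightarrow> norm (exp (- Lam k * (t - x)) * (p x \<bullet> E k)) \<le> C"
    proof (intro AE_I2 impI)
      fix s assume s: "s \<in> {\<tau>..t}"
      have "\<bar>p s \<bullet> E k\<bar> \<le> C"
        using Cauchy_Schwarz_ineq2[of "p s" "E k"] C[OF s] by simp
      moreover have "exp (- Lam k * (t - s)) \<le> 1"
        using s Lam_ge0[of k] by simp
      ultimately have "exp (- Lam k * (t - s)) * \<bar>p s \<bullet> E k\<bar> \<le> 1 * C"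
        by (intro mult_mono) auto
      then show "norm (exp (- Lam k * (t - s)) * (p s \<bullet> E k)) \<le> C"
        by (simp add: abs_mult)
    qed
  qed (auto simp: emeasure_lborel_Icc_eq)
qed

lemma vocp_add:
  assumes "vocp p I v" "vocp q I w" "loc_bounded p" "loc_bounded q"
  shows "vocp (\<lambda>s. p s + q s) I (\<lambda>t. v t + w t)"
proof (rule vocpI)
  fix \<tau> t k assume *: "\<tau> \<in> I" "t \<in> I" "\<tau> \<le> t"
  have "(LBINT s:{\<tau>..t}. exp (- Lam k * (t - s)) * ((p s + q s) \<bullet> E k)) =
      (LBINT s:{\<tau>..t}. exp (- Lam k * (t - s)) * (p s \<bullet> E k)) + (LBINT s:{\<tau>..t}. exp (- Lam k * (t - s)) * (q s \<bullet> E k))"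
    using set_integral_add(2)[OF voc_integrable[OF assms(3)] voc_integrable[OF assms(4)], of \<tau> t k k]
    by (simp add: inner_add_left distrib_left)
  then show "(v t + w t) \<bullet> E k = exp (- Lam k * (t - \<tau>)) * ((v \<tau> + w \<tau>) \<bullet> E k)
     + Lam k powr \<sigma> * (LBINT s:{\<tau>..t}. exp (- Lam k * (t - s)) * ((p s + q s) \<bullet> E k))"
    unfolding inner_add_left[of "v t"] vocpD[OF assms(1) *, of k] vocpD[OF assms(2) *, of k]
    by (simp only: inner_add_left distrib_left)
qed

lemma vocp_minus:
  assumes "vocp p I v"
  shows "vocp (\<lambda>s. - p s) I (\<lambda>t. - v t)"
proof (rule vocpI)
  fix \<tau> t k assume *: "\<tau> \<in> I" "t \<in> I" "\<tau> \<le> t"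
  have "(LBINT s:{\<tau>..t}. exp (- Lam k * (t - s)) * (- p s \<bullet> E k)) =
      - (LBINT s:{\<tau>..t}. exp (- Lam k * (t - s)) * (p s \<bullet> E k))"
    by (simp add: set_lebesgue_integral_def)
  then show "- v t \<bullet> E k = exp (- Lam k * (t - \<tau>)) * (- v \<tau> \<bullet> E k)
     + Lam k powr \<sigma> * (LBINT s:{\<tau>..t}. exp (- Lam k * (t - s)) * (- p s \<bullet> E k))"
    using vocpD[OF assms(1) *, of k] by simp
qed

text \<open>The forcings may differ at the single time s0, a null set. This is used at time 0, where
  a cut-off path already carries its nonzero value.\<close>

lemma vocp_cong:
  assumes v: "vocp p I v" and eq: "\<And>t. t \<in> I \<Longrightarrow> v t = w t"
    and pq: "\<And>s. s \<in> I \<Longrightarrow> s \<noteq> s0 \<Longrightarrow> p s = q s"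
    and m: "loc_bounded p" "loc_bounded q" and I: "is_interval I"
  shows "vocp q I w"
proof (rule vocpI)
  fix \<tau> t k assume *: "\<tau> \<in> I" "t \<in> I" "\<tau> \<le> t"
  note [measurable] = m[THEN loc_bounded_measurable]
  have sub: "s \<in> I" if "s \<in> {\<tau>..t}" for s
    using mem_is_interval_1_I[OF I *(1,2)] that by simp
  have "(LBINT s:{\<tau>..t}. exp (- Lam k * (t - s)) * (p s \<bullet> E k)) = (LBINT s:{\<tau>..t}. exp (- Lam k * (t - s)) * (q s \<bullet> E k))"
    unfolding set_lebesgue_integral_def
  proof (rule integral_cong_AE)
    show "AE s in lborel. indicator {\<tau>..t} s *\<^sub>R (exp (- Lam k * (t - s)) * (p s \<bullet> E k)) =
        indicator {\<tau>..t} s *\<^sub>R (exp (- Lam k * (t - s)) * (q s \<bullet> E k))"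
      using AE_lborel_singleton[of s0]
      by eventually_elim (use pq sub in \<open>auto simp: indicator_def\<close>)
  qed measurable
  then show "w t \<bullet> E k = exp (- Lam k * (t - \<tau>)) * (w \<tau> \<bullet> E k)
     + Lam k powr \<sigma> * (LBINT s:{\<tau>..t}. exp (- Lam k * (t - s)) * (q s \<bullet> E k))"
    using vocpD[OF v *, of k] eq[OF *(1)] eq[OF *(2)] by simp
qed

lemma vocp_glue:
  assumes p: "loc_bounded p" and v: "vocp p {..c} v" "vocp p {c..} v"
  shows "vocp p UNIV v"
proof (rule vocpI)
  fix \<tau> t k assume "\<tau> \<le> (t::real)"
  then consider "t \<le> c" | "c \<le> \<tau>" | "\<tau> \<le> c" "c \<le> t" by linarith
  then show "v t \<bullet> E k = exp (- Lam k * (t - \<tau>)) * (v \<tau> \<bullet> E k)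
     + Lam k powr \<sigma> * (LBINT s:{\<tau>..t}. exp (- Lam k * (t - s)) * (p s \<bullet> E k))"
  proof cases
    case 3
    let ?h = "\<lambda>t s. exp (- Lam k * (t - s)) * (p s \<bullet> E k)"
    have 1: "v c \<bullet> E k = exp (- Lam k * (c - \<tau>)) * (v \<tau> \<bullet> E k) + Lam k powr \<sigma> * (LBINT s:{\<tau>..c}. ?h c s)"
      and 2: "v t \<bullet> E k = exp (- Lam k * (t - c)) * (v c \<bullet> E k) + Lam k powr \<sigma> * (LBINT s:{c..t}. ?h t s)"
      using vocpD[OF v(1), of \<tau> c] vocpD[OF v(2), of c t] 3 by auto
    have i: "set_integrable lborel {\<tau>..t} (?h t)" by (rule voc_integrable[OF p])
    have "(LBINT s:{\<tau>..t}. ?h t s) = (LBINT s:{\<tau>..c}. ?h t s) + (LBINT s:{c<..t}. ?h t s)"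
    proof -
      have un: "{\<tau>..t} = {\<tau>..c} \<union> {c<..t}" using 3 by auto
      show ?thesis
        unfolding un using 3 by (intro set_integral_Un set_integrable_subset[OF i]) auto
    qed
    also have "(LBINT s:{c<..t}. ?h t s) = (LBINT s:{c..t}. ?h t s)"
      unfolding set_lebesgue_integral_def
      by (rule integral_cong_AE)
         (use AE_lborel_singleton[of c] loc_bounded_measurable[OF p] in \<open>auto elim!: eventually_mono simp: indicator_def\<close>)
    also have "(LBINT s:{\<tau>..c}. ?h t s) = exp (- Lam k * (t - c)) * (LBINT s:{\<tau>..c}. ?h c s)"
    proof -
      have h: "?h t s = exp (- Lam k * (t - c)) * ?h c s" for s
        by (subst exp_split[of "Lam k" t s c]) (rule mult.assoc)
      show ?thesis unfolding h by (rule set_integral_mult_right)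
    qed
    finally have "(LBINT s:{\<tau>..t}. ?h t s) = exp (- Lam k * (t - c)) * (LBINT s:{\<tau>..c}. ?h c s) + (LBINT s:{c..t}. ?h t s)" .
    then show ?thesis
      unfolding 2 1 exp_split[of "Lam k" t \<tau> c] by (simp only: distrib_left mult.assoc mult.left_commute add.assoc)
  qed (use vocpD[OF v(1), of \<tau> t] vocpD[OF v(2), of \<tau> t] \<open>\<tau> \<le> t\<close> in auto)
qed

text \<open>Away from s = \<tau> and s = t, the multiplier at t - s equals exp (- Lam k (t -
  \<tau>)) times the multiplier at \<tau> - s, plus Lam k^\<sigma> exp (- Lam k (t - s)) on
  [\<tau>, t]. In either kind of mode the kernel jumps by Lam k^\<sigma> at 0, and this jump
  produces the inhomogeneity. Integrating against p gives the formula.\<close>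

lemma vocp_conv:
  assumes ck: "conv_kernel (G n) (kap n) \<beta> c L"
    and p [measurable]: "p \<in> borel_measurable borel" and C: "exp_bounded \<beta> C p"
  shows "vocp p UNIV (conv_kernel.conv (G n) p)"
    and "conv_kernel.conv (G n) p t \<bullet> E k = (LINT s|lborel. mult n (t - s) k * (p s \<bullet> E k))"
proof -
  interpret conv_kernel "G n" "kap n" \<beta> c L by (rule ck)
  have int: "integrable lborel (\<lambda>s. G n (t - s) (p s))" for t
    by (rule conv_integrable[OF p C])
  have inner: "conv p t \<bullet> E k = (LINT s|lborel. mult n (t - s) k * (p s \<bullet> E k))" for t k
    unfolding conv_def using integral_inner_left[OF int[of t], of "E k"] by (simp add: inner_G)
  have int': "integrable lborel (\<lambda>s. mult n (t - s) k * (p s \<bullet> E k))" for t k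
    using integrable_inner_left[OF int[of t], of "E k"] by (simp add: inner_G)
  show "conv p t \<bullet> E k = (LINT s|lborel. mult n (t - s) k * (p s \<bullet> E k))" by (rule inner)
  show "vocp p UNIV (conv p)"
  proof (rule vocpI)
    fix \<tau> t k assume "\<tau> \<le> (t::real)"
    let ?h = "\<lambda>s. exp (- Lam k * (t - s)) * (p s \<bullet> E k)"
    have i: "integrable lborel (\<lambda>s. indicator {\<tau>..t} s * ?h s)"
      using voc_integrable[OF exp_bounded_loc_bounded[OF p C], of \<tau> t k] by (simp add: set_integrable_def)
    have "conv p t \<bullet> E k = (LINT s|lborel. exp (- Lam k * (t - \<tau>)) * (mult n (\<tau> - s) k * (p s \<bullet> E k))
        + Lam k powr \<sigma> * (indicator {\<tau>..t} s * ?h s))"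
      unfolding inner
    proof (rule integral_cong_AE)
      show "AE s in lborel. mult n (t - s) k * (p s \<bullet> E k) = exp (- Lam k * (t - \<tau>)) * (mult n (\<tau> - s) k * (p s \<bullet> E k))
          + Lam k powr \<sigma> * (indicator {\<tau>..t} s * ?h s)"
        using AE_lborel_singleton[of \<tau>] AE_lborel_singleton[of t]
      proof eventually_elim
        case (elim s)
        note e = exp_split[of "Lam k" t s \<tau>]
        have "mult n (t - s) k = exp (- Lam k * (t - \<tau>)) * mult n (\<tau> - s) k
          + Lam k powr \<sigma> * (indicator {\<tau>..t} s * exp (- Lam k * (t - s)))"
          using elim \<open>\<tau> \<le> t\<close> unfolding mult_def e by (auto simp: indicator_def)
        then show ?case by (simp add: algebra_simps)
      qed
    qed measurable
    also have "\<dots> = exp (- Lam k * (t - \<tau>)) * (LINT s|lborel. mult n (\<tau> - s) k * (p s \<bullet> E k))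
        + Lam k powr \<sigma> * (LINT s|lborel. indicator {\<tau>..t} s * ?h s)"
      using int' i by simp
    finally show "conv p t \<bullet> E k = exp (- Lam k * (t - \<tau>)) * (conv p \<tau> \<bullet> E k) + Lam k powr \<sigma> * (LBINT s:{\<tau>..t}. ?h s)"
      by (simp add: inner set_lebesgue_integral_def)
  qed
qed

text \<open>The linear flow on finitely many modes, hence a group defined for all times. At t = 0 it
  is the spectral projector, which commutes with A^\<sigma>.\<close>

definition SP :: "nat \<Rightarrow> real \<Rightarrow> 'a \<Rightarrow> 'a" where
  "SP n t = dg (\<lambda>k. if k < n then exp (- Lam k * t) else 0)"

text \<open>Cut to 0 at negative times, where the multipliers exp (- Lam k t) would be unbounded in
  k.\<close>

definition SQ :: "nat \<Rightarrow> real \<Rightarrow> 'a \<Rightarrow> 'a" where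
  "SQ n t = dg (\<lambda>k. if k < n \<or> t < 0 then 0 else exp (- Lam k * t))"

lemma SP_mult_le:
  assumes "\<bar>t\<bar> \<le> T"
  shows "\<bar>if k < n then exp (- Lam k * t) else 0\<bar> \<le> exp (Lam n * T)"
proof -
  have "- Lam k * t \<le> Lam k * \<bar>t\<bar>" by (simp add: abs_if)
  moreover have "Lam k * \<bar>t\<bar> \<le> Lam n * T" if "k < n"
    using that assms Lam_mono[of k n] by (intro mult_mono) auto
  ultimately show ?thesis by (auto intro: order_trans)
qed

lemma SQ_mult_le: "\<bar>if k < n \<or> t < 0 then 0 else exp (- Lam k * t)\<bar> \<le> 1"
  by auto

lemma inner_SP: "SP n t x \<bullet> E k = (if k < n then exp (- Lam k * t) * (x \<bullet> E k) else 0)"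
  unfolding SP_def by (subst inner_dg[OF SP_mult_le[OF order_refl]]) simp

lemma inner_SQ: "SQ n t x \<bullet> E k = (if k < n \<or> t < 0 then 0 else exp (- Lam k * t) * (x \<bullet> E k))"
  unfolding SQ_def by (subst inner_dg[OF SQ_mult_le]) simp

lemma bounded_linear_SP: "bounded_linear (SP n t)"
  unfolding SP_def by (rule bounded_linear_dg[OF SP_mult_le[OF order_refl]])

lemma bounded_linear_SQ: "bounded_linear (SQ n t)"
  unfolding SQ_def by (rule bounded_linear_dg[OF SQ_mult_le])

lemma SP_SQ_0: "SP n 0 x + SQ n 0 x = x"
  by (rule coords_eqI) (simp add: inner_add_left inner_SP inner_SQ)

lemma SP_SP_0: "SP n t (SP n 0 x) = SP n t x"
  by (rule coords_eqI) (simp add: inner_SP)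

lemma SP_measurable [measurable (raw)]:
  "g \<in> borel_measurable M \<Longrightarrow> y \<in> borel_measurable M \<Longrightarrow> (\<lambda>w. SP n (g w) (y w)) \<in> borel_measurable M"
  unfolding SP_def
proof (rule borel_measurable_dg)
  fix k
  show "g \<in> borel_measurable M \<Longrightarrow> (\<lambda>w. if k < n then exp (- Lam k * g w) else 0) \<in> borel_measurable M"
    by (cases "k < n") simp_all
qed

lemma SQ_measurable [measurable (raw)]:
  "g \<in> borel_measurable M \<Longrightarrow> y \<in> borel_measurable M \<Longrightarrow> (\<lambda>w. SQ n (g w) (y w)) \<in> borel_measurable M"
  unfolding SQ_def
proof (rule borel_measurable_dg)
  fix k
  show "g \<in> borel_measurable M \<Longrightarrow> (\<lambda>w. if k < n \<or> g w < 0 then 0 else exp (- Lam k * g w)) \<in> borel_measurable M"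
    by (cases "k < n") simp_all
qed

lemma SP_continuous: "continuous_on UNIV (\<lambda>t. SP n t x)"
proof (rule continuous_at_imp_continuous_on, rule ballI)
  fix t :: real
  have "continuous_on {t - 1..t + 1} (\<lambda>t. SP n t x)"
    unfolding SP_def
  proof (rule dg_continuous)
    show "\<bar>if k < n then exp (- Lam k * r) else 0\<bar> \<le> exp (Lam n * (\<bar>t\<bar> + 1))" if "r \<in> {t - 1..t + 1}" for r k
      using that by (intro SP_mult_le) auto
    show "continuous_on {t - 1..t + 1} (\<lambda>r. if k < n then exp (- Lam k * r) else 0)" for k
      by (cases "k < n") (auto intro!: continuous_intros)
  qed
  then show "isCont (\<lambda>t. SP n t x) t"
    by (rule continuous_on_interior) auto
qed

lemma SQ_continuous: "continuous_on {0..} (\<lambda>t. SQ n t x)"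
  unfolding SQ_def
proof (rule dg_continuous[OF SQ_mult_le])
  fix k
  have "continuous_on {0..} (\<lambda>r. if k < n then 0 else exp (- Lam k * r))"
    by (cases "k < n") (auto intro!: continuous_intros)
  then show "continuous_on {0..} (\<lambda>r. if k < n \<or> r < 0 then 0 else exp (- Lam k * r))"
    by (rule continuous_on_cong[THEN iffD1, rotated 2]) auto
qed

lemma norm_SP_le:
  assumes "t \<le> 0" "0 < n \<Longrightarrow> Lam (n - 1) \<le> \<beta>"
  shows "norm (SP n t x) \<le> norm x * exp (- \<beta> * t)"
proof -
  have "\<bar>if k < n then exp (- Lam k * t) else 0\<bar> \<le> exp (- \<beta> * t)" for k
  proof (cases "k < n")
    case True
    then have "k \<le> n - 1" "0 < n" by linarith+
    then have "Lam k \<le> \<beta>" using order_trans[OF Lam_mono[of k "n - 1"] assms(2)] by simp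
    then have "Lam k * (- t) \<le> \<beta> * (- t)" using assms(1) by (intro mult_right_mono) auto
    then show ?thesis using True by simp
  qed simp
  from norm_dg_le[OF this] show ?thesis by (simp add: SP_def mult.commute)
qed

lemma norm_SQ_le:
  assumes "\<beta> \<le> Lam n"
  shows "norm (SQ n t x) \<le> norm x * exp (- \<beta> * t)"
proof -
  have "\<bar>if k < n \<or> t < 0 then 0 else exp (- Lam k * t)\<bar> \<le> exp (- \<beta> * t)" for k
  proof (cases "k < n \<or> t < 0")
    case False
    then have "\<beta> \<le> Lam k" using Lam_mono[of n k] assms by simp
    then have "\<beta> * t \<le> Lam k * t" using False by (intro mult_right_mono) auto
    then show ?thesis using False by simp
  qed auto
  from norm_dg_le[OF this] show ?thesis by (simp add: SQ_def mult.commute)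
qed

lemma vocp_SP: "vocp (\<lambda>_. 0) I (\<lambda>t. SP n t x)"
proof (rule vocpI)
  fix \<tau> t k
  have "exp (- Lam k * t) = exp (- Lam k * (t - \<tau>)) * exp (- Lam k * \<tau>)"
    using exp_split[of "Lam k" t 0 \<tau>] by (simp only: diff_0_right)
  then show "SP n t x \<bullet> E k = exp (- Lam k * (t - \<tau>)) * (SP n \<tau> x \<bullet> E k)
     + Lam k powr \<sigma> * (LBINT s:{\<tau>..t}. exp (- Lam k * (t - s)) * (0 \<bullet> E k))"
    by (simp only: inner_SP inner_zero_left mult_zero_right set_lebesgue_integral_def scaleR_zero_right)
       (simp only: integral_zero mult_zero_right add_0_right mult.assoc if_distrib[of "(*) _"])
qed

lemma vocp_SQ: "vocp (\<lambda>_. 0) {0..} (\<lambda>t. SQ n t x)"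
proof (rule vocpI)
  fix \<tau> t k assume t: "\<tau> \<in> {0::real..}" "t \<in> {0::real..}"
  have "exp (- Lam k * t) = exp (- Lam k * (t - \<tau>)) * exp (- Lam k * \<tau>)"
    using exp_split[of "Lam k" t 0 \<tau>] by (simp only: diff_0_right)
  moreover have "(k < n \<or> t < 0) = (k < n)" "(k < n \<or> \<tau> < 0) = (k < n)" using t by auto
  ultimately show "SQ n t x \<bullet> E k = exp (- Lam k * (t - \<tau>)) * (SQ n \<tau> x \<bullet> E k)
     + Lam k powr \<sigma> * (LBINT s:{\<tau>..t}. exp (- Lam k * (t - s)) * (0 \<bullet> E k))"
    by (simp only: inner_SQ inner_zero_left mult_zero_right set_lebesgue_integral_def scaleR_zero_right)
       (simp only: integral_zero mult_zero_right add_0_right mult.assoc if_distrib[of "(*) _"])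
qed

lemma loc_bounded_0: "loc_bounded (\<lambda>_. 0)"
  by (simp add: loc_bounded_def) blast

lemma vocp_homogeneous:
  assumes "vocp p I v" "vocp p I w" "loc_bounded p" "\<tau> \<in> I" "t \<in> I" "\<tau> \<le> t"
  shows "(v t - w t) \<bullet> E k = exp (- Lam k * (t - \<tau>)) * ((v \<tau> - w \<tau>) \<bullet> E k)"
  using vocpD[OF assms(1,4-6), of k] vocpD[OF assms(2,4-6), of k]
  by (simp add: inner_diff_left right_diff_distrib)

lemma conv_eq_0:
  assumes ck: "conv_kernel (G n) (kap n) \<beta> c L" and "\<And>s k. mult n (t - s) k * (p s \<bullet> E k) = 0"
  shows "conv_kernel.conv (G n) p t = 0"
proof -
  have "G n (t - s) (p s) = 0" for s
    by (rule coords_eqI) (simp only: inner_G assms(2) inner_zero_left)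
  then show ?thesis
    by (simp add: conv_kernel.conv_def[OF ck])
qed

section \<open>Existence and uniqueness of mild solutions\<close>

definition mild :: "(real \<Rightarrow> 'a \<Rightarrow> 'a) \<Rightarrow> real set \<Rightarrow> (real \<Rightarrow> 'a) \<Rightarrow> bool" where
  "mild f I v \<longleftrightarrow> continuous_on I v \<and> vocp (\<lambda>s. f s (v s)) I v"

lemma mild_subset: "mild f I v \<Longrightarrow> J \<subseteq> I \<Longrightarrow> mild f J v"
  unfolding mild_def using continuous_on_subset vocp_subset by blast

lemma vocp_cong_on:
  assumes v: "vocp p I v" and eq: "\<And>t. t \<in> I \<Longrightarrow> v t = w t" "\<And>s. s \<in> I \<Longrightarrow> p s = q s"
    and I: "is_interval I"
  shows "vocp q I w"
proof (rule vocpI)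
  fix \<tau> t k assume *: "\<tau> \<in> I" "t \<in> I" "\<tau> \<le> t"
  have "(LBINT s:{\<tau>..t}. exp (- Lam k * (t - s)) * (p s \<bullet> E k)) = (LBINT s:{\<tau>..t}. exp (- Lam k * (t - s)) * (q s \<bullet> E k))"
    unfolding set_lebesgue_integral_def
  proof (rule Bochner_Integration.integral_cong[OF refl])
    fix s
    have "s \<in> I" if "s \<in> {\<tau>..t}"
      using mem_is_interval_1_I[OF I *(1,2)] that by simp
    then show "indicator {\<tau>..t} s *\<^sub>R (exp (- Lam k * (t - s)) * (p s \<bullet> E k)) =
       indicator {\<tau>..t} s *\<^sub>R (exp (- Lam k * (t - s)) * (q s \<bullet> E k))"
      using eq(2) by (auto simp: indicator_def)
  qed
  then show "w t \<bullet> E k = exp (- Lam k * (t - \<tau>)) * (w \<tau> \<bullet> E k)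
     + Lam k powr \<sigma> * (LBINT s:{\<tau>..t}. exp (- Lam k * (t - s)) * (q s \<bullet> E k))"
    using vocpD[OF v *, of k] eq(1)[OF *(1)] eq(1)[OF *(2)] by simp
qed

lemma mild_cong_on:
  assumes v: "mild f I v" and eq: "\<And>t. t \<in> I \<Longrightarrow> v t = w t" "\<And>s x. s \<in> I \<Longrightarrow> f s x = g s x"
    and I: "is_interval I"
  shows "mild g I w"
proof -
  have "continuous_on I w"
    using v eq(1) unfolding mild_def by (metis continuous_on_cong)
  moreover have "vocp (\<lambda>s. g s (w s)) I w"
    by (rule vocp_cong_on[where v = v and p = "\<lambda>s. f s (v s)"]) (use v eq I in \<open>auto simp: mild_def\<close>)
  ultimately show ?thesis by (simp add: mild_def)
qed

text \<open>Outside \<open>I\<close> the path may be anything; cutting it off there makes it measurable on the line.\<close>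

lemma mild_iff_cut:
  assumes I: "is_interval I"
  shows "mild f I v \<longleftrightarrow> continuous_on I v \<and> vocp (\<lambda>s. f s (indicator I s *\<^sub>R v s)) I v"
  unfolding mild_def
  by (intro conj_cong refl iffI; erule vocp_cong_on[where v = v and w = v]) (auto simp: indicator_def I)

lemma mild_cut_loc_bounded:
  assumes "forcing L f" "0 \<le> L" "closed I" "continuous_on I v"
  shows "loc_bounded (\<lambda>s. f s (indicator I s *\<^sub>R v s))"
  by (rule loc_bounded_forcing[OF assms(1,2) loc_bounded_continuous[OF assms(4,3)]])

lemma mild_glue:
  assumes f: "forcing L f" "0 \<le> L" and v: "mild f {..c} v" and w: "mild f {c..} w" and vw: "v c = w c"
  shows "mild f UNIV (\<lambda>t. if t \<le> c then v t else w t)" (is "mild f UNIV ?u")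
proof -
  have un: "{..c} \<union> {c..} = UNIV" by auto
  have u: "mild f {..c} ?u" "mild f {c..} ?u"
    by (rule mild_cong_on[OF v], auto, rule mild_cong_on[OF w], auto simp: vw)
  have cont: "continuous_on UNIV ?u"
    using continuous_on_closed_Un[of "{..c}" "{c..}" ?u] u un by (auto simp: mild_def)
  have "vocp (\<lambda>s. f s (?u s)) UNIV ?u"
  proof (rule vocp_glue)
    show "loc_bounded (\<lambda>s. f s (?u s))"
      using mild_cut_loc_bounded[OF f closed_UNIV cont] by simp
  qed (use u in \<open>auto simp: mild_def\<close>)
  with cont show ?thesis by (simp add: mild_def)
qed

text \<open>The forcing is switched off at negative times and the initial value enters through the
  inhomogeneity; the whole-line fixed point for the causal kernel then restricts to the forward
  solution.\<close>

lemma forward_exists: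
  assumes f: "forcing L f" and L: "0 \<le> L"
  obtains v where "mild f {0..} v" "v 0 = x"
proof -
  obtain \<gamma> where ck: "conv_kernel (G 0) (kap 0) \<gamma> (kap_int 0 \<gamma>) L" and \<gamma>: "\<gamma> \<le> 0"
    using forward_rate[OF L] .
  interpret conv_kernel "G 0" "kap 0" \<gamma> "kap_int 0 \<gamma>" L by (rule ck)
  define f' where "f' s y = (if 0 \<le> s then f s y else 0)" for s y
  have f': "forcing L f'"
    unfolding forcing_def
  proof (intro conjI allI)
    note [measurable (raw)] = forcing_comp_measurable[OF f]
    show "(\<lambda>(s, x). f' s x) \<in> borel_measurable (borel \<Otimes>\<^sub>M borel)"
      unfolding f'_def split_beta' by measurable
    show "norm (f' s x - f' s y) \<le> L * norm (x - y)" for s x y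
      using forcing_lipschitz[OF f, of s x y] L by (auto simp: f'_def)
  qed (auto simp: f'_def forcing_zero[OF f])
  define a where "a t = SQ 0 t x" for t
  have a: "a \<in> borel_measurable borel" "exp_bounded \<gamma> (norm x) a"
    using norm_SQ_le[of \<gamma> 0] \<gamma> Lam_pos[of 0] unfolding a_def[abs_def] exp_bounded_def by auto
  define v where "v = lp a f'"
  define p where "p s = f' s (v s)" for s
  note lp = lp_measurable[OF f' a] lp_bound[OF f' a] lp_forcing_measurable[OF f' a] lp_forcing_bound[OF f' a] lp_fixed_point[OF f' a]
  have p: "p \<in> borel_measurable borel" "exp_bounded \<gamma> (L * (norm x / (1 - L * kap_int 0 \<gamma>))) p"
    unfolding p_def[abs_def] v_def by (rule lp)+
  note pl = exp_bounded_loc_bounded[OF p]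
  have v: "v t = SQ 0 t x + conv p t" for t
  proof -
    have "p = (\<lambda>s. f' s (lp a f' s))" by (simp add: p_def v_def fun_eq_iff)
    then show ?thesis unfolding v_def a_def[symmetric] by (simp only: lp(5)[symmetric])
  qed
  have cont: "continuous_on {0..} v"
    unfolding v by (intro continuous_intros SQ_continuous continuous_on_subset[OF conv_continuous[OF p]]) auto
  have "vocp (\<lambda>s. 0 + p s) {0..} (\<lambda>t. SQ 0 t x + conv p t)"
    by (intro vocp_add vocp_SQ vocp_subset[OF vocp_conv(1)[OF ck p]] pl loc_bounded_0) auto
  then have "vocp (\<lambda>s. f s (v s)) {0..} v"
  proof (rule vocp_cong_on)
    show "SQ 0 t x + conv p t = v t" for t by (rule v[symmetric])
    show "0 + p s = f s (v s)" if "s \<in> {0..}" for s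
      using that by (simp add: p_def f'_def)
  qed (rule is_interval_ci)
  then have "mild f {0..} v"
    using cont by (simp add: mild_def)
  moreover have "v 0 = x"
  proof -
    \<comment> \<open>At t = 0 the causal kernel sees only s < 0, where the forcing has been
      switched off.\<close>
    have "conv p 0 = 0"
      by (rule conv_eq_0[OF ck]) (auto simp: mult_def p_def f'_def)
    moreover have "SQ 0 0 x = x" by (rule coords_eqI) (simp add: inner_SQ)
    ultimately show ?thesis by (simp add: v)
  qed
  ultimately show ?thesis by (rule that)
qed

text \<open>A solution on [0, T], cut to 0 outside, lies in the weighted space and satisfies the
  fixed point equation of the causal kernel on [0, T]. Elsewhere the difference of two such paths is
  0, so the difference estimate applies with A = 0.\<close>

lemma forward_unique:
  assumes f: "forcing L f" and L: "0 \<le> L"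
    and v: "mild f {0..T} v" and w: "mild f {0..T} w" and eq: "v 0 = w 0" and t: "t \<in> {0..T}"
  shows "v t = w t"
proof -
  obtain \<gamma> where ck: "conv_kernel (G 0) (kap 0) \<gamma> (kap_int 0 \<gamma>) L" and \<gamma>: "\<gamma> \<le> 0"
    using forward_rate[OF L] .
  interpret conv_kernel "G 0" "kap 0" \<gamma> "kap_int 0 \<gamma>" L by (rule ck)
  let ?I = "{0..T}"
  have rep: "\<exists>C. indicator ?I s *\<^sub>R u s = (indicator ?I s *\<^sub>R u s :: 'a) \<and>
      (\<lambda>s. indicator ?I s *\<^sub>R u s) \<in> borel_measurable borel \<and> exp_bounded \<gamma> C (\<lambda>s. indicator ?I s *\<^sub>R u s) \<and>
      (\<forall>t\<in>?I. u t = SQ 0 t (u 0) + conv (\<lambda>s. f s (indicator ?I s *\<^sub>R u s)) t)" if u: "mild f ?I u" for u s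
  proof -
    have cont: "continuous_on ?I u" using u by (simp add: mild_def)
    note lb = loc_bounded_continuous[OF cont]
    have m: "(\<lambda>s. indicator ?I s *\<^sub>R u s) \<in> borel_measurable borel"
      using lb by (auto simp: loc_bounded_def)
    obtain C where C: "\<And>s. s \<in> ?I \<Longrightarrow> norm (indicator ?I s *\<^sub>R u s) \<le> C"
      using lb unfolding loc_bounded_def by (metis closed_atLeastAtMost)
    have eb: "exp_bounded \<gamma> (max C 0) (\<lambda>s. indicator ?I s *\<^sub>R u s)"
      unfolding exp_bounded_def
    proof
      fix s
      show "norm (indicator ?I s *\<^sub>R u s) \<le> max C 0 * exp (- \<gamma> * s)"
      proof (cases "s \<in> ?I")
        case True
        \<comment> \<open>As \<gamma> <= 0, the weight is at least 1 on [0, T]. Taking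
          \<open>max C 0\<close> keeps the constant nonnegative even if the interval is
          empty.\<close>
        have "norm (indicator ?I s *\<^sub>R u s) \<le> max C 0 * 1" using C[OF True] by simp
        also have "\<dots> \<le> max C 0 * exp (- \<gamma> * s)"
          using True \<gamma> by (intro mult_left_mono) (auto simp: mult_nonpos_nonneg)
        finally show ?thesis .
      qed simp
    qed
    define p where "p = (\<lambda>s. f s (indicator ?I s *\<^sub>R u s))"
    have p: "p \<in> borel_measurable borel" "exp_bounded \<gamma> (L * max C 0) p"
      unfolding p_def using forcing_comp_measurable[OF f _ m, of "\<lambda>s. s"] exp_bounded_forcing[OF f L eb] by auto
    have vu: "vocp p ?I u"
      using u mild_iff_cut[OF is_interval_cc] by (simp add: p_def)
    have "vocp (\<lambda>s. 0 + p s) ?I (\<lambda>t. SQ 0 t (u 0) + conv p t)"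
      by (intro vocp_add vocp_subset[OF vocp_SQ] vocp_subset[OF vocp_conv(1)[OF ck p]] exp_bounded_loc_bounded[OF p] loc_bounded_0) auto
    then have vc: "vocp p ?I (\<lambda>t. SQ 0 t (u 0) + conv p t)" by simp
    have c0: "conv p 0 = 0"
      by (rule conv_eq_0[OF ck]) (auto simp: mult_def p_def forcing_zero[OF f] indicator_def)
    have s0: "SQ 0 0 (u 0) = u 0"
      by (rule coords_eqI) (simp add: inner_SQ)
    have "u t = SQ 0 t (u 0) + conv p t" if t: "t \<in> ?I" for t
    proof (rule coords_eqI)
      fix k
      have "0 \<in> ?I" "0 \<le> t" using t by auto
      from vocp_homogeneous[OF vu vc exp_bounded_loc_bounded[OF p] this(1) t this(2), of k]
      show "u t \<bullet> E k = (SQ 0 t (u 0) + conv p t) \<bullet> E k"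
        by (simp add: c0 s0 inner_diff_left)
    qed
    then show ?thesis using m eb unfolding p_def by blast
  qed
  let ?v = "\<lambda>s. indicator ?I s *\<^sub>R v s" and ?w = "\<lambda>s. indicator ?I s *\<^sub>R w s"
  obtain C where v': "?v \<in> borel_measurable borel" "exp_bounded \<gamma> C ?v"
      "\<And>t. t \<in> ?I \<Longrightarrow> v t = SQ 0 t (v 0) + conv (\<lambda>s. f s (?v s)) t"
    using rep[OF v] by blast
  obtain D where w': "?w \<in> borel_measurable borel" "exp_bounded \<gamma> D ?w"
      "\<And>t. t \<in> ?I \<Longrightarrow> w t = SQ 0 t (w 0) + conv (\<lambda>s. f s (?w s)) t"
    using rep[OF w] by blast
  have "exp_bounded \<gamma> (0 / (1 - L * kap_int 0 \<gamma>)) (\<lambda>s. ?v s - ?w s)"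
  proof (rule fixed_point_diff_bound[OF _ _ _ exp_bounded_forcing[OF f L v'(2)] exp_bounded_forcing[OF f L w'(2)]
        exp_bounded_diff[OF v'(2) w'(2)] forcing_lipschitz[OF f]])
    fix t
    show "norm (?v t - ?w t) \<le> 0 * exp (- \<gamma> * t) + norm (conv (\<lambda>s. f s (?v s)) t - conv (\<lambda>s. f s (?w s)) t)"
    proof (cases "t \<in> ?I")
      case True
      then have "?v t - ?w t = v t - w t" by simp
      also have "\<dots> = conv (\<lambda>s. f s (?v s)) t - conv (\<lambda>s. f s (?w s)) t"
        unfolding v'(3)[OF True] w'(3)[OF True] eq by simp
      finally show ?thesis by simp
    qed simp
  qed (use v' w' in \<open>auto intro!: forcing_comp_measurable[OF f]\<close>)
  then have "?v t = ?w t" by (simp add: exp_bounded_def)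
  then show ?thesis using t by simp
qed

end

section \<open>Invariant graphs and tracking\<close>

locale spectral_gap = frac_eigen e lam \<sigma>
  for e :: "nat \<Rightarrow> 'a::{real_inner,banach,second_countable_topology}" and lam \<sigma> +
  fixes N :: nat and \<beta> L :: real
  assumes N: "0 < N" and \<beta>: "Lam (N - 1) < \<beta>" "\<beta> < Lam N"
    and L_ge0: "0 \<le> L" and gap: "L * kap_int N \<beta> < 1"
begin

sublocale conv_kernel "G N" "kap N" \<beta> "kap_int N \<beta>" L
  using N \<beta> L_ge0 gap by (intro conv_kernel_G)

lemmas ck = conv_kernel_axioms

text \<open>The cut at positive times keeps the path in the weighted space: the first N modes decay
  more slowly than exp (- \<beta> t).\<close>

definition aM :: "'a \<Rightarrow> real \<Rightarrow> 'a" where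
  "aM \<xi> t = (if t \<le> 0 then SP N t \<xi> else 0)"

text \<open>With the future switched off, the unstable half of the kernel contributes nothing at
  time 0, so the first N coordinates there are prescribed by \<xi>.\<close>

definition past :: "(real \<Rightarrow> 'a \<Rightarrow> 'a) \<Rightarrow> real \<Rightarrow> 'a \<Rightarrow> 'a" where
  "past f s y = (if s \<le> 0 then f s y else 0)"

text \<open>The Lyapunov-Perron solution, posed on the whole line. For t <= 0 it is the backward
  solution through the manifold; for t > 0 it is only the tail of the convolution.\<close>

definition backward :: "(real \<Rightarrow> 'a \<Rightarrow> 'a) \<Rightarrow> 'a \<Rightarrow> real \<Rightarrow> 'a" where
  "backward f \<xi> = lp (aM \<xi>) (past f)"

definition graph_map :: "(real \<Rightarrow> 'a \<Rightarrow> 'a) \<Rightarrow> 'a \<Rightarrow> 'a" where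
  "graph_map f \<xi> = backward f \<xi> 0 - SP N 0 \<xi>"

lemma aM_measurable [measurable]: "aM \<xi> \<in> borel_measurable borel"
  unfolding aM_def[abs_def] by measurable

lemma norm_SP_N: "t \<le> 0 \<Longrightarrow> norm (SP N t x) \<le> norm x * exp (- \<beta> * t)"
  using less_imp_le[OF \<beta>(1)] by (intro norm_SP_le)

lemma aM_bound: "exp_bounded \<beta> (norm \<xi>) (aM \<xi>)"
  unfolding exp_bounded_def aM_def using norm_SP_N[of _ \<xi>] by simp

lemma aM_linear: "linear (\<lambda>\<xi>. aM \<xi> t)"
  using bounded_linear.linear[OF bounded_linear_SP[of N t]] linear_zero
  by (cases "t \<le> 0") (auto simp: aM_def)

lemma forcing_past:
  assumes f: "forcing L f"
  shows "forcing L (past f)"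
  unfolding forcing_def
proof (intro conjI allI)
  note [measurable (raw)] = forcing_comp_measurable[OF f]
  show "(\<lambda>(s, x). past f s x) \<in> borel_measurable (borel \<Otimes>\<^sub>M borel)"
    unfolding past_def split_beta' by measurable
  show "norm (past f s x - past f s y) \<le> L * norm (x - y)" for s x y
    using forcing_lipschitz[OF f, of s x y] L_ge0 by (auto simp: past_def)
qed (auto simp: past_def forcing_zero[OF f])

context
  fixes f :: "real \<Rightarrow> 'a \<Rightarrow> 'a"
  assumes f: "forcing L f"
begin

lemmas back_bound = lp_bound[OF forcing_past[OF f] aM_measurable aM_bound, folded backward_def]
lemmas back_forcing_measurable = lp_forcing_measurable[OF forcing_past[OF f] aM_measurable aM_bound, folded backward_def]
lemmas back_forcing_bound = lp_forcing_bound[OF forcing_past[OF f] aM_measurable aM_bound, folded backward_def]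
lemmas back_fixed_point = lp_fixed_point[OF forcing_past[OF f] aM_measurable aM_bound, folded backward_def]

lemma back_mild: "mild f {..0} (backward f \<xi>)"
proof -
  define p where "p = (\<lambda>s. past f s (backward f \<xi> s))"
  have p: "p \<in> borel_measurable borel" "exp_bounded \<beta> (L * (norm \<xi> / (1 - L * kap_int N \<beta>))) p"
    unfolding p_def by (rule back_forcing_measurable, rule back_forcing_bound)
  have eq: "SP N t \<xi> + conv p t = backward f \<xi> t" if "t \<in> {..0}" for t
    using that back_fixed_point[of \<xi> t] by (simp add: aM_def p_def)
  have "continuous_on {..0} (\<lambda>t. SP N t \<xi> + conv p t)"
    by (intro continuous_intros continuous_on_subset[OF SP_continuous] continuous_on_subset[OF conv_continuous[OF p]]) auto
  then have "continuous_on {..0} (backward f \<xi>)"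
    by (rule continuous_on_eq[OF _ eq])
  moreover have "vocp (\<lambda>s. 0 + p s) {..0} (\<lambda>t. SP N t \<xi> + conv p t)"
    by (intro vocp_add vocp_SP vocp_subset[OF vocp_conv(1)[OF ck p]] exp_bounded_loc_bounded[OF p] loc_bounded_0) auto
  then have "vocp (\<lambda>s. f s (backward f \<xi> s)) {..0} (backward f \<xi>)"
  proof (rule vocp_cong_on[OF _ eq])
    show "0 + p s = f s (backward f \<xi> s)" if "s \<in> {..0}" for s
      using that by (simp add: p_def past_def)
  qed (auto simp: is_interval_ic)
  ultimately show ?thesis by (simp add: mild_def)
qed

text \<open>For k < N the kernel at time 0 looks only at s > 0, where \<open>past f\<close>
  vanishes.\<close>

lemma SP_back_0: "SP N 0 (backward f \<xi> 0) = SP N 0 \<xi>"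
proof (rule coords_eqI)
  fix k
  define p where "p = (\<lambda>s. past f s (backward f \<xi> s))"
  have p: "p \<in> borel_measurable borel" "exp_bounded \<beta> (L * (norm \<xi> / (1 - L * kap_int N \<beta>))) p"
    unfolding p_def by (rule back_forcing_measurable, rule back_forcing_bound)
  have "conv p 0 \<bullet> E k = 0" if "k < N"
  proof -
    have "mult N (0 - s) k * (p s \<bullet> E k) = 0" for s
      using that by (auto simp: mult_def p_def past_def)
    then show ?thesis
      by (simp only: vocp_conv(2)[OF ck p] integral_zero)
  qed
  then show "SP N 0 (backward f \<xi> 0) \<bullet> E k = SP N 0 \<xi> \<bullet> E k"
    using back_fixed_point[of \<xi> 0] by (simp add: inner_SP aM_def p_def inner_add_left)
qed

lemma SP_graph_map: "SP N 0 (graph_map f \<xi>) = 0"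
  using linear_diff[OF bounded_linear.linear[OF bounded_linear_SP]] SP_back_0
  by (simp add: graph_map_def SP_SP_0)

lemma back_cong: "SP N 0 \<xi> = SP N 0 \<eta> \<Longrightarrow> backward f \<xi> = backward f \<eta>"
  unfolding backward_def aM_def[abs_def] by (metis SP_SP_0)

text \<open>The difference of v and the convolution solves the homogeneous linear equation. On the
  first N modes it is fixed by its value at 0. On the others a nonzero solution would grow like exp
  (- Lam k \<tau>) as \<tau> goes to minus infinity, faster than the bound exp (- \<beta> \<tau>)
  permits.\<close>

lemma back_representation:
  assumes v: "mild f {..0} v" and C: "\<And>t. t \<le> 0 \<Longrightarrow> norm (v t) \<le> C * exp (- \<beta> * t)" and t: "t \<le> 0"
  shows "v t = backward f (v 0) t"
proof -
  let ?I = "{..0::real}"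
  define v' where "v' s = indicator ?I s *\<^sub>R v s" for s
  have cont: "continuous_on ?I v" using v by (simp add: mild_def)
  have v': "v' \<in> borel_measurable borel"
    using loc_bounded_measurable[OF loc_bounded_continuous[OF cont closed_atMost]] by (simp add: v'_def[abs_def])
  have C0: "0 \<le> C" using order_trans[OF norm_ge_zero C[of 0]] by simp
  have v'b: "exp_bounded \<beta> C v'"
    unfolding exp_bounded_def v'_def using C C0 by (auto simp: indicator_def)
  define p where "p s = f s (v' s)" for s
  have p: "p \<in> borel_measurable borel" "exp_bounded \<beta> (L * C) p"
    unfolding p_def[abs_def] using forcing_comp_measurable[OF f _ v', of "\<lambda>s. s"] exp_bounded_forcing[OF f L_ge0 v'b] by auto
  have pl: "loc_bounded p" by (rule exp_bounded_loc_bounded[OF p])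
  have vp: "vocp p ?I v"
    using v mild_iff_cut[OF is_interval_ic] by (simp add: p_def[abs_def] v'_def)
  have vc: "vocp p ?I (conv p)"
    by (rule vocp_subset[OF vocp_conv(1)[OF ck p]]) simp
  have cb: "exp_bounded \<beta> (kap_int N \<beta> * (L * C)) (conv p)"
    by (rule exp_bounded_conv[OF p])
  have rep: "v t = SP N t (v 0) + conv p t" if t: "t \<le> 0" for t
  proof (rule coords_eqI)
    fix k
    have hom: "(v t - conv p t) \<bullet> E k = exp (- Lam k * (t - \<tau>)) * ((v \<tau> - conv p \<tau>) \<bullet> E k)" if "\<tau> \<le> t" "t \<le> 0" for \<tau> t
      using vocp_homogeneous[OF vp vc pl, of \<tau> t k] that by auto
    show "v t \<bullet> E k = (SP N t (v 0) + conv p t) \<bullet> E k"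
    proof (cases "k < N")
      case True
      have "conv p 0 \<bullet> E k = 0"
      proof -
        have "mult N (0 - s) k * (p s \<bullet> E k) = 0" for s
          using True by (auto simp: mult_def p_def v'_def indicator_def forcing_zero[OF f])
        then show ?thesis by (simp only: vocp_conv(2)[OF ck p] integral_zero)
      qed
      then have "v 0 \<bullet> E k = exp (Lam k * t) * ((v t - conv p t) \<bullet> E k)"
        using hom[of t 0] t by (simp add: inner_diff_left)
      then have "exp (- Lam k * t) * (v 0 \<bullet> E k) = exp (- Lam k * t) * (exp (Lam k * t) * ((v t - conv p t) \<bullet> E k))"
        by simp
      also have "\<dots> = (v t - conv p t) \<bullet> E k"
        by (simp add: mult.assoc[symmetric] mult_exp_exp)
      finally show ?thesis using True by (simp add: inner_add_left inner_diff_left inner_SP)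
    next
      case False
      define B where "B = C + kap_int N \<beta> * (L * C)"
      have k: "\<beta> < Lam k" using False \<beta>(2) Lam_mono[of N k] by simp
      \<comment> \<open>The homogeneous equation transports the growth bound from \<tau> to the
        fixed time t. The right side tends to 0 as \<tau> goes to minus infinity, because \<beta> <
        Lam k.\<close>
      have bd: "\<bar>(v t - conv p t) \<bullet> E k\<bar> \<le> B * exp (- Lam k * t) * exp ((Lam k - \<beta>) * \<tau>)" if "\<tau> \<le> t" for \<tau>
      proof -
        have "\<bar>(v \<tau> - conv p \<tau>) \<bullet> E k\<bar> \<le> norm (v \<tau> - conv p \<tau>)"
          using Cauchy_Schwarz_ineq2[of "v \<tau> - conv p \<tau>" "E k"] by simp
        also have "\<dots> \<le> B * exp (- \<beta> * \<tau>)"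
          using norm_triangle_ineq4[of "v \<tau>" "conv p \<tau>"] C[of \<tau>] exp_boundedD[OF cb, of \<tau>] that t
          by (simp add: B_def distrib_right)
        finally have "exp (- Lam k * (t - \<tau>)) * \<bar>(v \<tau> - conv p \<tau>) \<bullet> E k\<bar> \<le> exp (- Lam k * (t - \<tau>)) * (B * exp (- \<beta> * \<tau>))"
          by (rule mult_left_mono) simp
        also have "\<dots> = B * exp (- Lam k * t) * exp ((Lam k - \<beta>) * \<tau>)"
        proof -
          have "exp (- Lam k * (t - \<tau>)) * exp (- \<beta> * \<tau>) = exp (- Lam k * t) * exp ((Lam k - \<beta>) * \<tau>)"
            unfolding mult_exp_exp by (rule arg_cong[where f = exp]) (simp add: algebra_simps)
          then show ?thesis by (simp only: mult.assoc mult.left_commute)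
        qed
        finally show ?thesis using hom[OF that t] by (simp add: abs_mult)
      qed
      have lim: "((\<lambda>\<tau>. B * exp (- Lam k * t) * exp ((Lam k - \<beta>) * \<tau>)) \<longlongrightarrow> B * exp (- Lam k * t) * 0) at_bot"
        using k by (intro tendsto_intros filterlim_compose[OF exp_at_bot] filterlim_tendsto_pos_mult_at_bot[OF tendsto_const] filterlim_ident) simp
      have "\<bar>(v t - conv p t) \<bullet> E k\<bar> \<le> B * exp (- Lam k * t) * 0"
        by (rule tendsto_lowerbound[OF lim])
           (use bd in \<open>auto simp: eventually_at_bot_linorder\<close>)
      then show ?thesis using False by (simp add: inner_add_left inner_diff_left inner_SP)
    qed
  qed
  \<comment> \<open>This continues v beyond time 0 by the convolution tail, producing a whole-line
    fixed point to which uniqueness applies.\<close>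
  define y where "y t = aM (v 0) t + conv p t" for t
  have yv: "y t = v t" if "t \<le> 0" for t
    using rep[OF that] that by (simp add: y_def aM_def)
  have py: "past f s (y s) = p s" for s
    using yv[of s] by (simp add: past_def p_def v'_def indicator_def forcing_zero[OF f])
  have "y = lp (aM (v 0)) (past f)"
  proof (rule lp_unique[OF forcing_past[OF f] aM_measurable aM_bound])
    show "y \<in> borel_measurable borel" unfolding y_def[abs_def] using p by measurable
    show "exp_bounded \<beta> (norm (v 0) + kap_int N \<beta> * (L * C)) y"
      unfolding y_def[abs_def] by (intro exp_bounded_add aM_bound cb)
    show "y t = aM (v 0) t + conv (\<lambda>s. past f s (y s)) t" for t
      unfolding py by (simp add: y_def)
  qed
  then show ?thesis using yv[OF t] by (simp add: backward_def)
qed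

text \<open>The first summand of the constant is the Lipschitz constant of the fixed point at time
  0; the 1 comes from subtracting the projected datum.\<close>

lemma graph_map_lipschitz:
  "norm (graph_map f \<xi> - graph_map f \<eta>) \<le> (1 / (1 - L * kap_int N \<beta>) + 1) * norm (\<xi> - \<eta>)"
proof -
  have "exp_bounded \<beta> (norm (\<xi> - \<eta>)) (\<lambda>t. aM \<xi> t - aM \<eta> t)"
    using aM_bound[of "\<xi> - \<eta>"] by (simp add: linear_diff[OF aM_linear] exp_bounded_def)
  from exp_boundedD[OF lp_diff_bound[OF forcing_past[OF f] aM_measurable aM_bound aM_measurable aM_bound this], of 0]
  have "norm (backward f \<xi> 0 - backward f \<eta> 0) \<le> norm (\<xi> - \<eta>) / (1 - L * kap_int N \<beta>)"
    by (simp add: backward_def)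
  moreover have "norm (SP N 0 (\<xi> - \<eta>)) \<le> norm (\<xi> - \<eta>)"
    using norm_SP_N[of 0 "\<xi> - \<eta>"] by simp
  moreover have "norm (graph_map f \<xi> - graph_map f \<eta>) \<le> norm (backward f \<xi> 0 - backward f \<eta> 0) + norm (SP N 0 (\<xi> - \<eta>))"
    using norm_triangle_ineq4[of "backward f \<xi> 0 - backward f \<eta> 0" "SP N 0 (\<xi> - \<eta>)"]
    by (simp add: graph_map_def linear_diff[OF bounded_linear.linear[OF bounded_linear_SP]] algebra_simps)
  ultimately show ?thesis by (simp add: distrib_right)
qed

text \<open>
  Tracking: a forward solution \<open>u\<close> is cut off at time 0, and the correction \<open>\<phi>\<close> is a fixed point
  on the whole line; \<open>a\<close> removes the stable part of \<open>u 0\<close> and extends the unstable part backwards.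
\<close>

lemma tracking:
  assumes u: "mild f {0..} u"
  obtains w C where "mild f UNIV w"
    and "\<And>t. 0 \<le> t \<Longrightarrow> norm (w t - u t) \<le> norm (u 0) / (1 - L * kap_int N \<beta>) * exp (- \<beta> * t)"
    and "\<And>t. t \<le> 0 \<Longrightarrow> norm (w t) \<le> C * exp (- \<beta> * t)"
proof -
  have ucont: "continuous_on {0..} u" using u by (simp add: mild_def)
  define ub where "ub s = indicator {0..} s *\<^sub>R u s" for s
  have ub: "loc_bounded ub"
    unfolding ub_def[abs_def] by (rule loc_bounded_continuous[OF ucont closed_atLeast])
  note [measurable] = loc_bounded_measurable[OF ub] and [measurable (raw)] = forcing_comp_measurable[OF f]
  \<comment> \<open>The forcing felt by a correction y to the cut-off path. It vanishes at y = 0 and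
    keeps the constant L, so the same fixed point theory applies.\<close>
  define k where "k s y = f s (ub s + y) - f s (ub s)" for s y
  have k: "forcing L k"
    unfolding forcing_def
  proof (intro conjI allI)
    show "(\<lambda>(s, x). k s x) \<in> borel_measurable (borel \<Otimes>\<^sub>M borel)"
      unfolding k_def split_beta' by measurable
    show "norm (k s x - k s y) \<le> L * norm (x - y)" for s x y
      using forcing_lipschitz[OF f, of s "ub s + x" "ub s + y"] by (simp add: k_def)
  qed (simp add: k_def)
  \<comment> \<open>At 0 this jumps from SP N 0 (u 0) to - SQ N 0 (u 0), that is by - u 0. The
    cut-off path jumps by u 0 there, so the sum b is continuous.\<close>
  define a where "a t = (if t < 0 then SP N t (u 0) else - SQ N t (u 0))" for t
  have a: "a \<in> borel_measurable borel" "exp_bounded \<beta> (norm (u 0)) a"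
    unfolding a_def[abs_def] exp_bounded_def
    using norm_SP_N[of _ "u 0"] norm_SQ_le[OF less_imp_le[OF \<beta>(2)], of _ "u 0"] by auto
  define \<phi> where "\<phi> = lp a k"
  define q where "q = (\<lambda>s. k s (\<phi> s))"
  note \<phi> = lp_measurable[OF k a, folded \<phi>_def] lp_bound[OF k a, folded \<phi>_def]
    lp_fixed_point[OF k a, folded \<phi>_def, folded q_def]
  note q = lp_forcing_measurable[OF k a, folded \<phi>_def, folded q_def]
    lp_forcing_bound[OF k a, folded \<phi>_def, folded q_def]
  define p where "p s = f s (ub s)" for s
  have p: "loc_bounded p"
    unfolding p_def[abs_def] by (rule loc_bounded_forcing[OF f L_ge0 ub])
  define w where "w t = ub t + \<phi> t" for t
  define b where "b t = ub t + a t" for t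
  have wb: "w t = b t + conv q t" for t
    using \<phi>(3)[of t] by (simp add: w_def b_def)
  have b1: "b t = SP N t (u 0)" if "t \<le> 0" for t
    using that SP_SQ_0[of N "u 0"] by (cases "t = 0") (auto simp: b_def ub_def a_def algebra_simps)
  have b2: "b t = u t - SQ N t (u 0)" if "0 \<le> t" for t
    using that by (simp add: b_def ub_def a_def)
  have un: "{..0} \<union> {0..} = (UNIV :: real set)" by auto
  have "continuous_on {..0} b"
    by (rule continuous_on_eq[OF continuous_on_subset[OF SP_continuous[of N "u 0"]]]) (auto simp: b1)
  moreover have "continuous_on {0..} b"
    by (rule continuous_on_eq[of _ "\<lambda>t. u t - SQ N t (u 0)"])
       (auto simp: b2 intro!: continuous_intros ucont SQ_continuous)
  ultimately have bcont: "continuous_on UNIV b"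
    using continuous_on_closed_Un[of "{..0::real}" "{0..}" b] un by auto
  have "vocp p {..0} b"
  \<comment> \<open>The forcing p vanishes for s < 0 but not necessarily at s = 0, where the cut-off
    path has the value u 0; this is the exceptional time.\<close>
  proof (rule vocp_cong[where ?s0.0 = 0])
    show "vocp (\<lambda>_. 0) {..0} (\<lambda>t. SP N t (u 0))" by (rule vocp_SP)
    show "0 = p s" if "s \<in> {..0}" "s \<noteq> 0" for s
      using that by (simp add: p_def ub_def forcing_zero[OF f])
  qed (auto simp: b1 p loc_bounded_0 is_interval_ic)
  moreover have "vocp p {0..} b"
  proof -
    have "vocp p {0..} u"
      using u mild_iff_cut[OF is_interval_ci] by (simp add: p_def[abs_def] ub_def)
    then have "vocp (\<lambda>s. p s + - 0) {0..} (\<lambda>t. u t + - SQ N t (u 0))"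
      by (intro vocp_add vocp_minus vocp_SQ p) (simp_all add: loc_bounded_0)
    then show ?thesis
      by (rule vocp_cong_on) (auto simp: b2 is_interval_ci)
  qed
  ultimately have bv: "vocp p UNIV b" by (rule vocp_glue[OF p])
  have "vocp (\<lambda>s. p s + q s) UNIV (\<lambda>t. b t + conv q t)"
    by (rule vocp_add[OF bv vocp_conv(1)[OF ck q] p exp_bounded_loc_bounded[OF q]])
  then have "vocp (\<lambda>s. f s (w s)) UNIV w"
  proof (rule vocp_cong_on)
    show "b t + conv q t = w t" for t by (rule wb[symmetric])
    show "p s + q s = f s (w s)" for s by (simp add: p_def q_def k_def w_def)
  qed (rule is_interval_univ)
  moreover have "continuous_on UNIV w"
    unfolding wb by (intro continuous_intros bcont conv_continuous[OF q])
  ultimately have "mild f UNIV w" by (simp add: mild_def)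
  moreover have "norm (w t - u t) \<le> norm (u 0) / (1 - L * kap_int N \<beta>) * exp (- \<beta> * t)" if "0 \<le> t" for t
    using exp_boundedD[OF \<phi>(2), of t] that by (simp add: w_def ub_def)
  moreover have "norm (w t) \<le> (norm (u 0) / (1 - L * kap_int N \<beta>) + norm (u 0)) * exp (- \<beta> * t)" if "t \<le> 0" for t
  proof -
    have "norm (ub t) \<le> norm (u 0) * exp (- \<beta> * t)"
      using that by (auto simp: ub_def indicator_def)
    then show ?thesis
      using exp_boundedD[OF \<phi>(2), of t] norm_triangle_ineq[of "ub t" "\<phi> t"]
      by (simp add: w_def distrib_right)
  qed
  ultimately show ?thesis by (rule that)
qed

lemma graph_map_C1:
  assumes Df: "\<And>s x. (f s has_derivative blinfun_apply (Df s x)) (at x)"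
    and Df_cont: "\<And>s. continuous_on UNIV (Df s)"
  shows "\<exists>D. (\<forall>\<xi>. (graph_map f has_derivative D \<xi>) (at \<xi>)) \<and>
    (\<forall>\<xi>. \<forall>\<epsilon>>0. \<exists>\<delta>>0. \<forall>y. norm (y - \<xi>) < \<delta> \<longrightarrow> (\<forall>h. norm (D y h - D \<xi> h) \<le> \<epsilon> * norm h))"
proof -
  interpret S: smooth_forcing "G N" "kap N" \<beta> "kap_int N \<beta>" L "past f" "\<lambda>s x. if s \<le> 0 then Df s x else 0" aM
  proof
    show "(past f s has_derivative blinfun_apply (if s \<le> 0 then Df s x else 0)) (at x)" for s x
      using Df by (cases "s \<le> 0") (auto simp: past_def[abs_def] zero_blinfun.rep_eq)
    show "continuous_on UNIV (\<lambda>x. if s \<le> 0 then Df s x else 0)" for s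
      using Df_cont by (cases "s \<le> 0") auto
  qed (auto simp: forcing_past[OF f] aM_bound linear_add[OF aM_linear] linear_scale[OF aM_linear])
  have backward: "S.\<phi> \<xi> = backward f \<xi>" for \<xi>
    by (simp add: S.\<phi>_def backward_def)
  show ?thesis
  proof (rule exI[of _ "\<lambda>\<xi> h. S.\<Phi> \<xi> 0 h - SP N 0 h"], intro conjI allI impI)
    show "(graph_map f has_derivative (\<lambda>h. S.\<Phi> \<xi> 0 h - SP N 0 h)) (at \<xi>)" for \<xi>
      unfolding graph_map_def[abs_def]
      using S.\<phi>_has_derivative[of 0 \<xi>, unfolded backward]
      by (intro has_derivative_diff bounded_linear_imp_has_derivative bounded_linear_SP)
    show "\<exists>\<delta>>0. \<forall>y. norm (y - \<xi>) < \<delta> \<longrightarrow> (\<forall>h. norm (S.\<Phi> y 0 h - SP N 0 h - (S.\<Phi> \<xi> 0 h - SP N 0 h)) \<le> \<epsilon> * norm h)"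
      if "0 < \<epsilon>" for \<epsilon> \<xi>
      using S.\<Phi>_opnorm_continuous[OF that, of \<xi> 0] by simp
  qed
qed

end

text \<open>Both w and \<xi> are treated as parameters of the Picard iteration on the whole line,
  and the limit is evaluated at time 0.\<close>

lemma graph_map_measurable:
  assumes f: "(\<lambda>(w, s, x). f w s x) \<in> borel_measurable (M \<Otimes>\<^sub>M borel \<Otimes>\<^sub>M borel)"
  shows "(\<lambda>(w, \<xi>). graph_map (f w) \<xi>) \<in> borel_measurable (M \<Otimes>\<^sub>M borel)"
proof -
  have 1: "(\<lambda>(z, t). aM (snd z) t) \<in> borel_measurable ((M \<Otimes>\<^sub>M borel) \<Otimes>\<^sub>M borel)"
    unfolding aM_def split_beta' by measurable
  have "(\<lambda>((w, \<xi>), s, x). (w, s, x)) \<in> measurable ((M \<Otimes>\<^sub>M borel) \<Otimes>\<^sub>M borel \<Otimes>\<^sub>M borel) (M \<Otimes>\<^sub>M borel \<Otimes>\<^sub>M borel)"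
    unfolding split_beta' by measurable
  from measurable_compose[OF this f]
  have [measurable]: "(\<lambda>x. f (fst (fst x)) (fst (snd x)) (snd (snd x))) \<in> borel_measurable ((M \<Otimes>\<^sub>M borel) \<Otimes>\<^sub>M borel \<Otimes>\<^sub>M borel)"
    by (simp add: split_beta')
  have 2: "(\<lambda>(z, s, x). past (f (fst z)) s x) \<in> borel_measurable ((M \<Otimes>\<^sub>M borel) \<Otimes>\<^sub>M borel \<Otimes>\<^sub>M borel)"
    unfolding past_def split_beta' by measurable
  have "(\<lambda>z. (z, 0)) \<in> measurable (M \<Otimes>\<^sub>M borel) ((M \<Otimes>\<^sub>M borel) \<Otimes>\<^sub>M borel)"
    by measurable
  from measurable_compose[OF this lp_measurable_pair[OF 1 2]]
  show ?thesis
    unfolding graph_map_def backward_def split_beta' by simp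
qed

end

section \<open>Noise paths\<close>

text \<open>The path is evaluated at a grid point of mesh 1 / (n + 1) strictly to the right of x.
  Only countably many evaluation times occur, so this is jointly measurable, and right continuity
  gives convergence as the mesh tends to 0.\<close>

lemma evaluation_measurable:
  fixes M :: "path measure"
  assumes M: "sets M = sets (path_space X)"
    and X: "\<And>w x. w \<in> X \<Longrightarrow> continuous (at_right x) w"
  shows "(\<lambda>(w, x). w x) \<in> borel_measurable (M \<Otimes>\<^sub>M borel)"
proof -
  have sp: "space M = X"
    using sets_eq_imp_space_eq[OF M] by (simp add: path_space_def space_restrict_space space_PiM)
  have [measurable]: "(\<lambda>w. w q) \<in> borel_measurable M" for q :: real
  proof -
    have "(\<lambda>w. w q) \<in> borel_measurable (path_space X)"
      unfolding path_space_def by (rule measurable_restrict_space1) (rule measurable_component_singleton, simp)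
    then show ?thesis using M by (simp cong: measurable_cong_sets)
  qed
  define d where "d n (j :: int) = (of_int j + 1) / real (Suc n)" for n j
  show ?thesis
    unfolding split_beta'
  proof (rule borel_measurable_LIMSEQ_real)
    show "(\<lambda>z. fst z (d n \<lfloor>real (Suc n) * snd z\<rfloor>)) \<in> borel_measurable (M \<Otimes>\<^sub>M borel)" for n
    proof (rule measurable_compose_countable[where f = "\<lambda>j z. fst z (d n j)"])
      show "(\<lambda>x. \<lfloor>real (Suc n) * snd x\<rfloor>) \<in> measurable (M \<Otimes>\<^sub>M borel) (count_space UNIV)"
        by measurable
    qed measurable
    fix z assume "z \<in> space (M \<Otimes>\<^sub>M (borel :: real measure))"
    then have z: "fst z \<in> X" by (auto simp: space_pair_measure sp)
    define x where "x = snd z"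
    have gt: "x < d n \<lfloor>real (Suc n) * x\<rfloor>" for n
    proof -
      have "real (Suc n) * x < of_int \<lfloor>real (Suc n) * x\<rfloor> + 1" by linarith
      then show ?thesis by (simp add: d_def field_simps del: of_nat_Suc)
    qed
    have le: "d n \<lfloor>real (Suc n) * x\<rfloor> \<le> x + inverse (real (Suc n))" for n
    proof -
      have "of_int \<lfloor>real (Suc n) * x\<rfloor> + 1 \<le> real (Suc n) * x + 1" by linarith
      then have "d n \<lfloor>real (Suc n) * x\<rfloor> \<le> (real (Suc n) * x + 1) / real (Suc n)"
        unfolding d_def by (rule divide_right_mono) simp
      also have "\<dots> = x + inverse (real (Suc n))"
        by (simp add: add_divide_distrib inverse_eq_divide del: of_nat_Suc)
      finally show ?thesis .
    qed
    have "(\<lambda>n. d n \<lfloor>real (Suc n) * x\<rfloor>) \<longlonglongrightarrow> x"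
      by (rule tendsto_sandwich[OF _ _ tendsto_const LIMSEQ_inverse_real_of_nat_add])
         (use gt le in \<open>auto intro!: always_eventually less_imp_le\<close>)
    then have "filterlim (\<lambda>n. d n \<lfloor>real (Suc n) * x\<rfloor>) (at_right x) sequentially"
      using less_imp_neq[OF gt, symmetric] gt by (auto simp: filterlim_at simp del: of_nat_Suc intro!: always_eventually)
    moreover have "(fst z \<longlongrightarrow> fst z x) (at_right x)"
      using X[OF z, of x] by (simp add: continuous_within)
    ultimately show "(\<lambda>n. fst z (d n \<lfloor>real (Suc n) * snd z\<rfloor>)) \<longlonglongrightarrow> fst z (snd z)"
      unfolding x_def[symmetric] by (rule filterlim_compose[rotated])
  qed
qed

section \<open>Primitives of locally bounded functions\<close>

lemma loc_bounded_set_integrable: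
  fixes g :: "real \<Rightarrow> real"
  assumes "loc_bounded g"
  shows "set_integrable lborel {a..b} g"
proof -
  obtain C where C: "\<And>s. s \<in> {a..b} \<Longrightarrow> norm (g s) \<le> C"
    using assms unfolding loc_bounded_def by metis
  show ?thesis unfolding set_integrable_def
    by (rule integrableI_bounded_set_indicator[where B = C])
       (use C loc_bounded_measurable[OF assms] in \<open>auto simp: emeasure_lborel_Icc_eq\<close>)
qed

lemma loc_bounded_interval_integrable:
  fixes g :: "real \<Rightarrow> real"
  assumes "loc_bounded g"
  shows "interval_lebesgue_integrable lborel (ereal a) (ereal b) g"
proof -
  have "set_integrable lborel {a<..<b} g" for a b
    by (rule set_integrable_subset[OF loc_bounded_set_integrable[OF assms, of a b]]) auto
  then show ?thesis
    by (simp add: interval_lebesgue_integrable_def einterval_eq)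
qed

lemma loc_bounded_interval_sum:
  fixes g :: "real \<Rightarrow> real"
  assumes "loc_bounded g"
  shows "(LBINT x=ereal a..ereal b. g x) + (LBINT x=ereal b..ereal c. g x) = (LBINT x=ereal a..ereal c. g x)"
proof (rule interval_integral_sum)
  show "interval_lebesgue_integrable lborel (min (ereal a) (min (ereal b) (ereal c))) (max (ereal a) (max (ereal b) (ereal c))) g"
    using loc_bounded_interval_integrable[OF assms, of "min a (min b c)" "max a (max b c)"]
    by (simp only: ereal_min ereal_max)
qed

lemma loc_bounded_primitive_continuous:
  fixes g :: "real \<Rightarrow> real"
  assumes g: "loc_bounded g"
  shows "continuous_on UNIV (\<lambda>t. LBINT x=ereal a..ereal t. g x)"
proof (rule continuous_at_imp_continuous_on, rule ballI)
  fix t :: real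
  obtain C where C: "\<And>s. s \<in> {t - 1..t + 1} \<Longrightarrow> \<bar>g s\<bar> \<le> C"
    using g unfolding loc_bounded_def by (metis real_norm_def)
  have C0: "0 \<le> C" using C[of t] by auto
  have bound: "\<bar>LBINT x=ereal r..ereal s. g x\<bar> \<le> C * (s - r)" if "r \<le> s" "t - 1 \<le> r" "s \<le> t + 1" for r s
  proof -
    have i: "set_integrable lborel {r..s} g"
      by (rule loc_bounded_set_integrable[OF g])
    have "norm (LINT x|lborel. indicator {r..s} x *\<^sub>R g x) \<le> (LINT x|lborel. indicator {r..s} x * C)"
    proof (rule Bochner_Integration.integral_norm_bound_integral)
      show "integrable lborel (\<lambda>x. indicator {r..s} x * C)"
        by (intro integrable_mult_left integrable_real_indicator) (auto simp: emeasure_lborel_Icc_eq)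
    qed (use i C that in \<open>auto simp: set_integrable_def indicator_def\<close>)
    then show ?thesis using that
      by (simp add: interval_integral_Icc set_lebesgue_integral_def mult.commute)
  qed
  have lim: "\<bar>(LBINT x=ereal a..ereal s. g x) - (LBINT x=ereal a..ereal t. g x)\<bar> \<le> C * \<bar>s - t\<bar>" if "\<bar>s - t\<bar> \<le> 1" for s
    using loc_bounded_interval_sum[OF g, of a s t] loc_bounded_interval_sum[OF g, of a t s] bound[of s t] bound[of t s] that
    by (cases "s \<le> t") auto
  show "isCont (\<lambda>t. LBINT x=ereal a..ereal t. g x) t"
    unfolding isCont_def
  proof (rule LIM_zero_cancel, rule Lim_null_comparison)
    show "\<forall>\<^sub>F s in at t. norm ((LBINT x=ereal a..ereal s. g x) - (LBINT x=ereal a..ereal t. g x)) \<le> C * \<bar>s - t\<bar>"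
      unfolding eventually_at by (rule exI[of _ 1]) (auto simp: dist_real_def intro!: lim)
    have "((\<lambda>s. C * \<bar>s - t\<bar>) \<longlongrightarrow> C * \<bar>t - t\<bar>) (at t)" by (intro tendsto_intros)
    then show "((\<lambda>s. C * \<bar>s - t\<bar>) \<longlongrightarrow> 0) (at t)" by simp
  qed
qed

lemma interval_integral_shift:
  fixes g :: "real \<Rightarrow> real"
  shows "(LBINT x=ereal a..ereal b. g (c + x)) = (LBINT x=ereal (c + a)..ereal (c + b). g x)"
proof -
  have *: "(LBINT x=ereal a..ereal b. g (c + x)) = (LBINT x=ereal (c + a)..ereal (c + b). g x)" if "a \<le> b" for a b
  proof -
    have "(LBINT x:{c + a..c + b}. g x) = (LINT x|lborel. indicator {c + a..c + b} (c + 1 * x) *\<^sub>R g (c + 1 * x))"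
      unfolding set_lebesgue_integral_def by (subst lborel_integral_real_affine[of 1 _ c]) auto
    also have "\<dots> = (LBINT x:{a..b}. g (c + x))"
      unfolding set_lebesgue_integral_def by (intro Bochner_Integration.integral_cong) (auto simp: indicator_def)
    finally show ?thesis using that by (simp add: interval_integral_Icc)
  qed
  show ?thesis
  proof (cases "a \<le> b")
    case False
    then show ?thesis
      using *[of b a] interval_integral_endpoints_reverse[of "ereal a" "ereal b" "\<lambda>x. g (c + x)"]
        interval_integral_endpoints_reverse[of "ereal (c + a)" "ereal (c + b)" g] by simp
  qed (rule *)
qed

lemma loc_bounded_continuous_on:
  fixes u :: "real \<Rightarrow> 'a::{real_normed_vector,second_countable_topology}"
  assumes "continuous_on UNIV u"
  shows "loc_bounded u"
  using loc_bounded_continuous[OF assms closed_UNIV] by simp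

text \<open>K is the supremum over the nonnegative rationals: measurable because countable, and a
  bound at every t by approaching t through rationals from the right.\<close>

lemma right_continuous_bound_measurable:
  fixes g :: "'w \<Rightarrow> real \<Rightarrow> real"
  assumes [measurable]: "\<And>t. (\<lambda>\<omega>. g \<omega> t) \<in> borel_measurable M"
    and cont: "\<And>\<omega> t. \<omega> \<in> space M \<Longrightarrow> continuous (at_right t) (g \<omega>)"
    and bdd: "\<And>\<omega>. \<omega> \<in> space M \<Longrightarrow> \<exists>C. \<forall>t\<ge>0. g \<omega> t \<le> C"
  obtains K where "K \<in> borel_measurable M" "\<And>\<omega> t. \<omega> \<in> space M \<Longrightarrow> 0 \<le> t \<Longrightarrow> g \<omega> t \<le> K \<omega>"
proof
  define Q where "Q = \<rat> \<inter> {0::real..}"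
  have "countable Q" unfolding Q_def using countable_rat by auto
  have bd: "bdd_above ((\<lambda>t. g \<omega> t) ` Q)" if "\<omega> \<in> space M" for \<omega>
    using bdd[OF that] unfolding Q_def bdd_above_def by auto
  show "(\<lambda>\<omega>. SUP t\<in>Q. g \<omega> t) \<in> borel_measurable M"
    using \<open>countable Q\<close> bd by (intro borel_measurable_cSUP) auto
  fix \<omega> t assume \<omega>: "\<omega> \<in> space M" and t: "0 \<le> (t::real)"
  have "\<exists>q. q \<in> \<rat> \<and> t < q \<and> q < t + inverse (real (Suc n))" for n
    using Rats_dense_in_real[of t "t + inverse (real (Suc n))"] by auto
  then obtain q where q: "\<And>n. q n \<in> \<rat>" "\<And>n. t < q n" "\<And>n. q n < t + inverse (real (Suc n))"
    by metis
  have "q \<longlonglongrightarrow> t"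
    by (rule tendsto_sandwich[OF _ _ tendsto_const LIMSEQ_inverse_real_of_nat_add])
       (use q in \<open>auto intro!: always_eventually less_imp_le\<close>)
  then have "filterlim q (at_right t) sequentially"
    using less_imp_neq[OF q(2), symmetric] q(2) by (auto simp: filterlim_at intro!: always_eventually)
  moreover have "(g \<omega> \<longlongrightarrow> g \<omega> t) (at_right t)"
    using cont[OF \<omega>] by (simp add: continuous_within)
  ultimately have "(\<lambda>n. g \<omega> (q n)) \<longlonglongrightarrow> g \<omega> t"
    by (rule filterlim_compose[rotated])
  then show "g \<omega> t \<le> (SUP t\<in>Q. g \<omega> t)"
  proof (rule LIMSEQ_le_const2, intro exI[of _ 0] allI impI)
    fix n
    have "q n \<in> Q" using q(1,2)[of n] t by (auto simp: Q_def)
    then show "g \<omega> (q n) \<le> (SUP t\<in>Q. g \<omega> t)" by (rule cSUP_upper[OF _ bd[OF \<omega>]])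
  qed
qed

section \<open>The stationary Ornstein--Uhlenbeck process\<close>

definition Zp :: "path \<times> path \<Rightarrow> real \<Rightarrow> real" where "Zp \<omega> t = zOU (noise_shift t \<omega>)"

definition zeta :: "path \<times> path \<Rightarrow> real \<Rightarrow> real" where "zeta \<omega> t = zint \<omega> 0 t"

text \<open>The Wiener path is shifted first by l \<tau> and then by the increment of l over the
  next t units; the two add up to l (\<tau> + t).\<close>

lemma noise_shift_add: "noise_shift t (noise_shift \<tau> \<omega>) = noise_shift (\<tau> + t) \<omega>"
  by (cases \<omega>) (auto simp: noise_shift_def fun_eq_iff algebra_simps)

lemma subordinated_shift: "subordinated (noise_shift t \<omega>) s = subordinated \<omega> (t + s) - subordinated \<omega> t"
  by (cases \<omega>) (simp add: noise_shift_def subordinated_def)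

lemma Zp_eq: "Zp \<omega> t = - (LBINT s:{..0}. exp s * (subordinated \<omega> (t + s) - subordinated \<omega> t))"
  by (simp add: Zp_def zOU_def subordinated_shift)

lemma Zp_shift: "Zp (noise_shift \<tau> \<omega>) t = Zp \<omega> (\<tau> + t)"
  by (simp add: Zp_def noise_shift_add)

lemma zint_Zp: "zint \<omega> a b = (LBINT r=ereal a..ereal b. Zp \<omega> r)"
  by (simp add: zint_def Zp_def)

lemma zint_shift: "zint (noise_shift \<tau> \<omega>) a b = zint \<omega> (\<tau> + a) (\<tau> + b)"
  unfolding zint_Zp Zp_shift by (rule interval_integral_shift)

locale noise =
  fixes muW muS :: "path measure" and Om :: "(path \<times> path) set"
  assumes sets_W: "sets muW = sets (path_space wiener_paths)"
    and sets_S: "sets muS = sets (path_space subordinator_paths)"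
    and full: "full_invariant_set muW muS Om"
begin

definition Omega :: "(path \<times> path) measure" where
  "Omega = restrict_space (muW \<Otimes>\<^sub>M muS) Om"

lemma Om_sets: "Om \<in> sets (muW \<Otimes>\<^sub>M muS)"
  using full by (simp add: full_invariant_set_def)

lemma space_Omega [simp]: "space Omega = Om"
  using sets.sets_into_space[OF Om_sets] by (auto simp: Omega_def space_restrict_space)

lemma Om_paths:
  assumes "\<omega> \<in> Om"
  obtains w l where "\<omega> = (w, l)" "w \<in> wiener_paths" "l \<in> subordinator_paths"
proof -
  have "space muW = wiener_paths" "space muS = subordinator_paths"
    using sets_eq_imp_space_eq[OF sets_W] sets_eq_imp_space_eq[OF sets_S]
    by (simp_all add: path_space_def space_restrict_space space_PiM)
  then have "\<omega> \<in> wiener_paths \<times> subordinator_paths"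
    using assms sets.sets_into_space[OF Om_sets] by (auto simp: space_pair_measure)
  then show ?thesis using that by auto
qed

lemma Om_shift: "\<omega> \<in> Om \<Longrightarrow> noise_shift t \<omega> \<in> Om"
  using full unfolding full_invariant_set_def by blast

lemma noise_shift_0: "\<omega> \<in> Om \<Longrightarrow> noise_shift 0 \<omega> = \<omega>"
  by (erule Om_paths) (simp add: noise_shift_def wiener_paths_def subordinator_paths_def)

lemma Zp_0: "\<omega> \<in> Om \<Longrightarrow> Zp \<omega> 0 = zOU \<omega>"
  by (simp add: Zp_def noise_shift_0)

lemma Om_limits:
  assumes "\<omega> \<in> Om"
  shows "((\<lambda>t. subordinated \<omega> t / t) \<longlongrightarrow> 0) at_bot"
    and "((\<lambda>t. Zp \<omega> t / t) \<longlongrightarrow> 0) at_top"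
    and "((\<lambda>t. zeta \<omega> t / t) \<longlongrightarrow> 0) at_top"
proof -
  have *: "\<forall>\<omega>\<in>Om. \<forall>E\<in>{at_top, at_bot}.
        ((\<lambda>t. subordinated \<omega> t / t) \<longlongrightarrow> 0) E \<and>
        ((\<lambda>t. zOU (noise_shift t \<omega>) / t) \<longlongrightarrow> 0) E \<and>
        ((\<lambda>t. 1 / t * zint \<omega> 0 t) \<longlongrightarrow> 0) E"
    using full unfolding full_invariant_set_def by blast
  show "((\<lambda>t. subordinated \<omega> t / t) \<longlongrightarrow> 0) at_bot" "((\<lambda>t. Zp \<omega> t / t) \<longlongrightarrow> 0) at_top"
    "((\<lambda>t. zeta \<omega> t / t) \<longlongrightarrow> 0) at_top"
  proof -
    note top = bspec[OF bspec[OF * assms], of at_top, simplified] and bot = bspec[OF bspec[OF * assms], of at_bot, simplified]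
    show "((\<lambda>t. subordinated \<omega> t / t) \<longlongrightarrow> 0) at_bot" using bot by blast
    show "((\<lambda>t. Zp \<omega> t / t) \<longlongrightarrow> 0) at_top" using top unfolding Zp_def by blast
    show "((\<lambda>t. zeta \<omega> t / t) \<longlongrightarrow> 0) at_top" using top unfolding zeta_def by blast
  qed
qed

text \<open>Two evaluations in succession: the subordinator at the given time, then the Wiener path
  at the resulting random time. Both are jointly measurable by right continuity.\<close>

lemma subordinated_measurable [measurable (raw)]:
  assumes g: "g \<in> measurable M Omega" and h: "h \<in> borel_measurable M"
  shows "(\<lambda>x. subordinated (g x) (h x)) \<in> borel_measurable M"
proof -
  have g': "g \<in> measurable M (muW \<Otimes>\<^sub>M muS)"
    using g unfolding Omega_def measurable_restrict_space2_iff by blast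
  have W: "(\<lambda>(w, x). w x) \<in> borel_measurable (muW \<Otimes>\<^sub>M borel)"
    by (rule evaluation_measurable[OF sets_W])
       (auto simp: wiener_paths_def continuous_on_eq_continuous_at continuous_at_imp_continuous_within)
  have S: "(\<lambda>(w, x). w x) \<in> borel_measurable (muS \<Otimes>\<^sub>M borel)"
    by (rule evaluation_measurable[OF sets_S]) (simp add: subordinator_paths_def)
  have 1: "(\<lambda>x. snd (g x) (h x)) \<in> borel_measurable M"
    using measurable_compose[OF measurable_Pair[OF measurable_compose[OF g' measurable_snd] h] S] by simp
  have "(\<lambda>x. fst (g x) (snd (g x) (h x))) \<in> borel_measurable M"
    using measurable_compose[OF measurable_Pair[OF measurable_compose[OF g' measurable_fst] 1] W] by simp
  then show ?thesis
    by (simp add: subordinated_def split_beta')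
qed

lemma Zp_measurable [measurable (raw)]:
  assumes [measurable]: "g \<in> measurable M Omega" "h \<in> borel_measurable M"
  shows "(\<lambda>x. Zp (g x) (h x)) \<in> borel_measurable M"
  unfolding Zp_eq set_lebesgue_integral_def by measurable

lemma zeta_measurable [measurable (raw)]:
  assumes [measurable]: "g \<in> measurable M Omega" "h \<in> borel_measurable M"
  shows "(\<lambda>x. zeta (g x) (h x)) \<in> borel_measurable M"
proof -
  \<comment> \<open>Unfolding the orientation leaves ordinary integrals over the line, with
    integrands jointly measurable in all parameters.\<close>
  have eq: "zeta \<omega> t = (if 0 \<le> t then (LINT r|lborel. (if 0 < r \<and> r < t then Zp \<omega> r else 0))
      else - (LINT r|lborel. (if t < r \<and> r < 0 then Zp \<omega> r else 0)))" for \<omega> t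
    by (auto simp: zeta_def zint_Zp interval_lebesgue_integral_def set_lebesgue_integral_def einterval_eq
        intro!: Bochner_Integration.integral_cong)
  have [measurable]: "snd \<in> borel_measurable (M \<Otimes>\<^sub>M lborel)" by simp
  show ?thesis unfolding eq by measurable
qed

context
  fixes \<omega> assumes \<omega>: "\<omega> \<in> Om"
begin

lemma const_Omega [measurable]: "(\<lambda>_. \<omega>) \<in> measurable M Omega"
  by (rule measurable_const) (simp add: \<omega>)

lemma subordinated_right_continuous: "continuous (at_right t) (subordinated \<omega>)"
proof -
  obtain w l where wl: "\<omega> = (w, l)" "w \<in> wiener_paths" "l \<in> subordinator_paths"
    using Om_paths[OF \<omega>] .
  have "(l \<longlongrightarrow> l t) (at_right t)"
    using wl(3) by (simp add: subordinator_paths_def continuous_within)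
  moreover have "isCont w (l t)"
    using wl(2) by (simp add: wiener_paths_def continuous_on_eq_continuous_at)
  ultimately have "((\<lambda>t. w (l t)) \<longlongrightarrow> w (l t)) (at_right t)"
    by (rule isCont_tendsto_compose[rotated])
  then show ?thesis
    unfolding wl(1) subordinated_def continuous_within prod.case .
qed

text \<open>Monotonicity of l keeps the evaluation times in [l a, l b], a compact set on which the
  continuous Wiener path is bounded.\<close>

lemma subordinated_loc_bounded: "loc_bounded (subordinated \<omega>)"
  unfolding loc_bounded_def
proof (intro conjI allI)
  show "subordinated \<omega> \<in> borel_measurable borel" by measurable
  obtain w l where wl: "\<omega> = (w, l)" "w \<in> wiener_paths" "l \<in> subordinator_paths"
    using Om_paths[OF \<omega>] .
  fix a b :: real
  have "compact (w ` {l a..l b})"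
    using wl(2) by (intro compact_continuous_image) (auto simp: wiener_paths_def intro: continuous_on_subset)
  then obtain C where C: "\<And>x. x \<in> {l a..l b} \<Longrightarrow> norm (w x) \<le> C"
    by (metis bounded_iff compact_imp_bounded imageI)
  have "mono l" using wl(3) by (simp add: subordinator_paths_def)
  then have "norm (subordinated \<omega> s) \<le> C" if "s \<in> {a..b}" for s
    using that C[of "l s"] by (auto simp: wl(1) subordinated_def mono_def)
  then show "\<exists>C. \<forall>s\<in>{a..b}. norm (subordinated \<omega> s) \<le> C" by blast
qed

text \<open>Half of the exponential absorbs the growth of the path: near minus infinity the path is
  at most |r|, and exp (r / 2) * |r| <= 2. On the remaining compact stretch the path is
  bounded.\<close>

lemma exp_subordinated_bound:
  obtains C where "\<And>r. r \<le> T \<Longrightarrow> \<bar>exp r * subordinated \<omega> r\<bar> \<le> C * exp (1 / 2 * r)"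
proof -
  have "\<forall>\<^sub>F r in at_bot. \<bar>subordinated \<omega> r / r\<bar> < 1"
    using order_tendstoD(2)[OF tendsto_rabs_zero[OF Om_limits(1)[OF \<omega>]], of 1] by simp
  then have "\<forall>\<^sub>F r in at_bot. \<bar>subordinated \<omega> r / r\<bar> < 1 \<and> r < 0"
    using eventually_gt_at_bot[of 0] by eventually_elim auto
  then obtain R where R: "\<And>r. r \<le> R \<Longrightarrow> \<bar>subordinated \<omega> r / r\<bar> < 1 \<and> r < 0"
    by (auto simp: eventually_at_bot_linorder)
  obtain C where C: "\<And>r. r \<in> {R..T} \<Longrightarrow> \<bar>subordinated \<omega> r\<bar> \<le> C"
    using subordinated_loc_bounded unfolding loc_bounded_def by (metis real_norm_def)
  have half: "exp r = exp (1 / 2 * r) * exp (1 / 2 * r)" for r :: real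
    by (simp add: mult_exp_exp)
  have "\<bar>exp r * subordinated \<omega> r\<bar> \<le> (2 + \<bar>C\<bar> * exp (1 / 2 * T)) * exp (1 / 2 * r)" if "r \<le> T" for r
  proof (cases "r \<le> R")
    case True
    then have "\<bar>subordinated \<omega> r\<bar> \<le> \<bar>r\<bar>" "r < 0" using R[OF True] by (auto simp: abs_divide field_simps)
    then have "exp (1 / 2 * r) * \<bar>subordinated \<omega> r\<bar> \<le> exp (1 / 2 * r) * (- r)"
      by (intro mult_left_mono) auto
    also have "\<dots> \<le> 2"
    proof -
      have "- (1 / 2 * r) \<le> exp (- (1 / 2 * r))"
        using exp_ge_add_one_self[of "- (1 / 2 * r)"] by linarith
      then have "exp (1 / 2 * r) * - (1 / 2 * r) \<le> exp (1 / 2 * r) * exp (- (1 / 2 * r))"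
        by (rule mult_left_mono) simp
      then show ?thesis by (simp add: mult_exp_exp)
    qed
    also have "2 \<le> 2 + \<bar>C\<bar> * exp (1 / 2 * T)" by simp
    finally have "exp (1 / 2 * r) * (exp (1 / 2 * r) * \<bar>subordinated \<omega> r\<bar>) \<le> exp (1 / 2 * r) * (2 + \<bar>C\<bar> * exp (1 / 2 * T))"
      by (rule mult_left_mono) simp
    then show ?thesis by (simp add: half[of r] abs_mult mult_ac)
  next
    case False
    have "exp (1 / 2 * r) * \<bar>subordinated \<omega> r\<bar> \<le> exp (1 / 2 * T) * \<bar>C\<bar>"
      using that False C[of r] by (intro mult_mono) auto
    then have "exp (1 / 2 * r) * \<bar>subordinated \<omega> r\<bar> \<le> 2 + \<bar>C\<bar> * exp (1 / 2 * T)" by (simp add: mult.commute)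
    then have "exp (1 / 2 * r) * (exp (1 / 2 * r) * \<bar>subordinated \<omega> r\<bar>) \<le> exp (1 / 2 * r) * (2 + \<bar>C\<bar> * exp (1 / 2 * T))"
      by (rule mult_left_mono) simp
    then show ?thesis by (simp add: half[of r] abs_mult mult_ac)
  qed
  then show ?thesis by (rule that)
qed

lemma exp_half_integrable: "integrable lborel (\<lambda>r. indicator {..<T} r * exp (1 / 2 * r))" for T :: real
proof -
  have "has_bochner_integral lborel (\<lambda>r. indicator {..<0} r * exp (1 / 2 * r)) (1 / (1 / 2 :: real))"
    by (rule has_bochner_integral_exp_neg) simp
  then have "integrable lborel (\<lambda>r::real. indicator {..<0} r * exp (1 / 2 * r))"
    by (simp only: has_bochner_integral_iff)
  from lborel_integrable_real_affine[OF this, of 1 "- T"]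
  have 1: "integrable lborel (\<lambda>r. exp (1 / 2 * T) * (indicator {..<0} (- T + 1 * r) * exp (1 / 2 * (- T + 1 * r))))"
    by (intro integrable_mult_right) simp
  have 2: "exp (1 / 2 * T) * (indicator {..<0} (- T + 1 * r) * exp (1 / 2 * (- T + 1 * r))) = indicator {..<T} r * exp (1 / 2 * r)" for r
    by (auto simp: indicator_def mult_exp_exp add_divide_distrib[symmetric] diff_divide_distrib[symmetric])
  show ?thesis using 1 unfolding 2 .
qed

lemma exp_subordinated_integrable: "integrable lborel (\<lambda>r. indicator {..t} r * (exp r * subordinated \<omega> r))"
proof -
  obtain C where C: "\<And>r. r \<le> t + 1 \<Longrightarrow> \<bar>exp r * subordinated \<omega> r\<bar> \<le> C * exp (1 / 2 * r)"
    using exp_subordinated_bound[of "t + 1"] by blast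
  show ?thesis
  proof (rule Bochner_Integration.integrable_bound)
    show "integrable lborel (\<lambda>r. C * (indicator {..<t + 1} r * exp (1 / 2 * r)))"
      by (intro integrable_mult_right exp_half_integrable)
    show "AE r in lborel. norm (indicator {..t} r * (exp r * subordinated \<omega> r)) \<le> norm (C * (indicator {..<t + 1} r * exp (1 / 2 * r)))"
      by (rule AE_I2) (use C in \<open>auto simp: indicator_def intro: order_trans[OF _ abs_ge_self]\<close>)
  qed measurable
qed

definition J :: "real \<Rightarrow> real" where "J t = (LBINT r:{..t}. exp r * subordinated \<omega> r)"

text \<open>Only the upper limit of integration moves, and the indicators converge for every r other
  than t, under one integrable majorant.\<close>

lemma J_continuous: "continuous_on UNIV J"
proof (rule continuous_on_sequentiallyI)
  fix x :: "nat \<Rightarrow> real" and t assume x: "x \<longlonglongrightarrow> t"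
  obtain T where T: "\<And>n. x n \<le> T"
    using convergent_imp_Bseq[OF convergentI[OF x]] by (auto simp: Bseq_def real_norm_def abs_le_iff)
  show "(\<lambda>n. J (x n)) \<longlonglongrightarrow> J t"
    unfolding J_def set_lebesgue_integral_def
  proof (rule integral_dominated_convergence[where w = "\<lambda>r. \<bar>indicator {..T} r * (exp r * subordinated \<omega> r)\<bar>"])
    show "integrable lborel (\<lambda>r. \<bar>indicator {..T} r * (exp r * subordinated \<omega> r)\<bar>)"
      by (rule integrable_abs[OF exp_subordinated_integrable])
    show "AE r in lborel. (\<lambda>n. indicator {..x n} r *\<^sub>R (exp r * subordinated \<omega> r)) \<longlonglongrightarrow> indicator {..t} r *\<^sub>R (exp r * subordinated \<omega> r)"
      using AE_lborel_singleton[of t]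
    proof eventually_elim
      case (elim r)
      then consider "r < t" | "t < r" by linarith
      then have "\<forall>\<^sub>F n in sequentially. indicator {..x n} r = (indicator {..t} r :: real)"
      proof cases
        case 1
        then show ?thesis using order_tendstoD(1)[OF x 1] by (auto elim!: eventually_mono)
      next
        case 2
        then show ?thesis using order_tendstoD(2)[OF x 2] by (auto elim!: eventually_mono)
      qed
      then show ?case by (intro tendsto_eventually) (auto elim: eventually_mono)
    qed
    show "AE r in lborel. norm (indicator {..x n} r *\<^sub>R (exp r * subordinated \<omega> r)) \<le> \<bar>indicator {..T} r * (exp r * subordinated \<omega> r)\<bar>" for n
      using T[of n] by (intro AE_I2) (auto simp: indicator_def abs_mult)
  qed measurable
qed

text \<open>Substituting t + s in the defining integral and using that exp has integral 1 over the
  negative half-line. All jumps of \<open>Zp\<close> are thus those of the subordinated path, the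
  other term being continuous.\<close>

lemma Zp_formula: "Zp \<omega> t = subordinated \<omega> t - exp (- t) * J t"
proof -
  have e1: "has_bochner_integral lborel (\<lambda>s::real. indicator {..0} s * exp s) 1"
  proof -
    have "has_bochner_integral lborel (\<lambda>r::real. indicator {..<0} r * exp r) 1"
      using has_bochner_integral_exp_neg[of 1] by simp
    then show ?thesis
      by (rule has_bochner_integralI_AE) (use AE_lborel_singleton[of 0] in \<open>auto elim!: eventually_mono simp: indicator_def\<close>)
  qed
  have "J t = (LINT s|lborel. indicator {..t} (t + 1 * s) *\<^sub>R (exp (t + 1 * s) * subordinated \<omega> (t + 1 * s)))"
    unfolding J_def set_lebesgue_integral_def by (subst lborel_integral_real_affine[of 1 _ t]) auto
  also have "\<dots> = (LINT s|lborel. exp t * (indicator {..0} s * (exp s * subordinated \<omega> (t + s))))"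
    by (intro Bochner_Integration.integral_cong) (auto simp: indicator_def exp_add)
  finally have J: "J t = exp t * (LINT s|lborel. indicator {..0} s * (exp s * subordinated \<omega> (t + s)))"
    by simp
  have 1: "integrable lborel (\<lambda>s. exp (- t) * (indicator {..t} (t + 1 * s) * (exp (t + 1 * s) * subordinated \<omega> (t + 1 * s))))"
    using lborel_integrable_real_affine[OF exp_subordinated_integrable[of t], of 1 t] by (intro integrable_mult_right) simp
  have 2: "exp (- t) * (indicator {..t} (t + 1 * s) * (exp (t + 1 * s) * subordinated \<omega> (t + 1 * s))) = indicator {..0} s * (exp s * subordinated \<omega> (t + s))" for s
    by (auto simp: indicator_def exp_add exp_minus)
  have i: "integrable lborel (\<lambda>s. indicator {..0} s * (exp s * subordinated \<omega> (t + s)))"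
    using 1 unfolding 2 .
  have "(LBINT s:{..0}. exp s * (subordinated \<omega> (t + s) - subordinated \<omega> t)) =
      (LINT s|lborel. indicator {..0} s * (exp s * subordinated \<omega> (t + s)) - subordinated \<omega> t * (indicator {..0} s * exp s))"
    unfolding set_lebesgue_integral_def by (intro Bochner_Integration.integral_cong) (auto simp: algebra_simps)
  also have "\<dots> = (LINT s|lborel. indicator {..0} s * (exp s * subordinated \<omega> (t + s))) - subordinated \<omega> t"
    using i e1 by (simp add: has_bochner_integral_iff)
  finally show ?thesis
    unfolding Zp_eq J by (simp add: exp_minus)
qed

lemma Zp_right_continuous: "continuous (at_right t) (Zp \<omega>)"
proof -
  have "continuous (at_right t) J"
    using J_continuous by (simp add: continuous_on_eq_continuous_at continuous_at_imp_continuous_within)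
  then have "continuous (at_right t) (\<lambda>t. subordinated \<omega> t - exp (- t) * J t)"
    by (intro continuous_intros subordinated_right_continuous)
  then show ?thesis unfolding Zp_formula[abs_def] .
qed

lemma Zp_loc_bounded: "loc_bounded (Zp \<omega>)"
proof -
  have "loc_bounded (\<lambda>t. - exp (- t) * J t)"
    by (intro loc_bounded_continuous_on continuous_intros J_continuous)
  from loc_bounded_add[OF subordinated_loc_bounded this] show ?thesis
    unfolding Zp_formula[abs_def] by simp
qed

lemma zeta_continuous: "continuous_on UNIV (zeta \<omega>)"
  unfolding zeta_def[abs_def] zint_Zp by (rule loc_bounded_primitive_continuous[OF Zp_loc_bounded])

lemma zint_eq: "zint \<omega> a b = zeta \<omega> b - zeta \<omega> a"
  using loc_bounded_interval_sum[OF Zp_loc_bounded, of 0 a b] by (simp add: zeta_def zint_Zp)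

lemma zeta_0: "zeta \<omega> 0 = 0"
  by (simp add: zeta_def zint_def)

lemma zeta_shift: "zeta (noise_shift \<tau> \<omega>) t = zeta \<omega> (\<tau> + t) - zeta \<omega> \<tau>"
  by (simp add: zeta_def[of "noise_shift \<tau> \<omega>"] zint_shift zint_eq)

lemma zeta_right_continuous: "continuous (at_right t) (zeta \<omega>)"
  using zeta_continuous by (simp add: continuous_on_eq_continuous_at continuous_at_imp_continuous_within)

text \<open>Both quotients by t tend to 0, so the exponent is eventually nonpositive for any b > 0;
  on the compact remainder \<open>Zp\<close> and \<open>zeta\<close> are bounded.\<close>

lemma growth_bound:
  assumes "0 < b"
  shows "\<exists>C. \<forall>t\<ge>0. exp (k * Zp \<omega> t + zeta \<omega> t - b * t) \<le> C"
proof -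
  have "((\<lambda>t. k * (Zp \<omega> t / t) + zeta \<omega> t / t) \<longlongrightarrow> k * 0 + 0) at_top"
    by (intro tendsto_intros Om_limits \<omega>)
  then have "\<forall>\<^sub>F t in at_top. k * (Zp \<omega> t / t) + zeta \<omega> t / t < b"
    using assms by (intro order_tendstoD(2)) auto
  then have "\<forall>\<^sub>F t in at_top. k * Zp \<omega> t + zeta \<omega> t - b * t \<le> 0"
    using eventually_gt_at_top[of 0] by eventually_elim (auto simp: field_simps)
  then obtain T where T: "\<And>t. T \<le> t \<Longrightarrow> k * Zp \<omega> t + zeta \<omega> t - b * t \<le> 0"
    by (auto simp: eventually_at_top_linorder)
  obtain C where C: "\<And>t. t \<in> {0..T} \<Longrightarrow> \<bar>Zp \<omega> t\<bar> \<le> C"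
    using Zp_loc_bounded unfolding loc_bounded_def by (metis real_norm_def)
  obtain D where D: "\<And>t. t \<in> {0..T} \<Longrightarrow> \<bar>zeta \<omega> t\<bar> \<le> D"
    using loc_bounded_continuous_on[OF zeta_continuous] unfolding loc_bounded_def by (metis real_norm_def)
  have "exp (k * Zp \<omega> t + zeta \<omega> t - b * t) \<le> exp (\<bar>k\<bar> * \<bar>C\<bar> + \<bar>D\<bar>)" if "0 \<le> t" for t
  proof (cases "T \<le> t")
    case True
    have "0 \<le> \<bar>k\<bar> * \<bar>C\<bar> + \<bar>D\<bar>" by simp
    then have "k * Zp \<omega> t + zeta \<omega> t - b * t \<le> \<bar>k\<bar> * \<bar>C\<bar> + \<bar>D\<bar>"
      using T[OF True] by linarith
    then show ?thesis by simp
  next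
    case False
    then have "\<bar>Zp \<omega> t\<bar> \<le> \<bar>C\<bar>" "\<bar>zeta \<omega> t\<bar> \<le> \<bar>D\<bar>" using C[of t] D[of t] that by auto
    then have "k * Zp \<omega> t \<le> \<bar>k\<bar> * \<bar>C\<bar>"
      by (metis abs_ge_self abs_ge_zero abs_mult mult_left_mono order_trans)
    moreover have "0 \<le> b * t" using assms that by simp
    ultimately show ?thesis using \<open>\<bar>zeta \<omega> t\<bar> \<le> \<bar>D\<bar>\<close> by simp
  qed
  then show ?thesis by blast
qed

end

end

section \<open>The random equation as a deterministic mild equation\<close>

lemma (in eigen) inner_projP: "projP e n u \<bullet> E k = (if k < n then u \<bullet> E k else 0)"
proof -
  have "projP e n u = (\<Sum>j<n. (u \<bullet> E j) *\<^sub>R E j)"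
    unfolding projP_def by (rule sum.reindex_bij_witness[of _ Suc "\<lambda>j. j - 1"]) auto
  then show ?thesis by (simp add: inner_sum_E)
qed

locale marcus = spectral_gap e lam \<sigma> N \<beta> L + noise muW muS Om
  for e :: "nat \<Rightarrow> 'a::{real_inner,banach,second_countable_topology}" and lam \<sigma> N \<beta> L muW muS Om +
  fixes F :: "'a \<Rightarrow> 'a"
  assumes F_0: "F 0 = 0"
    and F_lipschitz: "\<And>u1 u2. u1 \<in> Adom e lam \<sigma> \<Longrightarrow> u2 \<in> Adom e lam \<sigma> \<Longrightarrow>
      norm (F u1 - F u2) \<le> L * snorm e lam \<sigma> (u1 - u2)"
begin

abbreviation D where "D \<equiv> Adom e lam \<sigma>"
abbreviation nD where "nD \<equiv> snorm e lam \<sigma>"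
abbreviation A where "A \<equiv> Apow e lam \<sigma>"
abbreviation B where "B \<equiv> Ainv \<sigma>"

lemmas B_D [simp] = Ainv_Adom[OF \<sigma>(1)]
lemmas A_B [simp] = Apow_Ainv[OF \<sigma>(1)]
lemmas B_A = Ainv_Apow[OF \<sigma>(1)]
lemmas B_linear = Ainv_linear[OF \<sigma>(1)]
lemmas nD_B = snorm_Ainv[OF \<sigma>(1)]

text \<open>The nonlinearity transported through the isometry \<open>B\<close>; it is globally
  L-Lipschitz on the ambient type.\<close>

definition Fh :: "'a \<Rightarrow> 'a" where "Fh x = F (B x)"

lemma Fh_lipschitz: "norm (Fh x - Fh y) \<le> L * norm (x - y)"
  using F_lipschitz[of "B x" "B y"] by (simp add: Fh_def B_linear[symmetric] nD_B)

lemma Fh_0: "Fh 0 = 0"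
  by (simp add: Fh_def B_linear F_0)

lemma Fh_measurable [measurable]: "Fh \<in> borel_measurable borel"
proof (rule borel_measurable_continuous_onI, rule continuous_on_sequentiallyI)
  fix x :: "nat \<Rightarrow> 'a" and l assume "x \<longlonglongrightarrow> l"
  then have "(\<lambda>n. L * norm (x n - l)) \<longlonglongrightarrow> 0"
    by (intro tendsto_mult_right_zero tendsto_norm_zero) (simp add: LIM_zero)
  then have "(\<lambda>n. Fh (x n) - Fh l) \<longlonglongrightarrow> 0"
    by (rule Lim_null_comparison[rotated]) (simp add: Fh_lipschitz)
  then show "(\<lambda>n. Fh (x n)) \<longlonglongrightarrow> Fh l" by (rule LIM_zero_cancel)
qed

text \<open>
  The random forcing in the variable \<open>v = exp (- zeta) A\<^sup>\<sigma> u\<close>, in which the scalar factor of the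
  evolution operator disappears; the Lipschitz constant is unchanged.
\<close>

definition h :: "path \<times> path \<Rightarrow> real \<Rightarrow> 'a \<Rightarrow> 'a" where
  "h \<omega> s x = exp (- (Zp \<omega> s + zeta \<omega> s)) *\<^sub>R Fh (exp (Zp \<omega> s + zeta \<omega> s) *\<^sub>R x)"

lemma h_measurable_pair: "(\<lambda>(\<omega>, s, x). h \<omega> s x) \<in> borel_measurable (Omega \<Otimes>\<^sub>M borel \<Otimes>\<^sub>M borel)"
  unfolding h_def split_beta' by measurable

lemma h_forcing:
  assumes "\<omega> \<in> Om"
  shows "forcing L (h \<omega>)"
  unfolding forcing_def
proof (intro conjI allI)
  have "(\<lambda>z. (\<omega>, z)) \<in> measurable (borel \<Otimes>\<^sub>M borel) (Omega \<Otimes>\<^sub>M borel \<Otimes>\<^sub>M borel)"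
    using assms by (intro measurable_Pair1') simp
  from measurable_compose[OF this h_measurable_pair]
  show "(\<lambda>(s, x). h \<omega> s x) \<in> borel_measurable (borel \<Otimes>\<^sub>M borel)"
    by (simp add: split_beta')
  fix s x y
  let ?c = "Zp \<omega> s + zeta \<omega> s"
  have "norm (h \<omega> s x - h \<omega> s y) = exp (- ?c) * norm (Fh (exp ?c *\<^sub>R x) - Fh (exp ?c *\<^sub>R y))"
    by (simp add: h_def scaleR_diff_right[symmetric] del: scaleR_diff_right)
  also have "\<dots> \<le> exp (- ?c) * (L * norm (exp ?c *\<^sub>R x - exp ?c *\<^sub>R y))"
    by (intro mult_left_mono Fh_lipschitz) simp
  also have "norm (exp ?c *\<^sub>R x - exp ?c *\<^sub>R y) = exp ?c * norm (x - y)"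
    by (simp add: scaleR_diff_right[symmetric] del: scaleR_diff_right)
  also have "exp (- ?c) * (L * (exp ?c * norm (x - y))) = L * norm (x - y)"
    by (simp add: mult_exp_exp mult.left_commute[of _ L] mult.assoc[symmetric])
  finally show "norm (h \<omega> s x - h \<omega> s y) \<le> L * norm (x - y)" .
qed (simp add: h_def Fh_0)

text \<open>\<open>zeta\<close> restarts at 0 after a shift. Seen from time \<tau>, the transformed
  variable is therefore \<open>exp (zeta \<omega> \<tau>)\<close> times the original one, and the
  forcing is conjugated by this factor.\<close>

lemma h_shift:
  assumes "\<omega> \<in> Om"
  shows "h (noise_shift \<tau> \<omega>) s x = exp (zeta \<omega> \<tau>) *\<^sub>R h \<omega> (\<tau> + s) (exp (- zeta \<omega> \<tau>) *\<^sub>R x)"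
  by (simp add: h_def Zp_shift zeta_shift[OF assms] mult_exp_exp algebra_simps)

lemma mild_shift:
  assumes \<omega>: "\<omega> \<in> Om" and v: "mild (h \<omega>) UNIV v"
  shows "mild (h (noise_shift \<tau> \<omega>)) I (\<lambda>s. exp (zeta \<omega> \<tau>) *\<^sub>R v (\<tau> + s))"
  unfolding mild_def
proof
  have cont: "continuous_on UNIV v" using v by (simp add: mild_def)
  show "continuous_on I (\<lambda>s. exp (zeta \<omega> \<tau>) *\<^sub>R v (\<tau> + s))"
    by (intro continuous_intros continuous_on_compose2[OF cont]) auto
  show "vocp (\<lambda>s. h (noise_shift \<tau> \<omega>) s (exp (zeta \<omega> \<tau>) *\<^sub>R v (\<tau> + s))) I (\<lambda>s. exp (zeta \<omega> \<tau>) *\<^sub>R v (\<tau> + s))"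
  proof (rule vocpI)
    fix r t k assume "r \<le> (t::real)"
    let ?z = "exp (zeta \<omega> \<tau>)"
    have hs: "h (noise_shift \<tau> \<omega>) s (?z *\<^sub>R v (\<tau> + s)) = ?z *\<^sub>R h \<omega> (\<tau> + s) (v (\<tau> + s))" for s
      by (simp add: h_shift[OF \<omega>] mult_exp_exp)
    have "(LBINT s:{\<tau> + r..\<tau> + t}. exp (- Lam k * (\<tau> + t - s)) * (h \<omega> s (v s) \<bullet> E k)) =
        (LINT s|lborel. indicator {\<tau> + r..\<tau> + t} (\<tau> + 1 * s) *\<^sub>R (exp (- Lam k * (\<tau> + t - (\<tau> + 1 * s))) * (h \<omega> (\<tau> + 1 * s) (v (\<tau> + 1 * s)) \<bullet> E k)))"
      unfolding set_lebesgue_integral_def by (subst lborel_integral_real_affine[of 1 _ \<tau>]) auto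
    also have "\<dots> = (LBINT s:{r..t}. exp (- Lam k * (t - s)) * (h \<omega> (\<tau> + s) (v (\<tau> + s)) \<bullet> E k))"
      unfolding set_lebesgue_integral_def by (intro Bochner_Integration.integral_cong) (auto simp: indicator_def)
    finally have int: "(LBINT s:{\<tau> + r..\<tau> + t}. exp (- Lam k * (\<tau> + t - s)) * (h \<omega> s (v s) \<bullet> E k)) =
        (LBINT s:{r..t}. exp (- Lam k * (t - s)) * (h \<omega> (\<tau> + s) (v (\<tau> + s)) \<bullet> E k))" .
    have "vocp (\<lambda>s. h \<omega> s (v s)) UNIV v" using v by (simp add: mild_def)
    from vocpD[OF this, of "\<tau> + r" "\<tau> + t" k] \<open>r \<le> t\<close>
    have "v (\<tau> + t) \<bullet> E k = exp (- Lam k * (t - r)) * (v (\<tau> + r) \<bullet> E k)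
       + Lam k powr \<sigma> * (LBINT s:{r..t}. exp (- Lam k * (t - s)) * (h \<omega> (\<tau> + s) (v (\<tau> + s)) \<bullet> E k))"
      unfolding int by simp
    moreover have "(LBINT s:{r..t}. exp (- Lam k * (t - s)) * (?z *\<^sub>R h \<omega> (\<tau> + s) (v (\<tau> + s)) \<bullet> E k)) =
       ?z * (LBINT s:{r..t}. exp (- Lam k * (t - s)) * (h \<omega> (\<tau> + s) (v (\<tau> + s)) \<bullet> E k))"
      by (subst set_integral_mult_right[symmetric]) (simp add: mult.left_commute)
    ultimately show "?z *\<^sub>R v (\<tau> + t) \<bullet> E k = exp (- Lam k * (t - r)) * (?z *\<^sub>R v (\<tau> + r) \<bullet> E k)
     + Lam k powr \<sigma> * (LBINT s:{r..t}. exp (- Lam k * (t - s)) * (h (noise_shift \<tau> \<omega>) s (?z *\<^sub>R v (\<tau> + s)) \<bullet> E k))"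
      unfolding hs by (simp add: distrib_left mult.left_commute)
  qed
qed

lemma expA_SQ: "0 \<le> r \<Longrightarrow> expA e lam r x = SQ 0 r x"
  by (simp add: expA_def SQ_def dg_def)

text \<open>Taking the coordinate along \<open>E k\<close> and multiplying by Lam k^\<sigma> exp (-
  zeta t) turns one variation of constants formula into the other. The integrals exist because a
  continuous path makes the forcing bounded on compact intervals.\<close>

lemma random_solution_iff:
  assumes \<omega>: "\<omega> \<in> Om" and I: "closed I" "is_interval I"
  shows "random_solution e lam \<sigma> F \<omega> I u \<longleftrightarrow>
    (\<forall>t\<in>I. u t \<in> D) \<and> mild (h \<omega>) I (\<lambda>t. exp (- zeta \<omega> t) *\<^sub>R A (u t))"
proof -
  define v where "v t = exp (- zeta \<omega> t) *\<^sub>R A (u t)" for t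
  have zc: "continuous_on I (zeta \<omega>)"
    by (rule continuous_on_subset[OF zeta_continuous[OF \<omega>]]) simp
  have "continuous_on I v \<longleftrightarrow> continuous_on I (\<lambda>t. A (u t))"
  proof
    assume "continuous_on I v"
    then have "continuous_on I (\<lambda>t. exp (zeta \<omega> t) *\<^sub>R v t)"
      by (intro continuous_intros zc)
    then show "continuous_on I (\<lambda>t. A (u t))"
      by (simp add: v_def mult_exp_exp)
  next
    assume "continuous_on I (\<lambda>t. A (u t))"
    then show "continuous_on I v"
      unfolding v_def by (intro continuous_intros zc)
  qed
  then have cont: "continuous_map (top_of_set I) (norm_topology D nD) u \<longleftrightarrow> (\<forall>t\<in>I. u t \<in> D) \<and> continuous_on I v"
    by (simp add: continuous_map_norm_topology[OF \<sigma>(1)])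
  show ?thesis
  proof (cases "(\<forall>t\<in>I. u t \<in> D) \<and> continuous_on I v")
    case True
    then have uD: "\<And>t. t \<in> I \<Longrightarrow> u t \<in> D" and vc: "continuous_on I v" by auto
    define q where "q s = h \<omega> s (indicator I s *\<^sub>R v s)" for s
    have q: "loc_bounded q"
      unfolding q_def[abs_def] by (rule mild_cut_loc_bounded[OF h_forcing[OF \<omega>] L_ge0 I(1) vc])
    note [measurable] = loc_bounded_measurable[OF q]
    define i where "i t s = exp (zint \<omega> s t) *\<^sub>R expA e lam (t - s) (Grand F (noise_shift s \<omega>) (u s))" for t s
    have i_eq: "indicator {\<tau>..t} s *\<^sub>R i t s = exp (zeta \<omega> t) *\<^sub>R (indicator {\<tau>..t} s *\<^sub>R SQ 0 (t - s) (q s))" if "\<tau> \<in> I" "t \<in> I" for \<tau> t s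
    proof (cases "s \<in> {\<tau>..t}")
      case True
      then have s: "s \<in> I" using mem_is_interval_1_I[OF I(2) that] by simp
      have "u s = B (exp (zeta \<omega> s) *\<^sub>R v s)"
        by (simp add: v_def mult_exp_exp B_A uD[OF s])
      then have "Grand F (noise_shift s \<omega>) (u s) = exp (- Zp \<omega> s) *\<^sub>R Fh (exp (Zp \<omega> s + zeta \<omega> s) *\<^sub>R v s)"
        by (simp add: Grand_def Zp_def[symmetric] Fh_def B_linear mult_exp_exp)
      also have "\<dots> = exp (zeta \<omega> s) *\<^sub>R q s"
        using s by (simp add: q_def h_def mult_exp_exp)
      finally show ?thesis
        using True by (simp add: i_def expA_SQ linear_scale[OF bounded_linear.linear[OF bounded_linear_SQ]] zint_eq[OF \<omega>] mult_exp_exp)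
    qed simp
    have int: "integrable lborel (\<lambda>s. indicator {\<tau>..t} s *\<^sub>R SQ 0 (t - s) (q s))" for \<tau> t
    proof -
      obtain C where C: "\<And>s. s \<in> {\<tau>..t} \<Longrightarrow> norm (q s) \<le> C"
        using q unfolding loc_bounded_def by metis
      show ?thesis
      proof (rule integrableI_bounded_set_indicator[where B = C])
        show "AE x in lborel. x \<in> {\<tau>..t} \<longrightarrow> norm (SQ 0 (t - x) (q x)) \<le> C"
        proof (intro AE_I2 impI)
          fix s assume "s \<in> {\<tau>..t}"
          then show "norm (SQ 0 (t - s) (q s)) \<le> C"
            using norm_SQ_le[of 0 0 "t - s" "q s"] C[of s] by simp
        qed
      qed (auto simp: emeasure_lborel_Icc_eq)
    qed
    have coord: "(LBINT s:{\<tau>..t}. i t s) \<bullet> E k = exp (zeta \<omega> t) * (LBINT s:{\<tau>..t}. exp (- Lam k * (t - s)) * (q s \<bullet> E k))"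
      if "\<tau> \<in> I" "t \<in> I" for \<tau> t k
    proof -
      have "(LBINT s:{\<tau>..t}. i t s) = exp (zeta \<omega> t) *\<^sub>R (LINT s|lborel. indicator {\<tau>..t} s *\<^sub>R SQ 0 (t - s) (q s))"
        by (simp only: set_lebesgue_integral_def i_eq[OF that] integral_scaleR_right)
      moreover have "(LINT s|lborel. indicator {\<tau>..t} s *\<^sub>R SQ 0 (t - s) (q s)) \<bullet> E k =
          (LINT s|lborel. (indicator {\<tau>..t} s *\<^sub>R SQ 0 (t - s) (q s)) \<bullet> E k)"
        using int by (intro integral_inner_left[symmetric])
      moreover have "(LINT s|lborel. (indicator {\<tau>..t} s *\<^sub>R SQ 0 (t - s) (q s)) \<bullet> E k) = (LBINT s:{\<tau>..t}. exp (- Lam k * (t - s)) * (q s \<bullet> E k))"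
        unfolding set_lebesgue_integral_def
        by (intro Bochner_Integration.integral_cong) (auto simp: inner_SQ indicator_def)
      ultimately show ?thesis by simp
    qed
    have eqv: "u t = exp (zint \<omega> \<tau> t) *\<^sub>R expA e lam (t - \<tau>) (u \<tau>) + (LBINT s:{\<tau>..t}. i t s) \<longleftrightarrow>
        (\<forall>k. v t \<bullet> E k = exp (- Lam k * (t - \<tau>)) * (v \<tau> \<bullet> E k) + Lam k powr \<sigma> * (LBINT s:{\<tau>..t}. exp (- Lam k * (t - s)) * (q s \<bullet> E k)))"
      (is "?l \<longleftrightarrow> (\<forall>k. ?r k)") if "\<tau> \<in> I" "t \<in> I" "\<tau> \<le> t" for \<tau> t
    proof -
      have "?l \<longleftrightarrow> (\<forall>k. u t \<bullet> E k = (exp (zint \<omega> \<tau> t) *\<^sub>R expA e lam (t - \<tau>) (u \<tau>) + (LBINT s:{\<tau>..t}. i t s)) \<bullet> E k)"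
        using coords_eqI by metis
      moreover have "u t \<bullet> E k = (exp (zint \<omega> \<tau> t) *\<^sub>R expA e lam (t - \<tau>) (u \<tau>) + (LBINT s:{\<tau>..t}. i t s)) \<bullet> E k \<longleftrightarrow> ?r k" for k
      proof -
        define X where "X = (LBINT s:{\<tau>..t}. exp (- Lam k * (t - s)) * (q s \<bullet> E k))"
        define y where "y = exp (- Lam k * (t - \<tau>))"
        have 1: "(exp (zint \<omega> \<tau> t) *\<^sub>R expA e lam (t - \<tau>) (u \<tau>) + (LBINT s:{\<tau>..t}. i t s)) \<bullet> E k =
            exp (zeta \<omega> t) * (exp (- zeta \<omega> \<tau>) * (y * (u \<tau> \<bullet> E k)) + X)"
          using that by (simp add: inner_add_left coord X_def y_def expA_SQ inner_SQ zint_eq[OF \<omega>] exp_diff exp_minus divide_inverse distrib_left)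
        have 2: "v t \<bullet> E k = exp (- zeta \<omega> t) * (Lam k powr \<sigma> * (u t \<bullet> E k))" "v \<tau> \<bullet> E k = exp (- zeta \<omega> \<tau>) * (Lam k powr \<sigma> * (u \<tau> \<bullet> E k))"
          using uD that by (simp_all add: v_def inner_Apow)
        \<comment> \<open>The conversion factor from u to v in mode k; being nonzero, it makes the
          two coordinate identities equivalent.\<close>
        define c where "c = Lam k powr \<sigma> * exp (- zeta \<omega> t)"
        have c: "c \<noteq> 0" using less_imp_neq[OF Lam_pos[of k]] by (simp add: c_def)
        define Y where "Y = exp (- zeta \<omega> \<tau>) * (y * (u \<tau> \<bullet> E k)) + X"
        have "exp (- zeta \<omega> t) * exp (zeta \<omega> t) = 1" by (simp add: mult_exp_exp)
        then have e1: "c * (exp (zeta \<omega> t) * Y) = Lam k powr \<sigma> * Y"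
          unfolding c_def by (metis mult.assoc mult.right_neutral)
        have e2: "?r k \<longleftrightarrow> c * (u t \<bullet> E k) = Lam k powr \<sigma> * Y"
          unfolding 2 X_def[symmetric] y_def[symmetric] c_def Y_def
          by (simp only: distrib_left mult_ac)
        show ?thesis unfolding 1 Y_def[symmetric] e2 e1[symmetric] using c by simp
      qed
      ultimately show ?thesis by blast
    qed
    have si: "set_integrable lborel {\<tau>..t} (i t)" if "\<tau> \<in> I" "t \<in> I" for \<tau> t
      unfolding set_integrable_def i_eq[OF that] by (intro integrable_scaleR_right int)
    have "random_solution e lam \<sigma> F \<omega> I u \<longleftrightarrow> vocp q I v"
      unfolding random_solution_def vocp_def cont i_def[symmetric] using True si eqv by blast
    also have "\<dots> \<longleftrightarrow> mild (h \<omega>) I v"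
      using vc by (simp add: mild_iff_cut[OF I(2)] q_def[abs_def])
    finally show ?thesis using True by (simp add: v_def[abs_def])
  next
    case False
    then show ?thesis
      unfolding random_solution_def cont by (auto simp: mild_def v_def[abs_def])
  qed
qed

lemma random_solution_of_mild:
  assumes "\<omega> \<in> Om" "closed I" "is_interval I" "mild (h \<omega>) I v"
  shows "random_solution e lam \<sigma> F \<omega> I (\<lambda>t. exp (zeta \<omega> t) *\<^sub>R B (v t))"
  using assms(4) by (simp add: random_solution_iff[OF assms(1-3)] Adom_scaleR mult_exp_exp)

text \<open>The definite description is resolved by this mild solution as a witness and by forward
  uniqueness on [0, t].\<close>

lemma u_flow_eq:
  assumes \<omega>: "\<omega> \<in> Om" and v: "mild (h \<omega>) {0..} v" and t: "0 \<le> t"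
  shows "u_flow e lam \<sigma> F t \<omega> (B (v 0)) = exp (zeta \<omega> t) *\<^sub>R B (v t)"
  unfolding u_flow_def
proof (rule the_equality)
  have "random_solution e lam \<sigma> F \<omega> {0..} (\<lambda>t. exp (zeta \<omega> t) *\<^sub>R B (v t))"
    by (rule random_solution_of_mild[OF \<omega> closed_atLeast is_interval_ci v])
  then show "\<exists>u. random_solution e lam \<sigma> F \<omega> {0..} u \<and> u 0 = B (v 0) \<and> u t = exp (zeta \<omega> t) *\<^sub>R B (v t)"
    by (intro exI[of _ "\<lambda>t. exp (zeta \<omega> t) *\<^sub>R B (v t)"]) (simp add: zeta_0[OF \<omega>])
next
  fix y assume "\<exists>u. random_solution e lam \<sigma> F \<omega> {0..} u \<and> u 0 = B (v 0) \<and> u t = y"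
  then obtain u where u: "random_solution e lam \<sigma> F \<omega> {0..} u" "u 0 = B (v 0)" "u t = y" by blast
  let ?w = "\<lambda>t. exp (- zeta \<omega> t) *\<^sub>R A (u t)"
  have uD: "u t \<in> D" and w: "mild (h \<omega>) {0..} ?w"
    using u(1) t by (auto simp: random_solution_iff[OF \<omega> closed_atLeast is_interval_ci])
  have "?w t = v t"
    by (rule forward_unique[OF h_forcing[OF \<omega>] L_ge0 mild_subset[OF w] mild_subset[OF v], of t])
       (use t u(2) zeta_0[OF \<omega>] in auto)
  then have "A (u t) = exp (zeta \<omega> t) *\<^sub>R v t"
    by (metis (no_types) exp_not_eq_zero exp_minus scaleR_scaleR right_inverse scaleR_one)
  then show "y = exp (zeta \<omega> t) *\<^sub>R B (v t)"
    using B_A[OF uD] u(3) by (simp add: B_linear)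
qed

section \<open>The slow manifold in the transformed variable\<close>

abbreviation Ms where "Ms \<equiv> slow_manifold e lam \<sigma> F \<beta>"

text \<open>The random weight of the backward space cancels the substitution: applied to u it gives
  exp (\<beta> t) times the norm of v. Membership thus becomes a deterministic growth condition on
  v.\<close>

lemma Ms_iff:
  assumes \<omega>: "\<omega> \<in> Om"
  shows "x \<in> Ms \<omega> \<longleftrightarrow> x \<in> D \<and>
    (\<exists>v C. mild (h \<omega>) {..0} v \<and> (\<forall>t\<le>0. norm (v t) \<le> C * exp (- \<beta> * t)) \<and> v 0 = A x)" (is "?l \<longleftrightarrow> ?r")
proof
  assume ?l
  then obtain u where x: "x \<in> D" and u: "u \<in> backward_space e lam \<sigma> \<beta> \<omega>"
    "random_solution e lam \<sigma> F \<omega> {..0} u" "u 0 = x"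
    by (auto simp: slow_manifold_def)
  let ?v = "\<lambda>t. exp (- zeta \<omega> t) *\<^sub>R A (u t)"
  obtain C where C: "\<And>t. t \<le> 0 \<Longrightarrow> exp (\<beta> * t - zint \<omega> 0 t) * nD (u t) \<le> C"
    using u(1) by (auto simp: backward_space_def bdd_above_def)
  have "norm (?v t) \<le> C * exp (- \<beta> * t)" if "t \<le> 0" for t
    using mult_right_mono[OF C[OF that], of "exp (- \<beta> * t)"]
    by (simp add: snorm_def zeta_def exp_diff exp_minus field_simps)
  moreover have "mild (h \<omega>) {..0} ?v"
    using u(2) by (simp add: random_solution_iff[OF \<omega> closed_atMost is_interval_ic])
  moreover have "?v 0 = A x" using u(3) zeta_0[OF \<omega>] by simp
  ultimately show ?r using x by blast
next
  assume ?r
  then obtain v C where x: "x \<in> D" and v: "mild (h \<omega>) {..0} v" "\<And>t. t \<le> 0 \<Longrightarrow> norm (v t) \<le> C * exp (- \<beta> * t)" "v 0 = A x"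
    by blast
  let ?u = "\<lambda>t. exp (zeta \<omega> t) *\<^sub>R B (v t)"
  have s: "random_solution e lam \<sigma> F \<omega> {..0} ?u"
    by (rule random_solution_of_mild[OF \<omega> closed_atMost is_interval_ic v(1)])
  have "exp (\<beta> * t - zint \<omega> 0 t) * nD (?u t) \<le> C" if "t \<le> 0" for t
  proof -
    have "exp (\<beta> * t - zint \<omega> 0 t) * nD (?u t) = exp (\<beta> * t) * norm (v t)"
      by (simp add: snorm_scaleR nD_B zeta_def exp_diff)
    also have "\<dots> \<le> exp (\<beta> * t) * (C * exp (- \<beta> * t))"
      by (intro mult_left_mono v(2) that) simp
    also have "\<dots> = C * (exp (\<beta> * t) * exp (- \<beta> * t))" by (simp only: mult.left_commute)
    also have "\<dots> = C" by (simp add: mult_exp_exp)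
    finally show ?thesis .
  qed
  then have "bdd_above ((\<lambda>t. exp (\<beta> * t - zint \<omega> 0 t) * nD (?u t)) ` {..0})"
    by (intro bdd_aboveI2) simp
  moreover have "continuous_map (top_of_set {..0}) (norm_topology D nD) ?u"
    using s unfolding random_solution_def by (rule conjunct1)
  ultimately have "?u \<in> backward_space e lam \<sigma> \<beta> \<omega>"
    unfolding backward_space_def by (intro CollectI conjI)
  moreover have "?u 0 = x" using v(3) zeta_0[OF \<omega>] B_A[OF x] by simp
  ultimately show ?l using s x unfolding slow_manifold_def by blast
qed

text \<open>Seen from time t, the history consists of the old past, which satisfies the growth
  bound, and the stretch [0, t], on which w is bounded by compactness. There the weight exp (-
  \<beta> s) with s <= 0 is at least 1, because \<beta> > 0.\<close>

lemma Ms_shiftI: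
  assumes \<omega>: "\<omega> \<in> Om" and w: "mild (h \<omega>) UNIV w" and C: "\<And>t. t \<le> 0 \<Longrightarrow> norm (w t) \<le> C * exp (- \<beta> * t)" and t: "0 \<le> t"
  shows "exp (zeta \<omega> t) *\<^sub>R B (w t) \<in> Ms (noise_shift t \<omega>)"
proof -
  obtain M where M: "\<And>s. s \<in> {0..t} \<Longrightarrow> norm (w s) \<le> M"
    using loc_bounded_continuous_on[of w] w unfolding mild_def loc_bounded_def by metis
  have C0: "0 \<le> C" using order_trans[OF norm_ge_zero C[of 0]] by simp
  have b: "0 < \<beta>" using \<beta>(1) Lam_pos[of "N - 1"] by linarith
  show ?thesis
    unfolding Ms_iff[OF Om_shift[OF \<omega>]]
  proof (intro conjI exI allI impI)
    show "exp (zeta \<omega> t) *\<^sub>R B (w t) \<in> D" by (simp add: Adom_scaleR)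
    show "mild (h (noise_shift t \<omega>)) {..0} (\<lambda>s. exp (zeta \<omega> t) *\<^sub>R w (t + s))"
      by (rule mild_shift[OF \<omega> w])
    show "exp (zeta \<omega> t) *\<^sub>R w (t + 0) = A (exp (zeta \<omega> t) *\<^sub>R B (w t))"
      by (simp add: Adom_scaleR)
    fix s :: real assume s: "s \<le> 0"
    have "norm (w (t + s)) \<le> (\<bar>M\<bar> + C) * exp (- \<beta> * s)"
    proof (cases "t + s \<le> 0")
      case True
      have "norm (w (t + s)) \<le> C * exp (- \<beta> * (t + s))" by (rule C[OF True])
      also have "\<dots> \<le> (\<bar>M\<bar> + C) * exp (- \<beta> * s)"
        using C0 b t by (intro mult_mono) auto
      finally show ?thesis .
    next
      case False
      then have "norm (w (t + s)) \<le> (\<bar>M\<bar> + C) * 1" using M[of "t + s"] s C0 by simp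
      also have "\<dots> \<le> (\<bar>M\<bar> + C) * exp (- \<beta> * s)"
        using C0 b s by (intro mult_left_mono) (auto simp: mult_nonneg_nonpos)
      finally show ?thesis .
    qed
    then show "norm (exp (zeta \<omega> t) *\<^sub>R w (t + s)) \<le> exp (zeta \<omega> t) * (\<bar>M\<bar> + C) * exp (- \<beta> * s)"
      by (simp add: mult.assoc)
  qed
qed

text \<open>The backward solution through x and the forward solution from x are glued at time 0 into
  one solution on the whole line.\<close>

lemma Ms_invariant:
  assumes \<omega>: "\<omega> \<in> Om" and t: "0 \<le> t" and x: "x \<in> Ms \<omega>"
  shows "u_flow e lam \<sigma> F t \<omega> x \<in> Ms (noise_shift t \<omega>)"
proof -
  obtain v C where xD: "x \<in> D" and v: "mild (h \<omega>) {..0} v" "\<And>t. t \<le> 0 \<Longrightarrow> norm (v t) \<le> C * exp (- \<beta> * t)" "v 0 = A x"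
    using x unfolding Ms_iff[OF \<omega>] by blast
  obtain w where w: "mild (h \<omega>) {0..} w" "w 0 = A x"
    using forward_exists[OF h_forcing[OF \<omega>] L_ge0] .
  have g: "mild (h \<omega>) UNIV (\<lambda>t. if t \<le> 0 then v t else w t)"
    by (rule mild_glue[OF h_forcing[OF \<omega>] L_ge0 v(1) w(1)]) (simp add: v w)
  have "exp (zeta \<omega> t) *\<^sub>R B (if t \<le> 0 then v t else w t) \<in> Ms (noise_shift t \<omega>)"
    by (rule Ms_shiftI[OF \<omega> g _ t]) (use v(2) in auto)
  moreover have "(if t \<le> 0 then v t else w t) = w t" using t v(3) w(2) by auto
  ultimately show ?thesis
    using u_flow_eq[OF \<omega> w(1) t] w(2) B_A[OF xD] by simp
qed

lemma Ms_tracking: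
  assumes \<omega>: "\<omega> \<in> Om" and x: "x \<in> D" and t: "0 \<le> t"
  obtains y where "y \<in> Ms (noise_shift t \<omega>)"
    "nD (u_flow e lam \<sigma> F t \<omega> x - y) \<le> nD x / (1 - L * kap_int N \<beta>) * exp (zeta \<omega> t - \<beta> * t)"
proof -
  obtain u where u: "mild (h \<omega>) {0..} u" "u 0 = A x"
    using forward_exists[OF h_forcing[OF \<omega>] L_ge0] .
  obtain w C where w: "mild (h \<omega>) UNIV w" "\<And>t. t \<le> 0 \<Longrightarrow> norm (w t) \<le> C * exp (- \<beta> * t)"
    and d: "\<And>t. 0 \<le> t \<Longrightarrow> norm (w t - u t) \<le> norm (u 0) / (1 - L * kap_int N \<beta>) * exp (- \<beta> * t)"
    using tracking[OF h_forcing[OF \<omega>] u(1)] by metis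
  show ?thesis
  proof (rule that[OF Ms_shiftI[OF \<omega> w t]])
    have "u_flow e lam \<sigma> F t \<omega> x = exp (zeta \<omega> t) *\<^sub>R B (u t)"
      using u_flow_eq[OF \<omega> u(1) t] u(2) B_A[OF x] by simp
    then have "nD (u_flow e lam \<sigma> F t \<omega> x - exp (zeta \<omega> t) *\<^sub>R B (w t)) = exp (zeta \<omega> t) * norm (u t - w t)"
      by (simp add: scaleR_diff_right[symmetric] B_linear[symmetric] snorm_scaleR nD_B del: scaleR_diff_right)
    also have "\<dots> \<le> exp (zeta \<omega> t) * (norm (u 0) / (1 - L * kap_int N \<beta>) * exp (- \<beta> * t))"
      using d[OF t] by (intro mult_left_mono) (auto simp: norm_minus_commute)
    finally show "nD (u_flow e lam \<sigma> F t \<omega> x - exp (zeta \<omega> t) *\<^sub>R B (w t)) \<le> nD x / (1 - L * kap_int N \<beta>) * exp (zeta \<omega> t - \<beta> * t)"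
      by (simp add: u(2) snorm_def exp_diff exp_minus divide_inverse mult_ac)
  qed
qed

end

section \<open>The random inertial manifolds\<close>

lemma norm_lipschitz_continuous:
  fixes g :: "'a::real_normed_vector \<Rightarrow> 'b::real_normed_vector"
  assumes "\<And>x y. norm (g x - g y) \<le> C * norm (x - y)"
  shows "continuous_on S g"
proof (rule continuous_on_sequentiallyI)
  fix x :: "nat \<Rightarrow> 'a" and l assume "x \<longlonglongrightarrow> l"
  then have "(\<lambda>n. C * norm (x n - l)) \<longlonglongrightarrow> 0"
    by (intro tendsto_mult_right_zero tendsto_norm_zero) (simp add: LIM_zero)
  then have "(\<lambda>n. g (x n) - g l) \<longlonglongrightarrow> 0"
    by (rule Lim_null_comparison[rotated]) (simp add: assms)
  then show "(\<lambda>n. g (x n)) \<longlonglongrightarrow> g l" by (rule LIM_zero_cancel)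
qed

context marcus
begin

abbreviation PD where "PD \<equiv> projP e N ` D"
abbreviation QD where "QD \<equiv> projQ e N ` D"

lemma projP_D: "x \<in> D \<Longrightarrow> projP e N x \<in> D" and A_projP: "x \<in> D \<Longrightarrow> A (projP e N x) = SP N 0 (A x)"
proof -
  assume x: "x \<in> D"
  have "Lam k powr \<sigma> * (projP e N x \<bullet> E k) = SP N 0 (A x) \<bullet> E k" for k
    by (simp add: inner_projP inner_SP inner_Apow[OF x])
  from AdomI[OF this] show "projP e N x \<in> D" "A (projP e N x) = SP N 0 (A x)" by auto
qed

lemma projQ_D: "x \<in> D \<Longrightarrow> projQ e N x \<in> D" and A_projQ: "x \<in> D \<Longrightarrow> A (projQ e N x) = A x - SP N 0 (A x)"
  by (simp_all add: projQ_def Adom_diff projP_D A_projP)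

lemma SP_linear: "SP N t (x + y) = SP N t x + SP N t y" "SP N t (x - y) = SP N t x - SP N t y"
    "SP N t (c *\<^sub>R x) = c *\<^sub>R SP N t x" "SP N t 0 = 0"
  using bounded_linear.linear[OF bounded_linear_SP]
  by (auto simp: linear_add linear_diff linear_scale linear_0)

lemma PD_iff: "\<xi> \<in> PD \<longleftrightarrow> \<xi> \<in> D \<and> SP N 0 (A \<xi>) = A \<xi>"
proof
  assume "\<xi> \<in> D \<and> SP N 0 (A \<xi>) = A \<xi>"
  then have "\<xi> = projP e N \<xi>" "\<xi> \<in> D"
    using Apow_inject[of \<xi> \<sigma> "projP e N \<xi>"] by (auto simp: projP_D A_projP)
  then show "\<xi> \<in> PD" by blast
qed (auto simp: projP_D A_projP SP_SP_0)

lemma QD_iff: "\<eta> \<in> QD \<longleftrightarrow> \<eta> \<in> D \<and> SP N 0 (A \<eta>) = 0"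
proof
  assume "\<eta> \<in> D \<and> SP N 0 (A \<eta>) = 0"
  then have "\<eta> = projQ e N \<eta>" "\<eta> \<in> D"
    using Apow_inject[of \<eta> \<sigma> "projQ e N \<eta>"] by (auto simp: projQ_D A_projQ)
  then show "\<eta> \<in> QD" by blast
qed (auto simp: projQ_D A_projQ SP_SP_0 SP_linear)

lemma PD_0: "0 \<in> PD"
  by (simp add: PD_iff Adom_0 Apow_0 SP_linear)

lemma QD_0: "0 \<in> QD"
  by (simp add: QD_iff Adom_0 Apow_0 SP_linear)

lemma PD_add: "x \<in> PD \<Longrightarrow> y \<in> PD \<Longrightarrow> x + y \<in> PD"
  unfolding PD_iff by (simp add: Adom_add SP_linear)

lemma PD_scaleR: "\<xi> \<in> PD \<Longrightarrow> c *\<^sub>R \<xi> \<in> PD"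
  unfolding PD_iff by (simp add: Adom_scaleR SP_linear)

lemma QD_add: "x \<in> QD \<Longrightarrow> y \<in> QD \<Longrightarrow> x + y \<in> QD"
  unfolding QD_iff by (simp add: Adom_add SP_linear)

lemma QD_scaleR: "\<xi> \<in> QD \<Longrightarrow> c *\<^sub>R \<xi> \<in> QD"
  unfolding QD_iff by (simp add: Adom_scaleR SP_linear)

lemma PD_D: "\<xi> \<in> PD \<Longrightarrow> \<xi> \<in> D" and QD_D: "\<eta> \<in> QD \<Longrightarrow> \<eta> \<in> D"
  by (simp_all add: PD_iff QD_iff)

lemma B_SP_PD: "B (SP N 0 x) \<in> PD"
  by (simp add: PD_iff SP_SP_0)

lemma splitting: "finite_dim_splitting D PD QD"
  unfolding finite_dim_splitting_def
proof (intro conjI exI)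
  show "finite (E ` {..<N})" by simp
  have "subspace PD"
    unfolding subspace_def using PD_0 PD_add PD_scaleR by blast
  moreover have "E ` {..<N} \<subseteq> PD"
  proof clarsimp
    fix k assume k: "k < N"
    have "Lam j powr \<sigma> * (E k \<bullet> E j) = (Lam k powr \<sigma> *\<^sub>R E k) \<bullet> E j" for j
      by (simp add: inner_E)
    from AdomI[OF this] have "E k \<in> D" "A (E k) = Lam k powr \<sigma> *\<^sub>R E k" by auto
    moreover have "SP N 0 (Lam k powr \<sigma> *\<^sub>R E k) = Lam k powr \<sigma> *\<^sub>R E k"
      by (rule coords_eqI) (use k in \<open>auto simp: inner_SP inner_E\<close>)
    ultimately show "E k \<in> PD" by (simp add: PD_iff)
  qed
  ultimately have "span (E ` {..<N}) \<subseteq> PD" by (rule span_minimal[rotated])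
  moreover have "PD \<subseteq> span (E ` {..<N})"
  proof
    fix \<xi> assume "\<xi> \<in> PD"
    then obtain x where "\<xi> = projP e N x" by blast
    also have "projP e N x = (\<Sum>j<N. (x \<bullet> E j) *\<^sub>R E j)"
      unfolding projP_def by (rule sum.reindex_bij_witness[of _ Suc "\<lambda>j. j - 1"]) auto
    also have "\<dots> \<in> span (E ` {..<N})"
      by (intro span_sum span_scale span_base) auto
    finally show "\<xi> \<in> span (E ` {..<N})" .
  qed
  ultimately show "PD = span (E ` {..<N})" by blast
  show "subspace QD"
    unfolding subspace_def using QD_0 QD_add QD_scaleR by blast
  show "PD \<inter> QD = {0}"
  proof
    show "PD \<inter> QD \<subseteq> {0}"
    proof
      fix x assume x: "x \<in> PD \<inter> QD"
      then have "x \<in> PD" "x \<in> QD" by blast+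
      then have "x \<in> D" "A x = A 0" unfolding PD_iff QD_iff Apow_0 by auto
      then show "x \<in> {0}" using Apow_inject[OF _ Adom_0] by simp
    qed
    show "{0} \<subseteq> PD \<inter> QD" using PD_0 QD_0 by blast
  qed
  show "D = {x + y |x y. x \<in> PD \<and> y \<in> QD}"
  proof
    show "D \<subseteq> {x + y |x y. x \<in> PD \<and> y \<in> QD}"
    proof
      fix x assume "x \<in> D"
      then have "projP e N x \<in> PD" "projQ e N x \<in> QD" by blast+
      moreover have "x = projP e N x + projQ e N x" by (simp add: projQ_def)
      ultimately
      show "x \<in> {x + y |x y. x \<in> PD \<and> y \<in> QD}" by blast
    qed
    show "{x + y |x y. x \<in> PD \<and> y \<in> QD} \<subseteq> D"
      using PD_D QD_D Adom_add(1) by blast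
  qed
qed

section \<open>Graphs over the first N modes: closedness, measurability, smoothness\<close>

definition graph :: "('a \<Rightarrow> 'a) \<Rightarrow> 'a set" where
  "graph m = {\<xi> + m \<xi> | \<xi>. \<xi> \<in> PD}"

text \<open>Graph maps are handled through their conjugates \<open>g = A\<^sup>\<sigma> m A\<^bsup>-\<sigma>\<^esup>\<close> on the whole space.\<close>

lemma graph_B_iff:
  assumes g: "\<And>x. SP N 0 (g x) = 0"
  shows "B x \<in> graph (\<lambda>\<xi>. B (g (A \<xi>))) \<longleftrightarrow> x - SP N 0 x = g (SP N 0 x)"
proof
  assume "B x \<in> graph (\<lambda>\<xi>. B (g (A \<xi>)))"
  then obtain \<xi> where \<xi>: "\<xi> \<in> PD" "B x = \<xi> + B (g (A \<xi>))" unfolding graph_def by blast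
  have "x = A (B x)" by simp
  also have "\<dots> = A \<xi> + g (A \<xi>)"
    unfolding \<xi>(2) using PD_D[OF \<xi>(1)] by (simp add: Adom_add)
  finally have x: "x = A \<xi> + g (A \<xi>)" .
  moreover have "SP N 0 (A \<xi>) = A \<xi>" using \<xi>(1) by (simp add: PD_iff)
  ultimately show "x - SP N 0 x = g (SP N 0 x)"
    by (simp add: SP_linear g)
next
  assume *: "x - SP N 0 x = g (SP N 0 x)"
  have "B x = B (SP N 0 x) + B (x - SP N 0 x)" by (simp add: B_linear)
  also have "B (x - SP N 0 x) = B (g (A (B (SP N 0 x))))" unfolding * by simp
  finally show "B x \<in> graph (\<lambda>\<xi>. B (g (A \<xi>)))"
    unfolding graph_def using B_SP_PD by blast
qed

lemma graph_D: "graph (\<lambda>\<xi>. B (g (A \<xi>))) \<subseteq> D"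
  unfolding graph_def using PD_D Adom_add(1) B_D by blast

lemma graph_lipschitz_map:
  assumes g: "\<And>x. SP N 0 (g x) = 0" and lip: "\<And>x y. norm (g x - g y) \<le> C * norm (x - y)"
  shows "lipschitz_map PD nD QD nD (\<lambda>\<xi>. B (g (A \<xi>)))"
  unfolding lipschitz_map_def
proof (intro conjI exI ballI)
  show "(\<lambda>\<xi>. B (g (A \<xi>))) \<in> PD \<rightarrow> QD"
    using g by (auto simp: QD_iff simp del: image_iff)
  show "0 \<le> max C 0" by simp
  fix x y assume xy: "x \<in> PD" "y \<in> PD"
  have "nD (B (g (A x)) - B (g (A y))) = norm (g (A x) - g (A y))"
    by (simp add: B_linear[symmetric] nD_B)
  also have "\<dots> \<le> max C 0 * norm (A x - A y)"
    using lip[of "A x" "A y"] mult_right_mono[of C "max C 0" "norm (A x - A y)"] by simp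
  also have "norm (A x - A y) = nD (x - y)"
    using PD_D[OF xy(1)] PD_D[OF xy(2)] by (simp add: snorm_def Adom_diff)
  finally show "nD (B (g (A x)) - B (g (A y))) \<le> max C 0 * nD (x - y)" .
qed

text \<open>Pulled back by \<open>B\<close>, the graph is the solution set of a continuous equation,
  hence closed. The distance to it is an infimum over all d of a continuous function of d, so a
  countable dense set suffices, and a countable infimum is measurable.\<close>

lemma graph_random_set:
  assumes g: "\<And>\<omega> x. \<omega> \<in> Om \<Longrightarrow> SP N 0 (g \<omega> x) = 0"
    and lip: "\<And>\<omega> x y. \<omega> \<in> Om \<Longrightarrow> norm (g \<omega> x - g \<omega> y) \<le> C \<omega> * norm (x - y)"
    and meas: "(\<lambda>(\<omega>, x). g \<omega> x) \<in> borel_measurable (Omega \<Otimes>\<^sub>M borel)"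
    and M: "\<And>\<omega>. \<omega> \<in> Om \<Longrightarrow> M \<omega> = graph (\<lambda>\<xi>. B (g \<omega> (A \<xi>)))"
  shows "random_set Omega D nD M"
  unfolding random_set_def space_Omega
proof (intro conjI ballI)
  fix \<omega> assume \<omega>: "\<omega> \<in> Om"
  have cont: "continuous_on UNIV (g \<omega>)"
    by (rule norm_lipschitz_continuous[OF lip[OF \<omega>]])
  note SPc = linear_continuous_on[OF bounded_linear_SP]
  show "M \<omega> \<noteq> {}" using PD_0 M[OF \<omega>] by (auto simp: graph_def)
  have "B -` M \<omega> = {x. x - SP N 0 x = g \<omega> (SP N 0 x)}"
    using graph_B_iff[of "g \<omega>", OF g[OF \<omega>]] M[OF \<omega>] by auto
  moreover have "closed {x. x - SP N 0 x = g \<omega> (SP N 0 x)}"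
    by (intro closed_Collect_eq continuous_intros SPc continuous_on_compose2[OF cont SPc]) auto
  ultimately show "closedin (norm_topology D nD) (M \<omega>)"
    using graph_D M[OF \<omega>] by (simp add: closedin_norm_topology[OF \<sigma>(1)])
next
  fix x assume x: "x \<in> D"
  obtain X :: "'a set" where X: "countable X" "\<And>S. open S \<Longrightarrow> S \<noteq> {} \<Longrightarrow> \<exists>d\<in>X. d \<in> S"
    using countable_dense_setE by metis
  have Xc: "closure X = UNIV"
  proof -
    have "x \<in> closure X" for x
      unfolding closure_iff_nhds_not_empty using X(2) by blast
    then show ?thesis by blast
  qed
  define r where "r \<omega> d = norm (A x - SP N 0 d - g \<omega> (SP N 0 d))" for \<omega> d
  have eq: "(INF y\<in>M \<omega>. nD (x - y)) = (INF d\<in>X. r \<omega> d)" if \<omega>: "\<omega> \<in> Om" for \<omega>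
  proof -
    have cont: "continuous_on UNIV (g \<omega>)"
      by (rule norm_lipschitz_continuous[OF lip[OF \<omega>]])
    note SPc = linear_continuous_on[OF bounded_linear_SP]
    have rc: "continuous_on UNIV (r \<omega>)"
      unfolding r_def by (intro continuous_intros SPc continuous_on_compose2[OF cont SPc]) auto
    have bd: "bdd_below (r \<omega> ` S)" for S by (rule bdd_belowI2[of _ 0]) (simp add: r_def)
    have nD: "nD (x - (\<xi> + B (g \<omega> (A \<xi>)))) = r \<omega> (A \<xi>)" if "\<xi> \<in> PD" for \<xi>
    proof -
      have "\<xi> \<in> D" "SP N 0 (A \<xi>) = A \<xi>" using that by (simp_all add: PD_iff)
      then show ?thesis using x by (simp add: snorm_def Adom_diff Adom_add r_def diff_diff_eq)
    qed
    \<comment> \<open>Because r depends on d only through its projection, the parameter may run over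
      the whole space instead of the finite-dimensional one.\<close>
    have "(\<lambda>y. nD (x - y)) ` M \<omega> = range (r \<omega>)"
    proof
      show "(\<lambda>y. nD (x - y)) ` M \<omega> \<subseteq> range (r \<omega>)"
        unfolding M[OF \<omega>] graph_def using nD by auto
      show "range (r \<omega>) \<subseteq> (\<lambda>y. nD (x - y)) ` M \<omega>"
      proof
        fix z assume "z \<in> range (r \<omega>)"
        then obtain d where z: "z = r \<omega> d" by blast
        have "z = r \<omega> (A (B (SP N 0 d)))" by (simp add: z r_def SP_SP_0)
        also have "\<dots> = nD (x - (B (SP N 0 d) + B (g \<omega> (A (B (SP N 0 d))))))"
          using nD[OF B_SP_PD] by simp
        finally show "z \<in> (\<lambda>y. nD (x - y)) ` M \<omega>"
          unfolding M[OF \<omega>] graph_def using B_SP_PD[of d] by blast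
      qed
    qed
    then have "(INF y\<in>M \<omega>. nD (x - y)) = (INF d. r \<omega> d)" by simp
    also have "\<dots> = (INF d\<in>X. r \<omega> d)"
    proof (rule antisym)
      have "X \<noteq> {}" using Xc by auto
      then show "(INF d. r \<omega> d) \<le> (INF d\<in>X. r \<omega> d)"
        by (intro cINF_superset_mono bd) auto
      show "(INF d\<in>X. r \<omega> d) \<le> (INF d. r \<omega> d)"
      proof (rule cINF_greatest)
        fix d
        have "closed {d. (INF d\<in>X. r \<omega> d) \<le> r \<omega> d}"
          by (intro closed_Collect_le continuous_on_const rc)
        moreover have "X \<subseteq> {d. (INF d\<in>X. r \<omega> d) \<le> r \<omega> d}"
          by (auto intro: cINF_lower bd)
        ultimately have "closure X \<subseteq> {d. (INF d\<in>X. r \<omega> d) \<le> r \<omega> d}"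
          by (rule closure_minimal[rotated])
        then show "(INF d\<in>X. r \<omega> d) \<le> r \<omega> d" unfolding Xc by blast
      qed simp
    qed
    finally show ?thesis .
  qed
  have gm: "(\<lambda>\<omega>. g \<omega> y) \<in> borel_measurable Omega" for y
    using measurable_compose[OF measurable_Pair2' meas, of y] by simp
  have "(\<lambda>\<omega>. INF d\<in>X. r \<omega> d) \<in> borel_measurable Omega"
  proof (rule borel_measurable_cINF[OF X(1)])
    fix d show "(\<lambda>\<omega>. r \<omega> d) \<in> borel_measurable Omega"
      unfolding r_def using gm by measurable
  qed (auto simp: r_def intro!: bdd_belowI2[of _ 0])
  then show "(\<lambda>\<omega>. INF y\<in>M \<omega>. nD (x - y)) \<in> borel_measurable Omega"
    by (rule measurable_cong[THEN iffD1, rotated]) (simp add: eq)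
qed

lemma graph_C1_map:
  assumes g: "\<And>x. SP N 0 (g x) = 0" and Dg: "\<And>x. (g has_derivative Dg x) (at x)"
    and cont: "\<And>x \<epsilon>. 0 < \<epsilon> \<Longrightarrow> \<exists>\<delta>>0. \<forall>y. norm (y - x) < \<delta> \<longrightarrow> (\<forall>h. norm (Dg y h - Dg x h) \<le> \<epsilon> * norm h)"
  shows "C1_map PD nD QD nD (\<lambda>\<xi>. B (g (A \<xi>)))"
  unfolding C1_map_def
proof (intro conjI exI ballI)
  show "(\<lambda>\<xi>. B (g (A \<xi>))) \<in> PD \<rightarrow> QD"
    using g by (auto simp: QD_iff simp del: image_iff)
  \<comment> \<open>The composition of the projector with g is constantly 0, so its derivative
    vanishes by uniqueness of derivatives.\<close>
  have SPD: "SP N 0 (Dg x y) = 0" for x y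
  proof -
    have "((\<lambda>x. SP N 0 (g x)) has_derivative (\<lambda>y. SP N 0 (Dg x y))) (at x)"
      by (rule bounded_linear.has_derivative[OF bounded_linear_SP Dg])
    moreover have "((\<lambda>x. SP N 0 (g x)) has_derivative (\<lambda>y. 0)) (at x)"
      unfolding g by (rule has_derivative_const)
    ultimately show ?thesis by (metis has_derivative_unique)
  qed
  have lin: "bounded_linear (Dg x)" for x using Dg by (rule has_derivative_bounded_linear)
  note lin' = linear_add[OF bounded_linear.linear[OF lin]] linear_scale[OF bounded_linear.linear[OF lin]]
  fix x assume "x \<in> PD"
  then have x: "x \<in> D" by (rule PD_D)
  show "bounded_linear_map PD nD QD nD (\<lambda>\<eta>. B (Dg (A x) (A \<eta>)))"
    unfolding bounded_linear_map_def
  proof (intro conjI ballI allI)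
    show "(\<lambda>\<eta>. B (Dg (A x) (A \<eta>))) \<in> PD \<rightarrow> QD"
      by (auto simp: QD_iff SPD simp del: image_iff)
    obtain K where K: "\<And>y. norm (Dg (A x) y) \<le> norm y * K"
      using bounded_linear.bounded[OF lin] by blast
    show "\<exists>C. \<forall>y\<in>PD. nD (B (Dg (A x) (A y))) \<le> C * nD y"
      using K by (intro exI[of _ K]) (simp add: nD_B mult.commute snorm_def del: image_iff)
  qed (auto dest!: PD_D simp: Adom_add Adom_scaleR lin' B_linear simp del: image_iff)
  show "\<forall>\<epsilon>>0. \<exists>\<delta>>0. \<forall>h\<in>PD. nD h < \<delta> \<longrightarrow> nD (B (g (A (x + h))) - B (g (A x)) - B (Dg (A x) (A h))) \<le> \<epsilon> * nD h"
  proof (intro allI impI)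
    fix \<epsilon> :: real assume "0 < \<epsilon>"
    with Dg[of "A x"] obtain d where d: "0 < d"
      "\<And>y. norm (y - A x) < d \<Longrightarrow> norm (g y - g (A x) - Dg (A x) (y - A x)) \<le> \<epsilon> * norm (y - A x)"
      unfolding has_derivative_at_alt by blast
    show "\<exists>\<delta>>0. \<forall>h\<in>PD. nD h < \<delta> \<longrightarrow> nD (B (g (A (x + h))) - B (g (A x)) - B (Dg (A x) (A h))) \<le> \<epsilon> * nD h"
    proof (intro exI[of _ d] conjI ballI impI d(1))
      fix h assume h: "h \<in> PD" "nD h < d"
      have "A (x + h) = A x + A h" using x PD_D[OF h(1)] by (simp add: Adom_add)
      then show "nD (B (g (A (x + h))) - B (g (A x)) - B (Dg (A x) (A h))) \<le> \<epsilon> * nD h"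
        using d(2)[of "A x + A h"] h(2) by (simp add: B_linear[symmetric] nD_B) (simp add: snorm_def)
    qed
  qed
  show "\<forall>\<epsilon>>0. \<exists>\<delta>>0. \<forall>y\<in>PD. nD (y - x) < \<delta> \<longrightarrow> (\<forall>h\<in>PD. nD (B (Dg (A y) (A h)) - B (Dg (A x) (A h))) \<le> \<epsilon> * nD h)"
  proof (intro allI impI)
    fix \<epsilon> :: real assume "0 < \<epsilon>"
    from cont[OF this, of "A x"] obtain d where d: "0 < d"
      "\<And>y h. norm (y - A x) < d \<Longrightarrow> norm (Dg y h - Dg (A x) h) \<le> \<epsilon> * norm h" by blast
    show "\<exists>\<delta>>0. \<forall>y\<in>PD. nD (y - x) < \<delta> \<longrightarrow> (\<forall>h\<in>PD. nD (B (Dg (A y) (A h)) - B (Dg (A x) (A h))) \<le> \<epsilon> * nD h)"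
    proof (intro exI[of _ d] conjI ballI impI d(1))
      fix y h assume y: "y \<in> PD" "nD (y - x) < d"
      then have "norm (A y - A x) < d" using x PD_D[OF y(1)] by (simp add: snorm_def Adom_diff)
      then show "nD (B (Dg (A y) (A h)) - B (Dg (A x) (A h))) \<le> \<epsilon> * nD h"
        using d(2)[of "A y" "A h"] by (simp add: B_linear[symmetric] nD_B) (simp add: snorm_def)
    qed
  qed
qed

text \<open>\<open>gu\<close> and \<open>gv\<close> are the conjugated graph maps of the random and of the Marcus equation.\<close>

definition gu :: "path \<times> path \<Rightarrow> 'a \<Rightarrow> 'a" where "gu \<omega> = graph_map (h \<omega>)"

definition gv :: "path \<times> path \<Rightarrow> 'a \<Rightarrow> 'a" where
  "gv \<omega> x = exp (zOU \<omega>) *\<^sub>R gu \<omega> (exp (- zOU \<omega>) *\<^sub>R x)"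

abbreviation "lipC \<equiv> 1 / (1 - L * kap_int N \<beta>) + 1"

lemma gu_props:
  assumes "\<omega> \<in> Om"
  shows "SP N 0 (gu \<omega> x) = 0" "norm (gu \<omega> x - gu \<omega> y) \<le> lipC * norm (x - y)"
  unfolding gu_def by (rule SP_graph_map[OF h_forcing[OF assms]], rule graph_map_lipschitz[OF h_forcing[OF assms]])

lemma gv_props:
  assumes "\<omega> \<in> Om"
  shows "SP N 0 (gv \<omega> x) = 0" "norm (gv \<omega> x - gv \<omega> y) \<le> lipC * norm (x - y)"
proof -
  show "SP N 0 (gv \<omega> x) = 0" using gu_props(1)[OF assms] by (simp add: gv_def SP_linear)
  have "norm (gv \<omega> x - gv \<omega> y) = exp (zOU \<omega>) * norm (gu \<omega> (exp (- zOU \<omega>) *\<^sub>R x) - gu \<omega> (exp (- zOU \<omega>) *\<^sub>R y))"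
    by (simp add: gv_def scaleR_diff_right[symmetric] del: scaleR_diff_right)
  also have "\<dots> \<le> exp (zOU \<omega>) * (lipC * norm (exp (- zOU \<omega>) *\<^sub>R x - exp (- zOU \<omega>) *\<^sub>R y))"
    by (intro mult_left_mono gu_props(2)[OF assms]) simp
  also have "norm (exp (- zOU \<omega>) *\<^sub>R x - exp (- zOU \<omega>) *\<^sub>R y) = exp (- zOU \<omega>) * norm (x - y)"
    by (simp add: scaleR_diff_right[symmetric] del: scaleR_diff_right)
  also have "exp (zOU \<omega>) * (lipC * (exp (- zOU \<omega>) * norm (x - y))) = (exp (zOU \<omega>) * exp (- zOU \<omega>)) * (lipC * norm (x - y))"
    by (simp only: mult_ac)
  also have "exp (zOU \<omega>) * exp (- zOU \<omega>) = 1" by (simp add: mult_exp_exp)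
  finally show "norm (gv \<omega> x - gv \<omega> y) \<le> lipC * norm (x - y)" by simp
qed

lemma gu_measurable: "(\<lambda>(\<omega>, x). gu \<omega> x) \<in> borel_measurable (Omega \<Otimes>\<^sub>M borel)"
  unfolding gu_def by (rule graph_map_measurable[OF h_measurable_pair])

lemma gv_measurable: "(\<lambda>(\<omega>, x). gv \<omega> x) \<in> borel_measurable (Omega \<Otimes>\<^sub>M borel)"
proof -
  have [measurable]: "(\<lambda>z. Zp (fst z) 0) \<in> borel_measurable (Omega \<Otimes>\<^sub>M (borel :: 'a measure))"
    by (rule Zp_measurable) measurable
  have "(\<lambda>z. (fst z, exp (- Zp (fst z) 0) *\<^sub>R snd z)) \<in> measurable (Omega \<Otimes>\<^sub>M (borel :: 'a measure)) (Omega \<Otimes>\<^sub>M (borel :: 'a measure))"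
    by measurable
  from measurable_compose[OF this gu_measurable]
  have [measurable]: "(\<lambda>z. gu (fst z) (exp (- Zp (fst z) 0) *\<^sub>R snd z)) \<in> borel_measurable (Omega \<Otimes>\<^sub>M (borel :: 'a measure))"
    by simp
  have "(\<lambda>z. exp (Zp (fst z) 0) *\<^sub>R gu (fst z) (exp (- Zp (fst z) 0) *\<^sub>R snd z)) \<in> borel_measurable (Omega \<Otimes>\<^sub>M (borel :: 'a measure))"
    by measurable
  then show ?thesis
    by (rule measurable_cong[THEN iffD1, rotated]) (auto simp: gv_def space_pair_measure Zp_0)
qed

text \<open>A point is on the manifold exactly when A x is the value at 0 of the Lyapunov-Perron
  solution with datum A x. That solution depends only on the projection of the datum, which turns
  the condition into the graph equation.\<close>

lemma Ms_graph:
  assumes \<omega>: "\<omega> \<in> Om"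
  shows "Ms \<omega> = graph (\<lambda>\<xi>. B (gu \<omega> (A \<xi>)))"
proof (rule set_eqI)
  fix x
  note f = h_forcing[OF \<omega>]
  show "x \<in> Ms \<omega> \<longleftrightarrow> x \<in> graph (\<lambda>\<xi>. B (gu \<omega> (A \<xi>)))"
  proof (cases "x \<in> D")
    case True
    have "x \<in> Ms \<omega> \<longleftrightarrow> A x = backward (h \<omega>) (A x) 0"
    proof
      assume "x \<in> Ms \<omega>"
      then obtain v C where v: "mild (h \<omega>) {..0} v" "\<And>t. t \<le> 0 \<Longrightarrow> norm (v t) \<le> C * exp (- \<beta> * t)" "v 0 = A x"
        unfolding Ms_iff[OF \<omega>] by blast
      from back_representation[OF f v(1,2), of 0] show "A x = backward (h \<omega>) (A x) 0"
        by (simp add: v(3))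
    next
      assume "A x = backward (h \<omega>) (A x) 0"
      then show "x \<in> Ms \<omega>"
        unfolding Ms_iff[OF \<omega>]
        using True back_mild[OF f, of "A x"] exp_boundedD[OF back_bound[OF f, of "A x"]] by metis
    qed
    also have "\<dots> \<longleftrightarrow> A x - SP N 0 (A x) = gu \<omega> (SP N 0 (A x))"
    proof -
      have "backward (h \<omega>) (SP N 0 (A x)) = backward (h \<omega>) (A x)"
        by (rule back_cong[OF f]) (simp add: SP_SP_0)
      then show ?thesis by (simp add: gu_def graph_map_def SP_SP_0)
    qed
    also have "\<dots> \<longleftrightarrow> x \<in> graph (\<lambda>\<xi>. B (gu \<omega> (A \<xi>)))"
      using graph_B_iff[of "gu \<omega>" "A x", OF gu_props(1)[OF \<omega>]] by (simp add: B_A[OF True])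
    finally show ?thesis .
  next
    case False
    then show ?thesis
      using graph_D unfolding Ms_iff[OF \<omega>] by blast
  qed
qed

abbreviation "Mv \<omega> \<equiv> (\<lambda>x. exp (zOU \<omega>) *\<^sub>R x) ` Ms \<omega>"

lemma gv_eq:
  assumes "\<xi> \<in> PD"
  shows "B (gv \<omega> (A \<xi>)) = exp (zOU \<omega>) *\<^sub>R B (gu \<omega> (A (exp (- zOU \<omega>) *\<^sub>R \<xi>)))"
  using PD_D[OF assms] by (simp add: gv_def B_linear Adom_scaleR)

lemma Mv_graph:
  assumes \<omega>: "\<omega> \<in> Om"
  shows "Mv \<omega> = graph (\<lambda>\<xi>. B (gv \<omega> (A \<xi>)))"
proof
  show "Mv \<omega> \<subseteq> graph (\<lambda>\<xi>. B (gv \<omega> (A \<xi>)))"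
  proof
    fix y assume "y \<in> Mv \<omega>"
    then obtain \<xi> where \<xi>: "\<xi> \<in> PD" "y = exp (zOU \<omega>) *\<^sub>R (\<xi> + B (gu \<omega> (A \<xi>)))"
      unfolding Ms_graph[OF \<omega>] graph_def by blast
    have "y = exp (zOU \<omega>) *\<^sub>R \<xi> + B (gv \<omega> (A (exp (zOU \<omega>) *\<^sub>R \<xi>)))"
      by (simp add: gv_eq[OF PD_scaleR[OF \<xi>(1)]] \<xi>(2) scaleR_add_right mult_exp_exp)
    then show "y \<in> graph (\<lambda>\<xi>. B (gv \<omega> (A \<xi>)))"
      unfolding graph_def using PD_scaleR[OF \<xi>(1)] by blast
  qed
  show "graph (\<lambda>\<xi>. B (gv \<omega> (A \<xi>))) \<subseteq> Mv \<omega>"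
  proof
    fix y assume "y \<in> graph (\<lambda>\<xi>. B (gv \<omega> (A \<xi>)))"
    then obtain \<xi> where \<xi>: "\<xi> \<in> PD" "y = \<xi> + B (gv \<omega> (A \<xi>))" unfolding graph_def by blast
    let ?\<eta> = "exp (- zOU \<omega>) *\<^sub>R \<xi>"
    have "y = exp (zOU \<omega>) *\<^sub>R (?\<eta> + B (gu \<omega> (A ?\<eta>)))"
      by (simp add: gv_eq[OF \<xi>(1)] \<xi>(2) scaleR_add_right mult_exp_exp)
    moreover have "?\<eta> + B (gu \<omega> (A ?\<eta>)) \<in> Ms \<omega>"
      unfolding Ms_graph[OF \<omega>] graph_def using PD_scaleR[OF \<xi>(1)] by blast
    ultimately show "y \<in> Mv \<omega>" by blast
  qed
qed

section \<open>Invariance and exponential attraction for both flows\<close>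

lemma u_invariant: "invariant_under Omega noise_shift (u_flow e lam \<sigma> F) Ms"
  unfolding invariant_under_def using Ms_invariant by auto

lemma v_invariant: "invariant_under Omega noise_shift (v_flow e lam \<sigma> F) Mv"
  unfolding invariant_under_def space_Omega
proof (intro ballI allI impI subsetI)
  fix \<omega> y and t :: real assume \<omega>: "\<omega> \<in> Om" and t: "0 \<le> t" and "y \<in> v_flow e lam \<sigma> F t \<omega> ` Mv \<omega>"
  then obtain x where x: "x \<in> Ms \<omega>" "y = v_flow e lam \<sigma> F t \<omega> (exp (zOU \<omega>) *\<^sub>R x)" by blast
  then have "y = exp (zOU (noise_shift t \<omega>)) *\<^sub>R u_flow e lam \<sigma> F t \<omega> x"
    by (simp add: v_flow_def mult_exp_exp)
  then show "y \<in> Mv (noise_shift t \<omega>)" using Ms_invariant[OF \<omega> t x(1)] by blast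
qed

lemma \<beta>_pos: "0 < \<beta>"
  using \<beta>(1) Lam_pos[of "N - 1"] by linarith

text \<open>One half of \<beta> is spent on absorbing the random factor into a measurable random
  constant, the other half remains as the rate. The value k = 0 serves the random equation and k = 1
  the Marcus equation.\<close>

lemma random_bound:
  obtains K where "K \<in> borel_measurable Omega"
    "\<And>\<omega> t. \<omega> \<in> Om \<Longrightarrow> 0 \<le> t \<Longrightarrow> exp (k * Zp \<omega> t + zeta \<omega> t - \<beta> * t) \<le> K \<omega> * exp (- (\<beta> / 2) * t)"
proof -
  obtain K where K: "K \<in> borel_measurable Omega"
    "\<And>\<omega> t. \<omega> \<in> space Omega \<Longrightarrow> 0 \<le> t \<Longrightarrow> exp (k * Zp \<omega> t + zeta \<omega> t - \<beta> / 2 * t) \<le> K \<omega>"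
  proof (rule right_continuous_bound_measurable[of "\<lambda>\<omega> t. exp (k * Zp \<omega> t + zeta \<omega> t - \<beta> / 2 * t)" Omega])
    show "(\<lambda>\<omega>. exp (k * Zp \<omega> t + zeta \<omega> t - \<beta> / 2 * t)) \<in> borel_measurable Omega" for t
      by measurable
    show "continuous (at_right t) (\<lambda>t. exp (k * Zp \<omega> t + zeta \<omega> t - \<beta> / 2 * t))" if "\<omega> \<in> space Omega" for \<omega> t
      using that by (intro continuous_intros Zp_right_continuous zeta_right_continuous) auto
    show "\<exists>C. \<forall>t\<ge>0. exp (k * Zp \<omega> t + zeta \<omega> t - \<beta> / 2 * t) \<le> C" if "\<omega> \<in> space Omega" for \<omega>
      using growth_bound[of \<omega> "\<beta> / 2" k] that \<beta>_pos by simp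
  qed blast
  show ?thesis
  proof (rule that[OF K(1)])
    fix \<omega> and t :: real assume "\<omega> \<in> Om" "0 \<le> t"
    then have "exp (k * Zp \<omega> t + zeta \<omega> t - \<beta> / 2 * t) * exp (- (\<beta> / 2) * t) \<le> K \<omega> * exp (- (\<beta> / 2) * t)"
      using K(2) by (intro mult_right_mono) auto
    then show "exp (k * Zp \<omega> t + zeta \<omega> t - \<beta> * t) \<le> K \<omega> * exp (- (\<beta> / 2) * t)"
      by (simp add: mult_exp_exp algebra_simps)
  qed
qed

lemma attracts_exponentiallyI:
  assumes K: "\<And>x. x \<in> D \<Longrightarrow> K x \<in> borel_measurable Omega"
    and M: "\<And>x \<omega> t. x \<in> D \<Longrightarrow> \<omega> \<in> Om \<Longrightarrow> 0 \<le> t \<Longrightarrow>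
      \<exists>y\<in>M (noise_shift t \<omega>). nD (\<phi> t \<omega> x - y) \<le> K x \<omega> * exp (- (\<beta> / 2) * t)"
  shows "attracts_exponentially Omega noise_shift D nD \<phi> M"
  unfolding attracts_exponentially_def space_Omega
proof (intro exI[of _ "\<beta> / 2"] conjI ballI)
  show "0 < \<beta> / 2" using \<beta>_pos by simp
  fix x assume x: "x \<in> D"
  show "\<exists>K\<in>borel_measurable Omega. \<forall>\<omega>\<in>Om. \<forall>t\<ge>0. (INF y\<in>M (noise_shift t \<omega>). nD (\<phi> t \<omega> x - y)) \<le> K \<omega> * exp (- (\<beta> / 2) * t)"
  proof (intro bexI[OF _ K[OF x]] ballI allI impI)
    fix \<omega> and t :: real assume "\<omega> \<in> Om" "0 \<le> t"
    with M[OF x] obtain y where y: "y \<in> M (noise_shift t \<omega>)" "nD (\<phi> t \<omega> x - y) \<le> K x \<omega> * exp (- (\<beta> / 2) * t)"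
      by blast
    have "(INF y\<in>M (noise_shift t \<omega>). nD (\<phi> t \<omega> x - y)) \<le> nD (\<phi> t \<omega> x - y)"
      by (rule cINF_lower[OF bdd_belowI2[of _ 0] y(1)]) (rule snorm_nonneg)
    with y(2) show "(INF y\<in>M (noise_shift t \<omega>). nD (\<phi> t \<omega> x - y)) \<le> K x \<omega> * exp (- (\<beta> / 2) * t)"
      by linarith
  qed
qed

lemma u_attracts: "attracts_exponentially Omega noise_shift D nD (u_flow e lam \<sigma> F) Ms"
proof -
  obtain K where K: "K \<in> borel_measurable Omega"
    "\<And>\<omega> t. \<omega> \<in> Om \<Longrightarrow> 0 \<le> t \<Longrightarrow> exp (0 * Zp \<omega> t + zeta \<omega> t - \<beta> * t) \<le> K \<omega> * exp (- (\<beta> / 2) * t)"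
    using random_bound[of 0] by blast
  show ?thesis
  proof (rule attracts_exponentiallyI[where K = "\<lambda>x \<omega>. nD x / (1 - L * kap_int N \<beta>) * K \<omega>"])
    show "(\<lambda>\<omega>. nD x / (1 - L * kap_int N \<beta>) * K \<omega>) \<in> borel_measurable Omega" for x
      using K(1) by measurable
    fix x \<omega> and t :: real assume *: "x \<in> D" "\<omega> \<in> Om" "0 \<le> t"
    obtain y where y: "y \<in> Ms (noise_shift t \<omega>)"
      "nD (u_flow e lam \<sigma> F t \<omega> x - y) \<le> nD x / (1 - L * kap_int N \<beta>) * exp (zeta \<omega> t - \<beta> * t)"
      using Ms_tracking[OF *(2,1,3)] .
    have "nD x / (1 - L * kap_int N \<beta>) * exp (zeta \<omega> t - \<beta> * t) \<le> nD x / (1 - L * kap_int N \<beta>) * (K \<omega> * exp (- (\<beta> / 2) * t))"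
      using K(2)[OF *(2,3)] Lc(2) snorm_nonneg[of \<sigma> x] by (intro mult_left_mono) auto
    with y show "\<exists>y\<in>Ms (noise_shift t \<omega>). nD (u_flow e lam \<sigma> F t \<omega> x - y) \<le> nD x / (1 - L * kap_int N \<beta>) * K \<omega> * exp (- (\<beta> / 2) * t)"
      by (intro bexI[of _ y]) (simp_all only: mult.assoc order_trans)
  qed
qed

text \<open>Two further factors appear: the initial rescaling exp (- Zp \<omega> 0) joins the random
  constant, and the final one, exp (Zp \<omega> t), is absorbed by \<open>random_bound\<close> with
  k = 1.\<close>

lemma v_attracts: "attracts_exponentially Omega noise_shift D nD (v_flow e lam \<sigma> F) Mv"
proof -
  obtain K where K: "K \<in> borel_measurable Omega"
    "\<And>\<omega> t. \<omega> \<in> Om \<Longrightarrow> 0 \<le> t \<Longrightarrow> exp (1 * Zp \<omega> t + zeta \<omega> t - \<beta> * t) \<le> K \<omega> * exp (- (\<beta> / 2) * t)"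
    using random_bound[of 1] by blast
  show ?thesis
  proof (rule attracts_exponentiallyI[where K = "\<lambda>x \<omega>. nD x / (1 - L * kap_int N \<beta>) * exp (- Zp \<omega> 0) * K \<omega>"])
    show "(\<lambda>\<omega>. nD x / (1 - L * kap_int N \<beta>) * exp (- Zp \<omega> 0) * K \<omega>) \<in> borel_measurable Omega" for x
      using K(1) by measurable
    fix x \<omega> and t :: real assume *: "x \<in> D" "\<omega> \<in> Om" "0 \<le> t"
    let ?x = "exp (- zOU \<omega>) *\<^sub>R x" and ?u = "u_flow e lam \<sigma> F t \<omega> (exp (- zOU \<omega>) *\<^sub>R x)"
    define c where "c = nD x / (1 - L * kap_int N \<beta>) * exp (- Zp \<omega> 0)"
    have c: "0 \<le> c" "nD ?x / (1 - L * kap_int N \<beta>) = c"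
      using Lc(2) snorm_nonneg[of \<sigma> x] by (simp_all add: c_def snorm_scaleR[OF *(1)] Zp_0[OF *(2)])
    obtain y where y: "y \<in> Ms (noise_shift t \<omega>)" "nD (?u - y) \<le> c * exp (zeta \<omega> t - \<beta> * t)"
      using Ms_tracking[OF *(2) Adom_scaleR(1)[OF *(1), of "exp (- zOU \<omega>)"] *(3)] unfolding c(2) by blast
    obtain v where v: "mild (h \<omega>) {0..} v" "v 0 = A ?x"
      using forward_exists[OF h_forcing[OF *(2)] L_ge0] .
    have uD: "?u \<in> D"
      using u_flow_eq[OF *(2) v(1) *(3)] B_A[OF Adom_scaleR(1)[OF *(1)]] v(2) Adom_scaleR(1)[OF B_D] by metis
    have yD: "y \<in> D" using y(1) Ms_iff[OF Om_shift[OF *(2)]] by blast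
    have "nD (v_flow e lam \<sigma> F t \<omega> x - exp (zOU (noise_shift t \<omega>)) *\<^sub>R y) = exp (Zp \<omega> t) * nD (?u - y)"
      using snorm_scaleR[OF Adom_diff(1)[OF uD yD], of "exp (Zp \<omega> t)"] by (simp add: v_flow_def Zp_def scaleR_diff_right)
    also have "\<dots> \<le> exp (Zp \<omega> t) * (c * exp (zeta \<omega> t - \<beta> * t))"
      by (intro mult_left_mono y(2)) simp
    also have "\<dots> = c * exp (1 * Zp \<omega> t + zeta \<omega> t - \<beta> * t)"
      by (simp add: exp_add exp_diff)
    also have "\<dots> \<le> c * (K \<omega> * exp (- (\<beta> / 2) * t))"
      by (intro mult_left_mono K(2)[OF *(2,3)] c(1))
    finally have "nD (v_flow e lam \<sigma> F t \<omega> x - exp (zOU (noise_shift t \<omega>)) *\<^sub>R y) \<le> c * K \<omega> * exp (- (\<beta> / 2) * t)"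
      by (simp only: mult.assoc)
    then show "\<exists>y\<in>Mv (noise_shift t \<omega>). nD (v_flow e lam \<sigma> F t \<omega> x - y) \<le> nD x / (1 - L * kap_int N \<beta>) * exp (- Zp \<omega> 0) * K \<omega> * exp (- (\<beta> / 2) * t)"
      unfolding c_def using y(1) by blast
  qed
qed

lemma u_random_set: "random_set Omega D nD Ms"
  by (rule graph_random_set[OF gu_props gu_measurable Ms_graph])

lemma v_random_set: "random_set Omega D nD Mv"
  by (rule graph_random_set[OF gv_props gv_measurable Mv_graph])

lemma psi_measurable:
  "(\<lambda>(\<omega>, \<xi>). B (gu \<omega> (A \<xi>))) \<in>
    measurable (Omega \<Otimes>\<^sub>M restrict_space (norm_borel D nD) PD) (restrict_space (norm_borel D nD) QD)"
proof (rule measurable_restrict_space2)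
  have PDs: "space (restrict_space (norm_borel D nD) PD) = PD"
    using PD_D by (auto simp: space_restrict_space space_norm_borel[OF \<sigma>(1)] simp del: image_iff)
  show "(\<lambda>(\<omega>, \<xi>). B (gu \<omega> (A \<xi>))) \<in> space (Omega \<Otimes>\<^sub>M restrict_space (norm_borel D nD) PD) \<rightarrow> QD"
    by (auto simp: space_pair_measure PDs QD_iff gu_props(1) simp del: image_iff)
  have [measurable]: "A \<in> borel_measurable (restrict_space (norm_borel D nD) PD)"
    by (rule measurable_restrict_space1[OF measurable_Apow[OF \<sigma>(1)]])
  have "(\<lambda>(\<omega>, \<xi>). (\<omega>, A \<xi>)) \<in> measurable (Omega \<Otimes>\<^sub>M restrict_space (norm_borel D nD) PD) (Omega \<Otimes>\<^sub>M borel)"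
    by measurable
  from measurable_compose[OF measurable_compose[OF this gu_measurable] measurable_Ainv[OF \<sigma>(1)]]
  show "(\<lambda>(\<omega>, \<xi>). B (gu \<omega> (A \<xi>))) \<in> measurable (Omega \<Otimes>\<^sub>M restrict_space (norm_borel D nD) PD) (norm_borel D nD)"
    by (simp add: split_beta')
qed

lemma u_lipschitz_manifold: "lipschitz_inertial_manifold Omega noise_shift D nD PD QD (u_flow e lam \<sigma> F) Ms"
  unfolding lipschitz_inertial_manifold_def space_Omega
proof (intro conjI splitting u_random_set u_invariant u_attracts exI[of _ "\<lambda>\<omega> \<xi>. B (gu \<omega> (A \<xi>))"] ballI)
  fix \<omega> assume \<omega>: "\<omega> \<in> Om"
  show "lipschitz_map PD nD QD nD (\<lambda>\<xi>. B (gu \<omega> (A \<xi>)))"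
    by (rule graph_lipschitz_map[OF gu_props[OF \<omega>]])
  show "Ms \<omega> = {\<xi> + B (gu \<omega> (A \<xi>)) |\<xi>. \<xi> \<in> PD}"
    by (rule Ms_graph[OF \<omega>, unfolded graph_def])
qed

lemma v_lipschitz_manifold: "lipschitz_inertial_manifold Omega noise_shift D nD PD QD (v_flow e lam \<sigma> F) Mv"
  unfolding lipschitz_inertial_manifold_def space_Omega
proof (intro conjI splitting v_random_set v_invariant v_attracts exI[of _ "\<lambda>\<omega> \<xi>. B (gv \<omega> (A \<xi>))"] ballI)
  fix \<omega> assume \<omega>: "\<omega> \<in> Om"
  show "lipschitz_map PD nD QD nD (\<lambda>\<xi>. B (gv \<omega> (A \<xi>)))"
    by (rule graph_lipschitz_map[OF gv_props[OF \<omega>]])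
  show "Mv \<omega> = {\<xi> + B (gv \<omega> (A \<xi>)) |\<xi>. \<xi> \<in> PD}"
    by (rule Mv_graph[OF \<omega>, unfolded graph_def])
qed

section \<open>Continuous differentiability\<close>

lemma Fh_derivative:
  assumes "C1_map D nD UNIV norm F"
  obtains DF :: "'a \<Rightarrow> 'a \<Rightarrow>\<^sub>L 'a" where "\<And>x. (Fh has_derivative DF x) (at x)" "continuous_on UNIV DF"
proof -
  obtain Df where Df: "\<And>x. x \<in> D \<Longrightarrow> bounded_linear_map D nD UNIV norm (Df x)"
    and d: "\<And>x \<epsilon>. x \<in> D \<Longrightarrow> 0 < \<epsilon> \<Longrightarrow> \<exists>\<delta>>0. \<forall>h\<in>D. nD h < \<delta> \<longrightarrow> norm (F (x + h) - F x - Df x h) \<le> \<epsilon> * nD h"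
    and c: "\<And>x \<epsilon>. x \<in> D \<Longrightarrow> 0 < \<epsilon> \<Longrightarrow> \<exists>\<delta>>0. \<forall>y\<in>D. nD (y - x) < \<delta> \<longrightarrow> (\<forall>h\<in>D. norm (Df y h - Df x h) \<le> \<epsilon> * nD h)"
    using assms unfolding C1_map_def by blast
  have bl: "bounded_linear (\<lambda>y. Df (B x) (B y))" for x
  proof -
    obtain K where K: "\<And>y. y \<in> D \<Longrightarrow> norm (Df (B x) y) \<le> K * nD y"
      using Df[OF B_D, of x] unfolding bounded_linear_map_def by blast
    show ?thesis
    proof (rule bounded_linear_intro[where K = K])
      show "norm (Df (B x) (B y)) \<le> norm y * K" for y
        using K[OF B_D, of y] by (simp add: nD_B mult.commute)
    qed (use Df[OF B_D, of x] in \<open>simp_all add: bounded_linear_map_def B_linear\<close>)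
  qed
  define DF where "DF x = Blinfun (\<lambda>y. Df (B x) (B y))" for x
  have DF: "blinfun_apply (DF x) y = Df (B x) (B y)" for x y
    unfolding DF_def by (simp add: bounded_linear_Blinfun_apply[OF bl])
  show ?thesis
  proof (rule that)
    fix x
    show "(Fh has_derivative DF x) (at x)"
      unfolding has_derivative_at_alt
    proof (intro conjI allI impI blinfun.bounded_linear_right)
      fix \<epsilon> :: real assume "0 < \<epsilon>"
      from d[OF B_D this] obtain \<delta> where \<delta>: "0 < \<delta>"
        "\<And>h. h \<in> D \<Longrightarrow> nD h < \<delta> \<Longrightarrow> norm (F (B x + h) - F (B x) - Df (B x) h) \<le> \<epsilon> * nD h" by blast
      have "norm (Fh y - Fh x - DF x (y - x)) \<le> \<epsilon> * norm (y - x)" if "norm (y - x) < \<delta>" for y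
        using \<delta>(2)[of "B (y - x)"] that by (simp add: nD_B Fh_def DF B_linear(1)[symmetric])
      with \<delta>(1) show "\<exists>d>0. \<forall>y. norm (y - x) < d \<longrightarrow> norm (Fh y - Fh x - DF x (y - x)) \<le> \<epsilon> * norm (y - x)" by blast
    qed
  next
    show "continuous_on UNIV DF"
      unfolding continuous_on_iff
    proof (intro ballI allI impI)
      fix x and \<epsilon> :: real assume "0 < \<epsilon>"
      \<comment> \<open>The pointwise estimates yield only a non-strict bound on the operator norm,
        while the distance has to be strictly below \<epsilon>.\<close>
      then have "0 < \<epsilon> / 2" by simp
      from c[OF B_D this] obtain \<delta> where \<delta>: "0 < \<delta>"
        "\<And>y h. y \<in> D \<Longrightarrow> nD (y - B x) < \<delta> \<Longrightarrow> h \<in> D \<Longrightarrow> norm (Df y h - Df (B x) h) \<le> \<epsilon> / 2 * nD h" by metis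
      have "dist (DF y) (DF x) < \<epsilon>" if "dist y x < \<delta>" for y
      proof -
        have "norm (DF y - DF x) \<le> \<epsilon> / 2"
        proof (rule norm_blinfun_bound)
          show "norm ((DF y - DF x) h) \<le> \<epsilon> / 2 * norm h" for h
            using \<delta>(2)[of "B y" "B h"] that
            by (simp add: blinfun.diff_left DF nD_B B_linear(2)[symmetric] dist_norm)
        qed (use \<open>0 < \<epsilon>\<close> in simp)
        then show ?thesis using \<open>0 < \<epsilon>\<close> by (simp add: dist_norm)
      qed
      with \<delta>(1) show "\<exists>d>0. \<forall>x'\<in>UNIV. dist x' x < d \<longrightarrow> dist (DF x') (DF x) < \<epsilon>" by blast
    qed
  qed
qed

lemma gu_C1:
  assumes F: "C1_map D nD UNIV norm F" and \<omega>: "\<omega> \<in> Om"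
  obtains Dg where "\<And>x. (gu \<omega> has_derivative Dg x) (at x)"
    "\<And>x \<epsilon>. 0 < \<epsilon> \<Longrightarrow> \<exists>\<delta>>0. \<forall>y. norm (y - x) < \<delta> \<longrightarrow> (\<forall>h. norm (Dg y h - Dg x h) \<le> \<epsilon> * norm h)"
proof -
  obtain DF :: "'a \<Rightarrow> 'a \<Rightarrow>\<^sub>L 'a" where DF: "\<And>x. (Fh has_derivative DF x) (at x)" "continuous_on UNIV DF"
    using Fh_derivative[OF F] by blast
  define Dh where "Dh s x = DF (exp (Zp \<omega> s + zeta \<omega> s) *\<^sub>R x)" for s x
  have 1: "(h \<omega> s has_derivative blinfun_apply (Dh s x)) (at x)" for s x
  proof -
    let ?c = "Zp \<omega> s + zeta \<omega> s"
    have "((\<lambda>x. exp ?c *\<^sub>R x) has_derivative (\<lambda>y. exp ?c *\<^sub>R y)) (at x)"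
      by (auto intro!: derivative_eq_intros)
    from has_derivative_compose[OF this DF(1)[of "exp ?c *\<^sub>R x"]]
    have "((\<lambda>x. exp (- ?c) *\<^sub>R Fh (exp ?c *\<^sub>R x)) has_derivative (\<lambda>y. exp (- ?c) *\<^sub>R DF (exp ?c *\<^sub>R x) (exp ?c *\<^sub>R y))) (at x)"
      by (rule has_derivative_scaleR_right)
    moreover have "exp (- ?c) *\<^sub>R DF (exp ?c *\<^sub>R x) (exp ?c *\<^sub>R y) = Dh s x y" for y
      by (simp add: Dh_def blinfun.scaleR_right mult_exp_exp)
    ultimately show ?thesis unfolding h_def[abs_def] by simp
  qed
  have 2: "continuous_on UNIV (Dh s)" for s
    unfolding Dh_def[abs_def] by (intro continuous_on_compose2[OF DF(2)] continuous_intros) auto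
  from graph_map_C1[OF h_forcing[OF \<omega>], of Dh] 1 2 that show ?thesis
    unfolding gu_def by blast
qed

lemma gu_C1_map:
  assumes F: "C1_map D nD UNIV norm F" and \<omega>: "\<omega> \<in> Om"
  shows "C1_map PD nD QD nD (\<lambda>\<xi>. B (gu \<omega> (A \<xi>)))"
proof -
  obtain Dg where "\<And>x. (gu \<omega> has_derivative Dg x) (at x)"
    "\<And>x \<epsilon>. 0 < \<epsilon> \<Longrightarrow> \<exists>\<delta>>0. \<forall>y. norm (y - x) < \<delta> \<longrightarrow> (\<forall>h. norm (Dg y h - Dg x h) \<le> \<epsilon> * norm h)"
    using gu_C1[OF F \<omega>] by blast
  then show ?thesis by (rule graph_C1_map[OF gu_props(1)[OF \<omega>]])
qed

lemma gv_C1_map: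
  assumes F: "C1_map D nD UNIV norm F" and \<omega>: "\<omega> \<in> Om"
  shows "C1_map PD nD QD nD (\<lambda>\<xi>. B (gv \<omega> (A \<xi>)))"
proof -
  obtain Dg where Dg: "\<And>x. (gu \<omega> has_derivative Dg x) (at x)"
    "\<And>x \<epsilon>. 0 < \<epsilon> \<Longrightarrow> \<exists>\<delta>>0. \<forall>y. norm (y - x) < \<delta> \<longrightarrow> (\<forall>h. norm (Dg y h - Dg x h) \<le> \<epsilon> * norm h)"
    using gu_C1[OF F \<omega>] by blast
  let ?z = "exp (- zOU \<omega>)"
  show ?thesis
  proof (rule graph_C1_map[OF gv_props(1)[OF \<omega>]])
    fix x :: 'a
    have "((\<lambda>x. ?z *\<^sub>R x) has_derivative (\<lambda>y. ?z *\<^sub>R y)) (at x)"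
      by (auto intro!: derivative_eq_intros)
    from has_derivative_compose[OF this Dg(1)[of "?z *\<^sub>R x"]]
    have "(gv \<omega> has_derivative (\<lambda>y. exp (zOU \<omega>) *\<^sub>R Dg (?z *\<^sub>R x) (?z *\<^sub>R y))) (at x)"
      unfolding gv_def[abs_def] by (rule has_derivative_scaleR_right)
    moreover have "exp (zOU \<omega>) *\<^sub>R Dg (?z *\<^sub>R x) (?z *\<^sub>R y) = Dg (?z *\<^sub>R x) y" for y
      by (simp add: linear_scale[OF bounded_linear.linear[OF has_derivative_bounded_linear[OF Dg(1)]]] mult_exp_exp)
    ultimately show "(gv \<omega> has_derivative Dg (?z *\<^sub>R x)) (at x)" by simp
    fix \<epsilon> :: real assume "0 < \<epsilon>"
    from Dg(2)[OF this, of "?z *\<^sub>R x"] obtain \<delta> where \<delta>: "0 < \<delta>"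
      "\<And>y h. norm (y - ?z *\<^sub>R x) < \<delta> \<Longrightarrow> norm (Dg y h - Dg (?z *\<^sub>R x) h) \<le> \<epsilon> * norm h" by blast
    show "\<exists>\<delta>>0. \<forall>y. norm (y - x) < \<delta> \<longrightarrow> (\<forall>h. norm (Dg (?z *\<^sub>R y) h - Dg (?z *\<^sub>R x) h) \<le> \<epsilon> * norm h)"
    \<comment> \<open>The derivative of the rescaled map at x is \<open>Dg\<close> at ?z times x, so
      the radius is divided by ?z.\<close>
    proof (intro exI[of _ "\<delta> / ?z"] conjI allI impI \<delta>(2))
      show "0 < \<delta> / ?z" using \<delta>(1) by simp
      fix y assume "norm (y - x) < \<delta> / ?z"
      then have "?z * norm (y - x) < \<delta>" by (simp add: field_simps)
      then show "norm (?z *\<^sub>R y - ?z *\<^sub>R x) < \<delta>"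
        by (simp add: scaleR_diff_right[symmetric] del: scaleR_diff_right)
    qed
  qed
qed

lemma u_C1_manifold:
  assumes F: "C1_map D nD UNIV norm F"
  shows "C1_inertial_manifold Omega noise_shift D nD PD QD (u_flow e lam \<sigma> F) Ms"
  unfolding C1_inertial_manifold_def space_Omega
proof (intro conjI splitting u_random_set u_invariant u_attracts exI[of _ "\<lambda>\<omega> \<xi>. B (gu \<omega> (A \<xi>))"] ballI)
  fix \<omega> assume \<omega>: "\<omega> \<in> Om"
  show "C1_map PD nD QD nD (\<lambda>\<xi>. B (gu \<omega> (A \<xi>)))"
    by (rule gu_C1_map[OF F \<omega>])
  show "Ms \<omega> = {\<xi> + B (gu \<omega> (A \<xi>)) |\<xi>. \<xi> \<in> PD}"
    by (rule Ms_graph[OF \<omega>, unfolded graph_def])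
qed

lemma v_C1_manifold:
  assumes F: "C1_map D nD UNIV norm F"
  shows "C1_inertial_manifold Omega noise_shift D nD PD QD (v_flow e lam \<sigma> F) Mv"
  unfolding C1_inertial_manifold_def space_Omega
proof (intro conjI splitting v_random_set v_invariant v_attracts exI[of _ "\<lambda>\<omega> \<xi>. B (gv \<omega> (A \<xi>))"] ballI)
  fix \<omega> assume \<omega>: "\<omega> \<in> Om"
  show "C1_map PD nD QD nD (\<lambda>\<xi>. B (gv \<omega> (A \<xi>)))"
    by (rule gv_C1_map[OF F \<omega>])
  show "Mv \<omega> = {\<xi> + B (gv \<omega> (A \<xi>)) |\<xi>. \<xi> \<in> PD}"
    by (rule Mv_graph[OF \<omega>, unfolded graph_def])
qed

lemma Mv_explicit:
  assumes "\<omega> \<in> Om"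
  shows "Mv \<omega> = {\<xi> + exp (zOU \<omega>) *\<^sub>R B (gu \<omega> (A (exp (- zOU \<omega>) *\<^sub>R \<xi>))) | \<xi>. \<xi> \<in> PD}"
  unfolding Mv_graph[OF assms] graph_def using gv_eq by (intro Collect_cong) metis

end

text \<open>With c = 2 L / \<mu> the choice of \<beta> means \<beta> - lam N = c p, so the unstable
  term contributes exactly L / c = \<mu> / 2. The gap condition leaves \<delta> = lam (N + 1) -
  \<beta> >= c (S \<Delta>^\<sigma> + q), and with \<delta> <= \<Delta> the stable terms contribute
  at most \<mu> / 2. The contraction factor is thus at most \<mu> < 1.\<close>

lemma (in frac_eigen) spectral_gapI:
  assumes "0 < L" "1 \<le> N" "0 < \<mu>" "\<mu> < 1"
    and gap: "lam (N + 1) - lam N \<ge>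
           2 * L / \<mu> * (lam N powr \<sigma>
             + self_power \<sigma> * Gamma (1 - \<sigma>) * (lam (N + 1) - lam N) powr \<sigma>
             + lam (N + 1) powr \<sigma>)"
  shows "spectral_gap e lam \<sigma> N (beta_exponent lam \<sigma> N L \<mu>) L"
proof unfold_locales
  define p where "p = lam N powr \<sigma>"
  define q where "q = lam (N + 1) powr \<sigma>"
  define \<Delta> where "\<Delta> = lam (N + 1) - lam N"
  define S where "S = self_power \<sigma> * Gamma (1 - \<sigma>)"
  define \<beta> where "\<beta> = beta_exponent lam \<sigma> N L \<mu>"
  have N: "Suc (N - 1) = N" using assms(2) by simp
  have lamN: "0 < lam N" using Lam_pos[of "N - 1"] by (simp only: N)
  have lamN1: "0 < lam (N + 1)" using Lam_pos[of N] by simp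
  have pq: "0 < p" "0 < q"
    unfolding p_def q_def powr_gt_zero using lamN lamN1 by linarith+
  have S: "0 \<le> S" using self_power_nonneg Gamma_real_pos[of "1 - \<sigma>"] \<sigma> by (simp add: S_def)
  define c where "c = 2 * L / \<mu>"
  have c: "0 < c" using assms by (simp add: c_def)
  have gap': "c * (p + S * \<Delta> powr \<sigma> + q) \<le> \<Delta>"
    using gap by (simp add: c_def p_def q_def S_def \<Delta>_def)
  have \<beta>: "\<beta> = lam N + c * p"
    by (simp add: \<beta>_def beta_exponent_def c_def p_def)
  define \<delta> where "\<delta> = lam (N + 1) - \<beta>"
  have \<delta>_ge: "c * (S * \<Delta> powr \<sigma> + q) \<le> \<delta>"
    using gap' by (simp add: \<delta>_def \<beta> \<Delta>_def algebra_simps)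
  moreover have "0 < c * (S * \<Delta> powr \<sigma> + q)"
    using c S pq by (intro mult_pos_pos add_nonneg_pos) auto
  ultimately have \<delta>: "0 < \<delta>" by linarith
  have \<delta>\<Delta>: "\<delta> \<le> \<Delta>" using c pq by (simp add: \<delta>_def \<Delta>_def \<beta>)
  show "0 < N" using assms(2) by simp
  show "Lam (N - 1) < beta_exponent lam \<sigma> N L \<mu>"
    unfolding \<beta>_def[symmetric] N \<beta> using c pq by simp
  show "beta_exponent lam \<sigma> N L \<mu> < Lam N"
    unfolding \<beta>_def[symmetric] using \<delta> by (simp add: \<delta>_def)
  show "0 \<le> L" using assms(1) by simp
  have "L * (S * \<delta> powr (\<sigma> - 1) + q / \<delta>) \<le> \<mu> / 2"
  proof -
    have "\<delta> powr (\<sigma> - 1) = \<delta> powr \<sigma> / \<delta>" using \<delta> by (simp add: powr_diff)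
    then have "S * \<delta> powr (\<sigma> - 1) + q / \<delta> = (S * \<delta> powr \<sigma> + q) / \<delta>"
      by (simp add: add_divide_distrib)
    also have "\<dots> \<le> (S * \<Delta> powr \<sigma> + q) / \<delta>"
      using \<delta> \<delta>\<Delta> \<sigma> S by (intro divide_right_mono add_right_mono mult_left_mono powr_mono2) auto
    also have "\<dots> \<le> 1 / c"
      using \<delta>_ge \<delta> c by (simp add: field_simps)
    finally have "L * (S * \<delta> powr (\<sigma> - 1) + q / \<delta>) \<le> L * (1 / c)"
      using assms(1) by (intro mult_left_mono) auto
    also have "L * (1 / c) = \<mu> / 2" using assms(1,3) by (simp add: c_def)
    finally show ?thesis .
  qed
  moreover have "L * (p / (\<beta> - lam N)) = \<mu> / 2"
    using pq assms(1,3) c by (simp add: \<beta> c_def)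
  moreover have "kap_int N \<beta> = S * \<delta> powr (\<sigma> - 1) + q / \<delta> + p / (\<beta> - lam N)"
    using assms(2) N by (simp add: kap_int_def S_def q_def \<delta>_def p_def)
  ultimately have "L * kap_int N \<beta> \<le> \<mu>"
    by (simp only: distrib_left[of L "S * \<delta> powr (\<sigma> - 1) + q / \<delta>"])
  then show "L * kap_int N (beta_exponent lam \<sigma> N L \<mu>) < 1"
    unfolding \<beta>_def[symmetric] using assms(4) by linarith
qed

theorem theorem4p1:
  fixes e :: "nat \<Rightarrow> 'a::{real_inner,banach,second_countable_topology}"
    and lam :: "nat \<Rightarrow> real"
    and F :: "'a \<Rightarrow> 'a"
    and \<sigma> L \<mu> \<alpha> :: real
    and N :: nat
    and muW muS :: "path measure"
    and Om :: "(path \<times> path) set"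
  defines "D \<equiv> Adom e lam \<sigma>"
    and "nD \<equiv> snorm e lam \<sigma>"
    and "PD \<equiv> projP e N ` Adom e lam \<sigma>"
    and "QD \<equiv> projQ e N ` Adom e lam \<sigma>"
    and "\<Omega> \<equiv> restrict_space (muW \<Otimes>\<^sub>M muS) Om"
    and "M \<equiv> slow_manifold e lam \<sigma> F (beta_exponent lam \<sigma> N L \<mu>)"
  assumes "eigenbasis e lam"
    and "0 \<le> \<sigma>" "\<sigma> < 1"
    and "0 < L"
    and "F 0 = 0"
    and "\<And>u1 u2. u1 \<in> D \<Longrightarrow> u2 \<in> D \<Longrightarrow> norm (F u1 - F u2) \<le> L * nD (u1 - u2)"
    and "1 \<le> N" "lam N < lam (N + 1)"
    and "1 < \<alpha>" "\<alpha> < 2"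
    and "wiener_measure muW"
    and "stable_subordinator_law \<alpha> muS"
    and "full_invariant_set muW muS Om"
    and "0 < \<mu>" "\<mu> < 1"
    and "lam (N + 1) - lam N \<ge>
           2 * L / \<mu> * (lam N powr \<sigma>
             + self_power \<sigma> * Gamma (1 - \<sigma>) * (lam (N + 1) - lam N) powr \<sigma>
             + lam (N + 1) powr \<sigma>)"
  shows "\<exists>\<psi> :: path \<times> path \<Rightarrow> 'a \<Rightarrow> 'a.
    (\<forall>\<omega>\<in>Om. lipschitz_map PD nD QD nD (\<psi> \<omega>) \<and> M \<omega> = {\<xi> + \<psi> \<omega> \<xi> | \<xi>. \<xi> \<in> PD}) \<and>
    (\<lambda>(\<omega>, \<xi>). \<psi> \<omega> \<xi>) \<in>
      measurable (\<Omega> \<Otimes>\<^sub>M restrict_space (norm_borel D nD) PD) (restrict_space (norm_borel D nD) QD) \<and>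
    lipschitz_inertial_manifold \<Omega> noise_shift D nD PD QD (u_flow e lam \<sigma> F) M \<and>
    (\<forall>\<omega>\<in>Om. (\<lambda>x. exp (zOU \<omega>) *\<^sub>R x) ` M \<omega> =
       {\<xi> + exp (zOU \<omega>) *\<^sub>R \<psi> \<omega> (exp (- zOU \<omega>) *\<^sub>R \<xi>) | \<xi>. \<xi> \<in> PD}) \<and>
    lipschitz_inertial_manifold \<Omega> noise_shift D nD PD QD (v_flow e lam \<sigma> F)
      (\<lambda>\<omega>. (\<lambda>x. exp (zOU \<omega>) *\<^sub>R x) ` M \<omega>) \<and>
    (C1_map D nD UNIV norm F \<longrightarrow>
       (\<forall>\<omega>\<in>Om. C1_map PD nD QD nD (\<psi> \<omega>)) \<and>
       C1_inertial_manifold \<Omega> noise_shift D nD PD QD (u_flow e lam \<sigma> F) M \<and>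
       C1_inertial_manifold \<Omega> noise_shift D nD PD QD (v_flow e lam \<sigma> F)
         (\<lambda>\<omega>. (\<lambda>x. exp (zOU \<omega>) *\<^sub>R x) ` M \<omega>))"
proof -
  interpret frac_eigen e lam \<sigma>
    by unfold_locales (use assms in blast)+
  interpret spectral_gap e lam \<sigma> N "beta_exponent lam \<sigma> N L \<mu>" L
    by (rule spectral_gapI) fact+
  interpret marcus e lam \<sigma> N "beta_exponent lam \<sigma> N L \<mu>" L muW muS Om F
  proof unfold_locales
    show "sets muW = sets (path_space wiener_paths)"
      using \<open>wiener_measure muW\<close> by (simp add: wiener_measure_def)
    show "sets muS = sets (path_space subordinator_paths)"
      using \<open>stable_subordinator_law \<alpha> muS\<close> by (simp add: stable_subordinator_law_def)
    show "norm (F u1 - F u2) \<le> L * snorm e lam \<sigma> (u1 - u2)" if "u1 \<in> Adom e lam \<sigma>" "u2 \<in> Adom e lam \<sigma>" for u1 u2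
      using assms that by blast
  qed fact+
  have \<Omega>: "\<Omega> = Omega" by (simp add: \<Omega>_def Omega_def)
  show ?thesis
    unfolding \<Omega> D_def nD_def PD_def QD_def M_def
  proof (intro exI[of _ "\<lambda>\<omega> \<xi>. Ainv \<sigma> (gu \<omega> (Apow e lam \<sigma> \<xi>))"] conjI ballI impI)
    fix \<omega> assume \<omega>: "\<omega> \<in> Om"
    show "lipschitz_map (projP e N ` Adom e lam \<sigma>) (snorm e lam \<sigma>) (projQ e N ` Adom e lam \<sigma>) (snorm e lam \<sigma>)
        (\<lambda>\<xi>. Ainv \<sigma> (gu \<omega> (Apow e lam \<sigma> \<xi>)))"
      by (rule graph_lipschitz_map[OF gu_props[OF \<omega>]])
    show "slow_manifold e lam \<sigma> F (beta_exponent lam \<sigma> N L \<mu>) \<omega> =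
        {\<xi> + Ainv \<sigma> (gu \<omega> (Apow e lam \<sigma> \<xi>)) |\<xi>. \<xi> \<in> projP e N ` Adom e lam \<sigma>}"
      by (rule Ms_graph[OF \<omega>, unfolded graph_def])
    show "(\<lambda>x. exp (zOU \<omega>) *\<^sub>R x) ` slow_manifold e lam \<sigma> F (beta_exponent lam \<sigma> N L \<mu>) \<omega> =
        {\<xi> + exp (zOU \<omega>) *\<^sub>R Ainv \<sigma> (gu \<omega> (Apow e lam \<sigma> (exp (- zOU \<omega>) *\<^sub>R \<xi>))) |\<xi>. \<xi> \<in> projP e N ` Adom e lam \<sigma>}"
      by (rule Mv_explicit[OF \<omega>])
  qed (rule psi_measurable u_lipschitz_manifold v_lipschitz_manifold gu_C1_map u_C1_manifold v_C1_manifold; assumption)+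
qed

end
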